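(* Let $G=(V,E)$ be a directed acyclic graph with $n$ vertices, $m$ edges and real (positive or negative) edge weights. There is an algorithm that solves the all-pairs shortest paths problem on $G$, i.e., computes the shortest-path distances between all ordered pairs of vertices together with, for every $v\in V$, the tree $T_v$ (given by storing for each ancestor $u$ of $v$ its successor in $T_v$), in time $$O\Big(\min\{n^{\omega},\, nm+n^2\log n\}+\sum_{v\in V}\mathrm{indeg}(v)\,|\mathrm{leaf}(T_v)|\Big),$$ where $T_v$ is defined with respect to the numbering $v_1,\dots,v_n$ of $V$ chosen by the algorithm, which extends the topological order and assigns the lowest numbers to the source vertices.
   Context: $\omega$ denotes the exponent of fast $n\times n$ matrix multiplication, and $\mathrm{indeg}(v)$ is the indegree of $v$. A vertex $u$ is an ancestor of $v$ if there is a directed path from $u$ to $v$, and a direct ancestor if $(u,v)\in E$. Fix a numbering $v_1,\dots,v_n$ of the vertices extending the topological order (every edge $(v_i,v_j)$ has $i<j$). A shortest directed path $P$ from $v_k$ to $v_i$ is lexicographically first if the direct ancestor $v_j$ of $v_i$ on $P$ has the smallest index $j$ among all direct ancestors of $v_i$ lying on shortest paths from $v_k$ to $v_i$, and the subpath of $P$ from $v_k$ to $v_j$ is the lexicographically-first shortest path from $v_k$ to $v_j$. For a vertex $v$, $T_v$ is the union of the lexicographically-first shortest paths from all ancestors of $v$ to $v$; it is a tree with $v$ as its root (sink), and $\mathrm{leaf}(T_v)$ is its set of leaves. *)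

theory Defs
  imports Complex_Main "Graph_Theory.Shortest_Path"
begin

section \<open>The machine model: a unit-cost real RAM with logarithmic words\<close>

text \<open>
  Programs are structured while programs over finitely many named arrays of machine words
  (natural numbers) and of real numbers; a scalar variable is cell 0 of an array.  Real numbers are
  only subject to field operations and comparisons, in particular there is no rounding and no
  conversion between reals and words.  The only real constants are integers.
\<close>

type_synonym vname = string

record state =
  words :: "vname \<Rightarrow> nat \<Rightarrow> nat"
  reals :: "vname \<Rightarrow> nat \<Rightarrow> real"

datatype nexp =
    NLit nat
  | NCell vname nexp
  | NAdd nexp nexp
  | NSub nexp nexp
  | NMul nexp nexp
  | NDiv nexp nexp
  | NMod nexp nexp

datatype rexp =
    RLit int
  | RCell vname nexp
  | RAdd rexp rexp
  | RSub rexp rexp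
  | RMul rexp rexp
  | RDiv rexp rexp

datatype bexp =
    NLess nexp nexp
  | RLess rexp rexp
  | BNot bexp
  | BAnd bexp bexp

datatype com =
    Skip
  | NAssign vname nexp nexp  \<comment> \<open>array, index, value\<close>
  | RAssign vname nexp rexp  \<comment> \<open>array, index, value\<close>
  | Seq com com
  | Cond bexp com com
  | While bexp com

primrec nval :: "nexp \<Rightarrow> state \<Rightarrow> nat" where
  "nval (NLit k) s = k"
| "nval (NCell a i) s = words s a (nval i s)"
| "nval (NAdd x y) s = nval x s + nval y s"
| "nval (NSub x y) s = nval x s - nval y s"
| "nval (NMul x y) s = nval x s * nval y s"
| "nval (NDiv x y) s = nval x s div nval y s"
| "nval (NMod x y) s = nval x s mod nval y s"

primrec rval :: "rexp \<Rightarrow> state \<Rightarrow> real" where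
  "rval (RLit k) s = of_int k"
| "rval (RCell a i) s = reals s a (nval i s)"
| "rval (RAdd x y) s = rval x s + rval y s"
| "rval (RSub x y) s = rval x s - rval y s"
| "rval (RMul x y) s = rval x s * rval y s"
| "rval (RDiv x y) s = rval x s / rval y s"

primrec bval :: "bexp \<Rightarrow> state \<Rightarrow> bool" where
  "bval (NLess x y) s \<longleftrightarrow> nval x s < nval y s"
| "bval (RLess x y) s \<longleftrightarrow> rval x s < rval y s"
| "bval (BNot b) s \<longleftrightarrow> \<not> bval b s"
| "bval (BAnd b c) s \<longleftrightarrow> bval b s \<and> bval c s"

text \<open>
  \<open>run W c s t s'\<close>: started in state \<open>s\<close>, program \<open>c\<close> halts in state \<open>s'\<close> after \<open>t\<close> steps, and never
  stores a word larger than \<open>W\<close> (storing a larger word gets stuck).  Every elementary command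
  and every test costs one step.  As the expressions in a program have fixed size, charging for
  each of their operations instead would only change \<open>t\<close> by a constant factor depending
  on \<open>c\<close>; for the same reason all intermediate values are polynomial in \<open>W\<close>.
\<close>

inductive run :: "nat \<Rightarrow> com \<Rightarrow> state \<Rightarrow> nat \<Rightarrow> state \<Rightarrow> bool" for W where
  Skip: "run W Skip s 1 s"
| NAssign: "nval e s \<le> W \<Longrightarrow>
    run W (NAssign a i e) s 1 (s\<lparr>words := (words s)(a := (words s a)(nval i s := nval e s))\<rparr>)"
| RAssign:
    "run W (RAssign a i e) s 1 (s\<lparr>reals := (reals s)(a := (reals s a)(nval i s := rval e s))\<rparr>)"
| Seq: "run W c s t s' \<Longrightarrow> run W d s' t' s'' \<Longrightarrow> run W (Seq c d) s (t + t') s''"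
| CondTrue: "bval b s \<Longrightarrow> run W c s t s' \<Longrightarrow> run W (Cond b c d) s (1 + t) s'"
| CondFalse: "\<not> bval b s \<Longrightarrow> run W d s t s' \<Longrightarrow> run W (Cond b c d) s (1 + t) s'"
| WhileFalse: "\<not> bval b s \<Longrightarrow> run W (While b c) s 1 s"
| WhileTrue: "bval b s \<Longrightarrow> run W c s t s' \<Longrightarrow> run W (While b c) s' t' s'' \<Longrightarrow>
    run W (While b c) s (1 + t + t') s''"


section \<open>The exponent of matrix multiplication\<close>

text \<open>
  Matrices are stored row by row.  Memory other than the input arrays has arbitrary initial
  contents.  The word bound \<open>(n + 2) ^ d\<close> allows words of \<open>O(log n)\<close> bits.
\<close>

definition mm_exponents :: "real set" where
  "mm_exponents = {\<tau>. \<exists>c C d. \<forall>n s. words s ''n'' 0 = n \<longrightarrow>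
     (\<exists>t s'. run ((n + 2) ^ d) c s t s' \<and>
        (\<forall>i<n. \<forall>j<n. reals s' ''C'' (i * n + j) =
           (\<Sum>k<n. reals s ''A'' (i * n + k) * reals s ''B'' (k * n + j))) \<and>
        (1 \<le> n \<longrightarrow> real t \<le> C * real n powr \<tau>))}"

definition mm_omega :: real where
  "mm_omega = Inf mm_exponents"


section \<open>Lexicographically-first shortest paths\<close>

context wf_digraph
begin

text \<open>The numbers assigned to the vertices are \<open>1, \<dots>, n\<close>; sources come first.\<close>

definition source_first_numbering :: "('a \<Rightarrow> nat) \<Rightarrow> bool" where
  "source_first_numbering num \<longleftrightarrow>
     bij_betw num (verts G) {1..card (verts G)} \<and>
     (\<forall>e\<in>arcs G. num (tail G e) < num (head G e)) \<and>
     (\<forall>u\<in>verts G. \<forall>v\<in>verts G. in_degree G u = 0 \<and> in_degree G v \<noteq> 0 \<longrightarrow> num u < num v)"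

definition shortest_awalk :: "'b weight_fun \<Rightarrow> 'a \<Rightarrow> 'b awalk \<Rightarrow> 'a \<Rightarrow> bool" where
  "shortest_awalk w u p v \<longleftrightarrow> awalk u p v \<and> ereal (awalk_cost w p) = \<mu> w u v"

text \<open>
  The minimum ranges over the last-but-one vertices of shortest paths from \<open>u\<close> to \<open>v\<close>.  A direct
  ancestor of \<open>v\<close> that occurs on such a path only at an earlier position does not take part.
\<close>

inductive lex_first :: "'b weight_fun \<Rightarrow> ('a \<Rightarrow> nat) \<Rightarrow> 'a \<Rightarrow> 'b awalk \<Rightarrow> 'a \<Rightarrow> bool"
  for w num u where
  Nil: "u \<in> verts G \<Longrightarrow> lex_first w num u [] u"
| snoc: "lex_first w num u p (tail G e) \<Longrightarrow> shortest_awalk w u (p @ [e]) v \<Longrightarrow>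
    (\<And>q f. shortest_awalk w u (q @ [f]) v \<Longrightarrow> num (tail G e) \<le> num (tail G f)) \<Longrightarrow>
    lex_first w num u (p @ [e]) v"

definition lex_tree :: "'b weight_fun \<Rightarrow> ('a \<Rightarrow> nat) \<Rightarrow> 'a \<Rightarrow> ('a, 'b) pre_digraph" where
  "lex_tree w num v =
     \<lparr>verts = \<Union>{set (awalk_verts u p) | u p. lex_first w num u p v},
      arcs = \<Union>{set p | u p. lex_first w num u p v},
      tail = tail G, head = head G\<rparr>"

end

text \<open>The trees are directed towards their root.\<close>

definition leaves :: "('a, 'b) pre_digraph \<Rightarrow> 'a set" where
  "leaves T = {u \<in> verts T. in_arcs T u = {}}"


section \<open>Input and output of the all-pairs shortest paths problem\<close>

text \<open>The input graph is given by an unordered list of its weighted arcs.\<close>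

definition encodes_graph :: "state \<Rightarrow> (nat, nat) pre_digraph \<Rightarrow> nat weight_fun \<Rightarrow> bool" where
  "encodes_graph s G w \<longleftrightarrow>
     verts G = {..<words s ''n'' 0} \<and> arcs G = {..<words s ''m'' 0} \<and>
     (\<forall>e\<in>arcs G. words s ''tail'' e = tail G e \<and> words s ''head'' e = head G e \<and>
        reals s ''weight'' e = w e)"

text \<open>
  Two-dimensional arrays are stored row by row.  The word array \<open>reach\<close> tells whether the distance
  is finite, and \<open>succ\<close> holds the successor of \<open>u\<close> in the tree of \<open>v\<close> for every ancestor
  \<open>u \<noteq> v\<close> of \<open>v\<close>.
\<close>

definition encodes_apsp_solution :: "state \<Rightarrow> (nat, nat) pre_digraph \<Rightarrow> nat weight_fun \<Rightarrow> bool" where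
  "encodes_apsp_solution s G w \<longleftrightarrow>
     (let n = card (verts G); num = words s ''num'' in
       wf_digraph.source_first_numbering G num \<and>
       (\<forall>u\<in>verts G. \<forall>v\<in>verts G. wf_digraph.\<mu> G w u v =
          (if words s ''reach'' (u * n + v) = 0 then \<infinity>
           else ereal (reals s ''dist'' (u * n + v)))) \<and>
       (\<forall>v\<in>verts G. arcs_ends (wf_digraph.lex_tree G w num v) =
          {(u, words s ''succ'' (u * n + v)) | u. u \<rightarrow>\<^sup>+\<^bsub>G\<^esub> v}))"

definition apsp_bound ::
    "real \<Rightarrow> ('a, 'b) pre_digraph \<Rightarrow> 'b weight_fun \<Rightarrow> ('a \<Rightarrow> nat) \<Rightarrow> real" where
  "apsp_bound \<tau> G w num =
     (let n = real (card (verts G)); m = real (card (arcs G)) in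
       min (n powr \<tau>) (n * m + n ^ 2 * log 2 n) +
       (\<Sum>v\<in>verts G.
          real (in_degree G v) * real (card (leaves (wf_digraph.lex_tree G w num v)))))"

end

theory Submission
  imports Defs
begin

text \<open>
  Vertices are numbered by Kahn's algorithm, whose queue starts with the sources.  The prefixes and
  suffixes of lexicographically-first shortest paths are again lexicographically first, so the last
  arc of the path from \<open>u\<close> to \<open>v\<close> is found by one scan of the in-neighbours of \<open>v\<close>,
  and it serves all vertices on this path.  Hence \<open>T\<^sub>v\<close> is built by visiting the ancestors of
  \<open>v\<close> in topological order, scanning only for those not yet covered by an earlier path and then
  following the path until it meets the tree.  A scan happens only at leaves of \<open>T\<^sub>v\<close>.

  The ancestors come from the transitive closure.  As the adjacency matrix is upper triangular, the
  closure of a diagonal block is assembled from those of its two halves with two multiplications of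
  half the size.  Entries stay nonnegative reals that are positive exactly on reachable pairs, so no
  rounding to Boolean matrices is needed.  To reach the minimum with \<open>n m\<close> without computing
  \<open>n powr \<tau>\<close> (\<open>\<tau>\<close> is an arbitrary real), this program runs on a clock with budget
  \<open>n m + n\<^sup>2\<close> and is replaced by the elementary closure algorithm when it is interrupted.

  Matrix multiplication must write \<open>n\<^sup>2\<close> cells, so every exponent is at least 2 and absorbs all
  quadratic terms; the naive algorithm shows that \<open>mm_omega\<close> is the infimum of a nonempty set.
\<close>

section \<open>Time-bounded weakest preconditions\<close>

text \<open>What makes one scan per path sufficient is an exchange argument: in a shortest path from
  \<open>u\<close> through \<open>x\<close> to \<open>v\<close>, the part after \<open>x\<close> may
  be replaced by any other shortest path from \<open>x\<close> to \<open>v\<close>, so every arc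
  that competes for the last position from \<open>x\<close> also competes from \<open>u\<close>.
  Therefore all vertices of the path share the last arc, with tail \<open>t\<close> say. The
  distance and the successor of each \<open>x\<close> on the path with respect to \<open>v\<close>
  are then read off in constant time from the entries for \<open>t\<close>, which are final because
  the targets are treated in topological order too. The multiplication program is only known to
  exist. Its arrays are therefore renamed apart, and its running time, available to the proof but
  not to the program, is limited from outside. Counting loop iterations instead of steps keeps this
  simple, as a loop-free stretch has bounded length. The budget can do without a logarithm because
  log n is at least 1 for n \<ge> 2. All costs outside the closure and the scans are O(n^2), which
  both arguments of the minimum absorb.\<close>

definition setw :: "vname \<Rightarrow> nat \<Rightarrow> nat \<Rightarrow> state \<Rightarrow> state" where
  "setw a i x s = s\<lparr>words := (words s)(a := (words s a)(i := x))\<rparr>"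

definition setr :: "vname \<Rightarrow> nat \<Rightarrow> real \<Rightarrow> state \<Rightarrow> state" where
  "setr a i x s = s\<lparr>reals := (reals s)(a := (reals s a)(i := x))\<rparr>"

lemma set_sel [simp]:
  "words (setw a i x s) b = (if b = a then (words s a)(i := x) else words s b)"
  "reals (setw a i x s) b = reals s b"
  "reals (setr a i y s) b = (if b = a then (reals s a)(i := y) else reals s b)"
  "words (setr a i y s) b = words s b"
  by (auto simp: setw_def setr_def)

text \<open>The postcondition sees the number of steps, so correctness and running time are proved
  together; the existential form also asserts termination within the word bound
  \<open>W\<close>.\<close>

definition wp :: "nat \<Rightarrow> com \<Rightarrow> (nat \<Rightarrow> state \<Rightarrow> bool) \<Rightarrow> state \<Rightarrow> bool" where
  "wp W c Q s \<longleftrightarrow> (\<exists>t s'. run W c s t s' \<and> Q t s')"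

lemmas run_intros = run.intros[unfolded One_nat_def add_Suc add_0]

inductive_cases run_SkipE: "run W Skip s t s'"
inductive_cases run_NAssignE: "run W (NAssign a i e) s t s'"
inductive_cases run_RAssignE: "run W (RAssign a i e) s t s'"
inductive_cases run_SeqE: "run W (Seq c d) s t s'"
inductive_cases run_CondE: "run W (Cond b c d) s t s'"

lemma wp_Skip [simp]: "wp W Skip Q s \<longleftrightarrow> Q 1 s"
  unfolding wp_def by (auto intro: run_intros elim: run_SkipE)

lemma wp_NAssign [simp]:
  "wp W (NAssign a i e) Q s \<longleftrightarrow> nval e s \<le> W \<and> Q 1 (setw a (nval i s) (nval e s) s)"
  unfolding wp_def setw_def by (auto intro: run_intros elim: run_NAssignE)

lemma wp_RAssign [simp]:
  "wp W (RAssign a i e) Q s \<longleftrightarrow> Q 1 (setr a (nval i s) (rval e s) s)"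
  unfolding wp_def setr_def by (auto intro: run_intros elim: run_RAssignE)

lemma wp_Seq [simp]: "wp W (Seq c d) Q s \<longleftrightarrow> wp W c (\<lambda>t. wp W d (\<lambda>t'. Q (t + t'))) s"
  unfolding wp_def by (blast intro: run.Seq elim: run_SeqE)

lemma wp_Seq_eta: "wp W (Seq c d) Q = wp W c (\<lambda>t. wp W d (\<lambda>t'. Q (t + t')))"
  by (simp add: fun_eq_iff)

lemma wp_Cond [simp]: "wp W (Cond b c d) Q s \<longleftrightarrow>
   (if bval b s then wp W c (\<lambda>t. Q (1 + t)) s else wp W d (\<lambda>t. Q (1 + t)) s)"
  unfolding wp_def by (auto intro: run_intros elim!: run_CondE)

lemma wp_mono: "wp W c P s \<Longrightarrow> (\<And>t s'. P t s' \<Longrightarrow> Q t s') \<Longrightarrow> wp W c Q s"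
  unfolding wp_def by blast

text \<open>For embedding the multiplication program: its word bound depends on the block size and
  has to be raised to that of the whole computation.\<close>

lemma run_mono: "run W c s t s' \<Longrightarrow> W \<le> W' \<Longrightarrow> run W' c s t s'"
  proof (induction rule: run.induct)
  case (NAssign e s a i)
  then show ?case using run.NAssign[of e s W' a i] by simp
qed (blast intro: run.intros)+

text \<open>Amortised rule: the drop of the natural number \<open>\<Phi>\<close> pays for the test
  and the body, which also gives termination. The extra step in the postcondition is the last,
  failing test.\<close>

lemma wp_While:
  assumes "I s"
    and step: "\<And>s. I s \<Longrightarrow> bval b s \<Longrightarrow> wp W c (\<lambda>t s'. I s' \<and> 1 + t + \<Phi> s' \<le> (\<Phi> s :: nat)) s"
    and post: "\<And>t s'. I s' \<Longrightarrow> \<not> bval b s' \<Longrightarrow> t + \<Phi> s' \<le> Suc (\<Phi> s) \<Longrightarrow> Q t s'"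
  shows "wp W (While b c) Q s"
proof -
  have "\<exists>t s'. run W (While b c) s t s' \<and> I s' \<and> \<not> bval b s' \<and> t + \<Phi> s' \<le> Suc (\<Phi> s)"
    using \<open>I s\<close>
  proof (induction "\<Phi> s" arbitrary: s rule: less_induct)
    case less
    show ?case
    proof (cases "bval b s")
      case True
      from step[OF less.prems True] obtain t s' where
        1: "run W c s t s'" "I s'" "1 + t + \<Phi> s' \<le> \<Phi> s" unfolding wp_def by blast
      then have "\<Phi> s' < \<Phi> s" by simp
      from less.hyps[OF this 1(2)] obtain t' s'' where
        2: "run W (While b c) s' t' s''" "I s''" "\<not> bval b s''" "t' + \<Phi> s'' \<le> Suc (\<Phi> s')" by blast
      have "run W (While b c) s (1 + t + t') s''" using True 1 2 by (blast intro: run.WhileTrue)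
      with 1 2 show ?thesis by (intro exI[of _ "1 + t + t'"] exI[of _ s'']) simp
    next
      case False
      then show ?thesis using less.prems by (intro exI[of _ 1] exI[of _ s]) (auto intro: run_intros)
    qed
  qed
  then show ?thesis using post unfolding wp_def by blast
qed

section \<open>Frame conditions read off from the program text, and counting loops\<close>

primrec wvars :: "com \<Rightarrow> vname set" where
  "wvars Skip = {}"
| "wvars (NAssign a i e) = {a}"
| "wvars (RAssign a i e) = {}"
| "wvars (Seq c d) = wvars c \<union> wvars d"
| "wvars (Cond b c d) = wvars c \<union> wvars d"
| "wvars (While b c) = wvars c"

primrec rvars :: "com \<Rightarrow> vname set" where
  "rvars Skip = {}"
| "rvars (NAssign a i e) = {}"
| "rvars (RAssign a i e) = {a}"
| "rvars (Seq c d) = rvars c \<union> rvars d"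
| "rvars (Cond b c d) = rvars c \<union> rvars d"
| "rvars (While b c) = rvars c"

definition same :: "vname set \<Rightarrow> vname set \<Rightarrow> state \<Rightarrow> state \<Rightarrow> bool" where
  "same A B s s' \<longleftrightarrow> (\<forall>a. a \<notin> A \<longrightarrow> words s' a = words s a) \<and> (\<forall>a. a \<notin> B \<longrightarrow> reals s' a = reals s a)"

lemma sameD:
  "same A B s s' \<Longrightarrow> a \<notin> A \<Longrightarrow> words s' a = words s a"
  "same A B s s' \<Longrightarrow> a \<notin> B \<Longrightarrow> reals s' a = reals s a"
  by (auto simp: same_def)

lemma same_refl [simp]: "same A B s s"
  by (simp add: same_def)

lemma same_trans: "same A B s s' \<Longrightarrow> same A B s' s'' \<Longrightarrow> same A B s s''"
  by (simp add: same_def)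

lemma same_mono: "same A B s s' \<Longrightarrow> A \<subseteq> A' \<Longrightarrow> B \<subseteq> B' \<Longrightarrow> same A' B' s s'"
  by (auto simp: same_def)

lemma run_same: "run W c s t s' \<Longrightarrow> same (wvars c) (rvars c) s s'"
  by (induction rule: run.induct) (auto simp: same_def)

text \<open>Any postcondition may be strengthened by the syntactic frame condition, so invariants
  need not mention arrays that a program never writes.\<close>

lemma wp_same:
  assumes "wp W c P s" "\<And>t s'. same (wvars c) (rvars c) s s' \<Longrightarrow> P t s' \<Longrightarrow> Q t s'"
  shows "wp W c Q s"
  using assms run_same unfolding wp_def by blast

abbreviation V :: "vname \<Rightarrow> nexp" where "V x \<equiv> NCell x (NLit 0)"

abbreviation Var_assign :: "vname \<Rightarrow> nexp \<Rightarrow> com" where "Var_assign x e \<equiv> NAssign x (NLit 0) e"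

definition For :: "vname \<Rightarrow> nexp \<Rightarrow> com \<Rightarrow> com" where
  "For i e c = Seq (Var_assign i (NLit 0)) (While (NLess (V i) e) (Seq c (Var_assign i (NAdd (V i) (NLit 1)))))"

lemma vars_For [simp]:
  "wvars (For i e c) = insert i (wvars c)" "rvars (For i e c) = rvars c"
  by (auto simp: For_def)

text \<open>An iteration may take \<open>K\<close> steps beyond what \<open>\<Phi>\<close> pays,
  plus test and increment, hence \<open>K + 2\<close>; the final 2 covers the initialisation and the
  failing test. The limit \<open>e\<close> is evaluated at every test, so it has to be constant
  under the frame condition of the loop.\<close>

lemma wp_For_potential:
  fixes \<Phi> :: "nat \<Rightarrow> state \<Rightarrow> nat"
  assumes i: "i \<notin> wvars c" and n: "n \<le> W"
    and e: "\<And>s. same (insert i (wvars c)) (rvars c) s0 s \<Longrightarrow> nval e s = n"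
    and init: "I 0 (setw i 0 0 s0)"
    and step: "\<And>k s. k < n \<Longrightarrow> same (insert i (wvars c)) (rvars c) s0 s \<Longrightarrow> words s i 0 = k \<Longrightarrow> I k s \<Longrightarrow>
       wp W c (\<lambda>t s'. I (Suc k) (setw i 0 (Suc k) s') \<and>
          t + \<Phi> (Suc k) (setw i 0 (Suc k) s') \<le> \<Phi> k s + K) s"
    and post: "\<And>t s. same (insert i (wvars c)) (rvars c) s0 s \<Longrightarrow> words s i 0 = n \<Longrightarrow> I n s \<Longrightarrow>
       t + \<Phi> n s \<le> \<Phi> 0 (setw i 0 0 s0) + n * (K + 2) + 2 \<Longrightarrow> Q t s"
  shows "wp W (For i e c) Q s0"
proof -
  let ?S = "same (insert i (wvars c)) (rvars c) s0"
  define J where "J s \<longleftrightarrow> (?S s \<and> words s i 0 \<le> n \<and> I (words s i 0) s)" for s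
  define \<Psi> where "\<Psi> s = \<Phi> (words s i 0) s + (n - words s i 0) * (K + 2)" for s
  let ?s1 = "setw i 0 0 s0"
  have J0: "J ?s1" unfolding J_def using init by (auto simp: same_def)
  have "wp W (While (NLess (V i) e) (Seq c (Var_assign i (NAdd (V i) (NLit 1))))) (\<lambda>t. Q (Suc t)) ?s1"
  proof (rule wp_While[where I = J and \<Phi> = \<Psi>])
    show "J ?s1" by (fact J0)
  next
    fix s assume "J s" "bval (NLess (V i) e) s"
    then have S: "?S s" and I: "I (words s i 0) s" and lt: "words s i 0 < n"
      using e unfolding J_def by auto
    let ?k = "words s i 0"
    show "wp W (Seq c (Var_assign i (NAdd (V i) (NLit 1)))) (\<lambda>t s'. J s' \<and> 1 + t + \<Psi> s' \<le> \<Psi> s) s"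
      unfolding wp_Seq
    proof (rule wp_same[OF step[OF lt S refl I]])
      fix t s' assume sm: "same (wvars c) (rvars c) s s'"
        and *: "I (Suc ?k) (setw i 0 (Suc ?k) s') \<and> t + \<Phi> (Suc ?k) (setw i 0 (Suc ?k) s') \<le> \<Phi> ?k s + K"
      have k': "words s' i 0 = ?k" using sameD(1)[OF sm i] by simp
      have S': "?S (setw i 0 (Suc ?k) s')" using S sm by (auto simp: same_def)
      \<comment> \<open>\<open>R\<close> hides the product with the number of remaining iterations,
        which leaves a linear goal.\<close>
      define R where "R = (n - Suc ?k) * (K + 2)"
      have "(n - ?k) * (K + 2) = R + (K + 2)" unfolding R_def using lt
        by (metis Suc_diff_Suc add.commute mult_Suc)
      with R_def[symmetric] show "wp W (Var_assign i (NAdd (V i) (NLit 1))) (\<lambda>t' s'. J s' \<and> 1 + (t + t') + \<Psi> s' \<le> \<Psi> s) s'"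
        using * S' lt n k' by (simp add: J_def \<Psi>_def del: mult_Suc mult_Suc_right add_mult_distrib2)
    qed
  next
    fix t s' assume "J s'" "\<not> bval (NLess (V i) e) s'" and t: "t + \<Psi> s' \<le> Suc (\<Psi> ?s1)"
    then have S: "?S s'" and k: "words s' i 0 = n" and I: "I n s'"
      using e unfolding J_def by auto
    show "Q (Suc t) s'" using post[OF S k I] t k by (simp add: \<Psi>_def)
  qed
  then show ?thesis by (simp add: For_def)
qed

lemma wp_For:
  assumes "i \<notin> wvars c" and "n \<le> W"
    and "\<And>s. same (insert i (wvars c)) (rvars c) s0 s \<Longrightarrow> nval e s = n"
    and "I 0 (setw i 0 0 s0)"
    and step: "\<And>k s. k < n \<Longrightarrow> same (insert i (wvars c)) (rvars c) s0 s \<Longrightarrow> words s i 0 = k \<Longrightarrow> I k s \<Longrightarrow>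
       wp W c (\<lambda>t s'. I (Suc k) (setw i 0 (Suc k) s') \<and> t \<le> K) s"
    and "\<And>t s. same (insert i (wvars c)) (rvars c) s0 s \<Longrightarrow> words s i 0 = n \<Longrightarrow> I n s \<Longrightarrow>
       t \<le> n * (K + 2) + 2 \<Longrightarrow> Q t s"
  shows "wp W (For i e c) Q s0"
proof (rule wp_For_potential[where \<Phi> = "\<lambda>_ _. 0" and K = K and I = I and n = n])
  fix k s
  assume "k < n" "same (insert i (wvars c)) (rvars c) s0 s" "words s i 0 = k" "I k s"
  from step[OF this] show "wp W c (\<lambda>t s'. I (Suc k) (setw i 0 (Suc k) s') \<and> t + 0 \<le> 0 + K) s" by simp
qed (use assms in auto)

section \<open>Lexicographically-first shortest paths in numbered graphs\<close>

locale numbered_dag = digraph G for G :: "('a, 'b) pre_digraph" (structure) +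
  fixes w :: "'b weight_fun" and num :: "'a \<Rightarrow> nat"
  assumes num_inj: "inj_on num (verts G)"
    and num_less: "e \<in> arcs G \<Longrightarrow> num (tail G e) < num (head G e)"
begin

definition dst :: "'a \<Rightarrow> 'a \<Rightarrow> real" where
  "dst u v = real_of_ereal (\<mu> w u v)"

lemma awalk_num_le: "awalk u p v \<Longrightarrow> num u \<le> num v"
proof (induction p arbitrary: u)
  case (Cons e p)
  then have "e \<in> arcs G" "u = tail G e" "num (head G e) \<le> num v" by (auto simp: awalk_Cons_iff)
  then show ?case using num_less[of e] by simp
qed (simp add: awalk_Nil_iff)

lemma awalk_num_less: "awalk u p v \<Longrightarrow> p \<noteq> [] \<Longrightarrow> num u < num v"
proof (cases p)
  case (Cons e q)
  assume "awalk u p v"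
  with Cons have "e \<in> arcs G" "u = tail G e" "awalk (head G e) q v" by (simp_all add: awalk_Cons_iff)
  then show ?thesis using num_less[of e] awalk_num_le[of "head G e" q v] by simp
qed simp

lemma closed_awalk_Nil: "awalk u p u \<Longrightarrow> p = []"
  using awalk_num_less by blast

text \<open>Numbers increase along arcs, so a closed walk is empty; negative weights cannot create a
  negative cycle and the minimum is attained.\<close>

lemma ex_shortest_awalk: "u \<rightarrow>\<^sup>* v \<Longrightarrow> \<exists>p. shortest_awalk w u p v"
proof -
  assume r: "u \<rightarrow>\<^sup>* v"
  have "\<exists>p. apath u p v \<and> \<mu> w u v = awalk_cost w p"
    by (rule no_neg_cyc_reach_imp_path[OF r]) (metis awalk_cost_Nil closed_awalk_Nil less_irrefl)
  then show ?thesis unfolding shortest_awalk_def apath_def by metis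
qed

lemma mu_eq: "u \<rightarrow>\<^sup>* v \<Longrightarrow> \<mu> w u v = ereal (dst u v)"
  using ex_shortest_awalk unfolding shortest_awalk_def dst_def by (metis real_of_ereal.simps(1))

lemma shortest_awalk_iff: "shortest_awalk w u p v \<longleftrightarrow> awalk u p v \<and> awalk_cost w p = dst u v"
proof -
  have "awalk u p v \<Longrightarrow> \<mu> w u v = ereal (dst u v)" using mu_eq reachable_awalk by blast
  then show ?thesis unfolding shortest_awalk_def by auto
qed

lemma dst_le: "awalk u p v \<Longrightarrow> dst u v \<le> awalk_cost w p"
  using min_cost_le_walk_cost[of u p v w] mu_eq reachable_awalk by (metis ereal_less_eq(3))

lemma dst_self: "u \<in> verts G \<Longrightarrow> dst u u = 0"
  using ex_shortest_awalk[of u u] shortest_awalk_iff closed_awalk_Nil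
  by (metis awalk_cost_Nil reachable_refl)

text \<open>A cheaper walk from the intermediate vertex would give a cheaper walk from
  \<open>u\<close>.\<close>

lemma shortest_suffix:
  assumes "shortest_awalk w u (a @ b) v"
  shows "shortest_awalk w (awlast u a) b v"
proof -
  have ab: "awalk u a (awlast u a)" "awalk (awlast u a) b v"
    using assms by (auto simp: shortest_awalk_iff)
  then have "awlast u a \<rightarrow>\<^sup>* v" using reachable_awalk by blast
  then obtain q where q: "shortest_awalk w (awlast u a) q v" using ex_shortest_awalk by blast
  then have "awalk u (a @ q) v" using ab by (auto simp: shortest_awalk_iff)
  from dst_le[OF this] dst_le[OF ab(2)] show ?thesis
    using assms q ab by (auto simp: shortest_awalk_iff)
qed

text \<open>The exchange step: both suffixes cost the distance from the intermediate vertex to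
  \<open>v\<close>.\<close>

lemma shortest_replace_suffix:
  assumes "shortest_awalk w u (a @ b) v" "shortest_awalk w (awlast u a) b' v"
  shows "shortest_awalk w u (a @ b') v"
  using assms shortest_suffix[OF assms(1)] by (auto simp: shortest_awalk_iff)

lemma shortest_snoc_iff:
  "shortest_awalk w u (q @ [e]) v \<longleftrightarrow>
     e \<in> arcs G \<and> head G e = v \<and> shortest_awalk w u q (tail G e) \<and> dst u (tail G e) + w e = dst u v"
  (is "?L \<longleftrightarrow> ?R")
proof
  assume L: ?L
  then have e: "e \<in> arcs G" "head G e = v" "awalk u q (tail G e)"
    by (auto simp: shortest_awalk_iff awalk_simps)
  then have "u \<rightarrow>\<^sup>* tail G e" using reachable_awalk by blast
  then obtain r where r: "shortest_awalk w u r (tail G e)" using ex_shortest_awalk by blast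
  then have "awalk u (r @ [e]) v" using e by (auto simp: shortest_awalk_iff awalk_simps)
  from dst_le[OF this] dst_le[OF e(3)] show ?R using L r e by (auto simp: shortest_awalk_iff)
next
  assume ?R then show ?L by (auto simp: shortest_awalk_iff awalk_simps)
qed

text \<open>The arcs that can end a shortest path, described by the Bellman equation alone. The scan
  can test this condition once the distances to the in-neighbours of \<open>v\<close> are
  known.\<close>

definition last_arc :: "'a \<Rightarrow> 'a \<Rightarrow> 'b \<Rightarrow> bool" where
  "last_arc u v e \<longleftrightarrow> e \<in> arcs G \<and> head G e = v \<and> u \<rightarrow>\<^sup>* tail G e \<and> dst u (tail G e) + w e = dst u v"

lemma ex_shortest_snoc: "(\<exists>q. shortest_awalk w u (q @ [e]) v) \<longleftrightarrow> last_arc u v e"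
  unfolding shortest_snoc_iff last_arc_def using ex_shortest_awalk
  by (auto simp: shortest_awalk_iff reachable_awalk)

lemma awalk_neq_ex_snoc: "awalk u p v \<Longrightarrow> u \<noteq> v \<Longrightarrow> \<exists>q e. p = q @ [e]"
  by (cases p rule: rev_cases) (auto simp: awalk_simps)

lemma ex_last_arc:
  assumes "u \<rightarrow>\<^sup>+ v"
  shows "\<exists>e. last_arc u v e \<and> (\<forall>f. last_arc u v f \<longrightarrow> num (tail G e) \<le> num (tail G f))"
proof -
  obtain p where p: "awalk u p v" "p \<noteq> []" using assms reachable1_awalk by blast
  then have "u \<noteq> v" using closed_awalk_Nil by blast
  moreover obtain r where r: "shortest_awalk w u r v" using ex_shortest_awalk p reachable_awalk by blast
  ultimately obtain q e where "r = q @ [e]" using awalk_neq_ex_snoc shortest_awalk_iff by blast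
  then have "last_arc u v e" using r ex_shortest_snoc by blast
  from ex_has_least_nat[of "last_arc u v" e "\<lambda>e. num (tail G e)", OF this] show ?thesis by blast
qed

text \<open>Equal numbers mean equal tails, and there are no parallel arcs; so breaking ties by
  number determines the arc.\<close>

lemma last_arc_unique:
  assumes "last_arc u v e" "last_arc u v f" "num (tail G e) = num (tail G f)"
  shows "e = f"
proof -
  have "tail G e = tail G f" "head G e = head G f" using assms num_inj
    by (auto simp: last_arc_def dest: inj_onD)
  then show ?thesis using assms no_multi_arcs by (auto simp: last_arc_def arc_to_ends_def)
qed

lemma lex_first_snoc_iff:
  "lex_first w num u p v \<longleftrightarrow> (p = [] \<and> u = v \<and> u \<in> verts G) \<or>
     (\<exists>q e. p = q @ [e] \<and> lex_first w num u q (tail G e) \<and> shortest_awalk w u p v \<and>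
        (\<forall>f. last_arc u v f \<longrightarrow> num (tail G e) \<le> num (tail G f)))"
  unfolding ex_shortest_snoc[symmetric] by (subst lex_first.simps) blast

lemma lex_first_shortest: "lex_first w num u p v \<Longrightarrow> shortest_awalk w u p v"
  by (induction rule: lex_first.induct) (auto simp: shortest_awalk_iff awalk_simps dst_self)

lemma lex_first_unique: "lex_first w num u p v \<Longrightarrow> lex_first w num u p' v \<Longrightarrow> p = p'"
proof (induction arbitrary: p' rule: lex_first.induct)
  case Nil
  then show ?case using closed_awalk_Nil lex_first_shortest shortest_awalk_iff by metis
next
  case (snoc p e v)
  have "u \<noteq> v" using snoc.hyps(2) closed_awalk_Nil shortest_awalk_iff by (metis snoc_eq_iff_butlast)
  then have "p' \<noteq> []"
    using snoc.prems lex_first_shortest shortest_awalk_iff awalk_Nil_iff by metis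
  then obtain q f where p': "p' = q @ [f]" "lex_first w num u q (tail G f)" "shortest_awalk w u p' v"
    "\<forall>f'. last_arc u v f' \<longrightarrow> num (tail G f) \<le> num (tail G f')"
    using snoc.prems lex_first_snoc_iff[of u p' v] by blast
  have e: "last_arc u v e" "last_arc u v f" using snoc.hyps p' ex_shortest_snoc by blast+
  moreover have "num (tail G e) = num (tail G f)" using p' snoc.hyps(3) e ex_shortest_snoc
    by (metis le_antisym)
  ultimately have "e = f" using last_arc_unique by blast
  then show ?case using snoc.IH p' by blast
qed

text \<open>The tail of a last arc has a smaller number than \<open>v\<close>, so the recursion in
  the definition is well-founded.\<close>

lemma ex_lex_first: "u \<rightarrow>\<^sup>* v \<Longrightarrow> \<exists>p. lex_first w num u p v"
proof (induction "num v" arbitrary: v rule: less_induct)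
  case less
  show ?case
  proof (cases "u = v")
    case True
    then show ?thesis using lex_first.Nil less.prems reachable_in_verts by blast
  next
    case False
    then have "u \<rightarrow>\<^sup>+ v" using less.prems reachable_neq_reachable1 by blast
    from ex_last_arc[OF this] obtain e where e: "last_arc u v e"
      "\<forall>f. last_arc u v f \<longrightarrow> num (tail G e) \<le> num (tail G f)" by blast
    then have "num (tail G e) < num v" using num_less by (auto simp: last_arc_def)
    then obtain p where p: "lex_first w num u p (tail G e)" using less.hyps e by (auto simp: last_arc_def)
    then have "shortest_awalk w u (p @ [e]) v"
      using e lex_first_shortest by (auto simp: shortest_snoc_iff last_arc_def)
    then show ?thesis using p e lex_first_snoc_iff[of u "p @ [e]" v] by blast
  qed
qed

text \<open>Dropping an initial segment can only remove competitors: by exchange of suffixes, a last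
  arc from the intermediate vertex is also one from \<open>u\<close>, so the arc that is minimal for
  \<open>u\<close> stays minimal.\<close>

lemma lex_first_suffix: "lex_first w num u (a @ b) v \<Longrightarrow> lex_first w num (awlast u a) b v"
proof (induction b arbitrary: v rule: rev_induct)
  case Nil
  then show ?case using lex_first_shortest[OF Nil] awalk_last_in_verts
    by (auto simp: shortest_awalk_iff intro: lex_first.Nil)
next
  case (snoc e b)
  have S: "shortest_awalk w u (a @ (b @ [e])) v" by (rule lex_first_shortest) (use snoc in simp)
  have 1: "lex_first w num u (a @ b) (tail G e)"
    "\<forall>f. last_arc u v f \<longrightarrow> num (tail G e) \<le> num (tail G f)"
    using snoc.prems lex_first_snoc_iff[of u "a @ b @ [e]" v] by auto
  have "last_arc u v f" if "last_arc (awlast u a) v f" for f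
    using that shortest_replace_suffix[OF S] unfolding ex_shortest_snoc[symmetric]
    by (metis append.assoc)
  with 1 snoc.IH shortest_suffix[OF S] show ?case using lex_first_snoc_iff[of "awlast u a" "b @ [e]" v]
    by blast
qed

section \<open>Predecessors, successors and leaves in the trees\<close>

definition lex_path :: "'a \<Rightarrow> 'a \<Rightarrow> 'b list" where
  "lex_path u v = (THE p. lex_first w num u p v)"

lemma lex_path: "u \<rightarrow>\<^sup>* v \<Longrightarrow> lex_first w num u p v \<longleftrightarrow> p = lex_path u v"
  unfolding lex_path_def using ex_lex_first lex_first_unique by (metis the_equality)

text \<open>Like \<open>sc\<close>, meaningful for proper ancestors \<open>u\<close> of
  \<open>v\<close> only, as the path from \<open>v\<close> to itself is empty.\<close>

definition prd :: "'a \<Rightarrow> 'a \<Rightarrow> 'a" where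
  "prd u v = tail G (last (lex_path u v))"

definition sc :: "'a \<Rightarrow> 'a \<Rightarrow> 'a" where
  "sc u v = head G (hd (lex_path u v))"

lemma reachable1_neq: "u \<rightarrow>\<^sup>+ v \<Longrightarrow> u \<noteq> v"
  using reachable1_awalk closed_awalk_Nil by blast

lemma lex_path_snoc:
  assumes "u \<rightarrow>\<^sup>+ v"
  obtains e where "lex_path u v = lex_path u (tail G e) @ [e]" "last_arc u v e"
    "\<And>f. last_arc u v f \<Longrightarrow> num (tail G e) \<le> num (tail G f)" "prd u v = tail G e"
proof -
  have *: "lex_first w num u (lex_path u v) v" using assms lex_path by blast
  then obtain q e where e: "lex_path u v = q @ [e]" "lex_first w num u q (tail G e)"
    "shortest_awalk w u (lex_path u v) v" "\<forall>f. last_arc u v f \<longrightarrow> num (tail G e) \<le> num (tail G f)"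
    using lex_first_snoc_iff[of u "lex_path u v" v] reachable1_neq[OF assms] by blast
  moreover have l: "last_arc u v e" using e ex_shortest_snoc by metis
  moreover have "q = lex_path u (tail G e)" using e lex_path l by (simp add: last_arc_def)
  ultimately show ?thesis using that by (simp add: prd_def)
qed

lemma lex_path_self: "v \<in> verts G \<Longrightarrow> lex_path v v = []"
  using lex_path[of v v "[]"] lex_first.Nil[of v w num] by simp

lemma prd:
  assumes "u \<rightarrow>\<^sup>+ v"
  obtains e where "e \<in> arcs G" "tail G e = prd u v" "head G e = v" "u \<rightarrow>\<^sup>* prd u v"
    "dst u v = dst u (prd u v) + w e"
  using lex_path_snoc[OF assms] unfolding last_arc_def by metis

text \<open>What the scan relies on: \<open>prd u v\<close> attains the least candidate distance
  and, among ties, the least number.\<close>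

lemma prd_minimal:
  assumes "e \<in> arcs G" "head G e = v" "u \<rightarrow>\<^sup>* tail G e"
  shows "dst u v \<le> dst u (tail G e) + w e"
    and "dst u v = dst u (tail G e) + w e \<Longrightarrow> num (prd u v) \<le> num (tail G e)"
proof -
  obtain p where "shortest_awalk w u p (tail G e)" using ex_shortest_awalk assms by blast
  then show "dst u v \<le> dst u (tail G e) + w e" using dst_le[of u "p @ [e]" v] assms
    by (auto simp: shortest_awalk_iff awalk_simps)
  assume "dst u v = dst u (tail G e) + w e"
  then have l: "last_arc u v e" using assms by (simp add: last_arc_def)
  have "u \<rightarrow>\<^sup>+ v" using assms by (metis in_arcs_imp_in_arcs_ends reachable_adj_trans reachable_reachable1_trans r_into_trancl')
  from lex_path_snoc[OF this] l show "num (prd u v) \<le> num (tail G e)" by metis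
qed

text \<open>Without its last arc the path is the lexicographically-first path to
  \<open>prd u v\<close>. So unless it is a single arc, its first arc is already recorded for that
  earlier target, and the successor is found in constant time.\<close>

lemma sc_eq:
  assumes "u \<rightarrow>\<^sup>+ v"
  shows "sc u v = (if prd u v = u then v else sc u (prd u v))"
proof -
  obtain e where e: "lex_path u v = lex_path u (tail G e) @ [e]" "last_arc u v e" "prd u v = tail G e"
    using lex_path_snoc[OF assms] by metis
  show ?thesis
  proof (cases "prd u v = u")
    case True
    then show ?thesis using e lex_path_self by (auto simp: sc_def last_arc_def)
  next
    case False
    then have "u \<rightarrow>\<^sup>+ tail G e" using e by (auto simp: last_arc_def)
    then have "lex_path u (tail G e) \<noteq> []" by (rule lex_path_snoc) simp
    then show ?thesis using e False by (auto simp: sc_def)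
  qed
qed

lemma lex_path_Cons:
  assumes "u \<rightarrow>\<^sup>+ v"
  obtains e where "lex_path u v = e # lex_path (sc u v) v" "tail G e = u" "head G e = sc u v"
    "e \<in> arcs G" "sc u v \<rightarrow>\<^sup>* v"
proof -
  have "lex_path u v \<noteq> []" using lex_path_snoc[OF assms] by (metis snoc_eq_iff_butlast)
  then obtain e p where p: "lex_path u v = e # p" by (cases "lex_path u v") auto
  have l: "lex_first w num u (e # p) v" using lex_path assms p by (metis reachable1_reachable)
  then have a: "tail G e = u" "e \<in> arcs G" "awalk (head G e) p v"
    by (auto dest!: lex_first_shortest simp: shortest_awalk_iff awalk_simps)
  have "lex_first w num (head G e) p v" using lex_first_suffix[of u "[e]" p v] l by simp
  moreover have r: "head G e \<rightarrow>\<^sup>* v" using a reachable_awalk by blast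
  ultimately have "p = lex_path (head G e) v" using lex_path by blast
  then show ?thesis using that p a r by (auto simp: sc_def)
qed

text \<open>The rest of the path is a nonempty suffix and ends with the same arc. Hence the result
  of a scan for \<open>u\<close> serves every later vertex of the path.\<close>

lemma prd_sc:
  assumes "u \<rightarrow>\<^sup>+ v" "sc u v \<noteq> v"
  shows "sc u v \<rightarrow>\<^sup>+ v" "prd (sc u v) v = prd u v"
proof -
  obtain e where e: "lex_path u v = e # lex_path (sc u v) v" "sc u v \<rightarrow>\<^sup>* v"
    using lex_path_Cons[OF assms(1)] by metis
  then show r: "sc u v \<rightarrow>\<^sup>+ v" using assms by auto
  have "lex_path (sc u v) v \<noteq> []" using lex_path_snoc[OF r] by (metis snoc_eq_iff_butlast)
  then show "prd (sc u v) v = prd u v" using e by (simp add: prd_def)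
qed

lemma sc_reachable: "u \<rightarrow>\<^sup>+ v \<Longrightarrow> sc u v \<rightarrow>\<^sup>* v"
  using lex_path_Cons by metis

lemma num_sc: "u \<rightarrow>\<^sup>+ v \<Longrightarrow> num u < num (sc u v)"
  using lex_path_Cons num_less by metis

text \<open>An arc on any of the paths begins a suffix, which is itself the path of the tail of this
  arc. So every vertex other than the root has exactly one outgoing arc, the first one of its own
  path.\<close>

lemma arcs_ends_lex_tree:
  "arcs_ends (lex_tree w num v) = {(u, sc u v) | u. u \<rightarrow>\<^sup>+ v}"
proof (intro set_eqI iffI; clarify?)
  fix x y assume "(x, y) \<in> arcs_ends (lex_tree w num v)"
  then obtain u p e where "lex_first w num u p v" "e \<in> set p" "x = tail G e" "y = head G e"
    by (auto simp: arcs_ends_def arc_to_ends_def lex_tree_def)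
  then obtain a b where ab: "lex_first w num u (a @ e # b) v" by (metis split_list)
  then have aw: "awalk u a (tail G e)" "e \<in> arcs G" "awalk (head G e) b v"
    by (auto dest!: lex_first_shortest simp: shortest_awalk_iff awalk_simps)
  then have l: "lex_first w num x (e # b) v" using lex_first_suffix[OF ab] \<open>x = _\<close> by auto
  have r: "x \<rightarrow>\<^sup>+ v" using aw reachable1_awalk[of x v] \<open>x = _\<close> by (metis awalk_Cons_iff list.distinct(1))
  then have "e # b = lex_path x v" using lex_path l by blast
  then show "\<exists>u. (x, y) = (u, sc u v) \<and> u \<rightarrow>\<^sup>+ v" using r \<open>y = _\<close> by (metis sc_def list.sel(1))
next
  fix u assume r: "u \<rightarrow>\<^sup>+ v"
  obtain e where e: "lex_path u v = e # lex_path (sc u v) v" "tail G e = u" "head G e = sc u v"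
    using lex_path_Cons[OF r] by metis
  have "lex_first w num u (lex_path u v) v" using lex_path r by blast
  then have "e \<in> arcs (lex_tree w num v)" using e by (force simp: lex_tree_def)
  then show "(u, sc u v) \<in> arcs_ends (lex_tree w num v)" using e
    by (force simp: arcs_ends_def arc_to_ends_def lex_tree_def)
qed

text \<open>For charging scans to leaves: the arcs of the tree lead from vertices to their
  successors, so a vertex that is nobody's successor has no incoming arc.\<close>

lemma leaf_lex_tree:
  assumes "u \<rightarrow>\<^sup>+ v" "\<And>x. x \<rightarrow>\<^sup>+ v \<Longrightarrow> sc x v \<noteq> u"
  shows "u \<in> leaves (lex_tree w num v)"
proof -
  have l: "lex_first w num u (lex_path u v) v" using lex_path assms by blast
  then have "u \<in> set (awalk_verts u (lex_path u v))"
    using hd_in_awalk_verts(1) lex_first_shortest shortest_awalk_iff by blast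
  then have "u \<in> verts (lex_tree w num v)" using l by (auto simp: lex_tree_def)
  moreover have "in_arcs (lex_tree w num v) u = {}"
  proof (rule ccontr)
    assume "in_arcs (lex_tree w num v) u \<noteq> {}"
    then obtain e where "e \<in> arcs (lex_tree w num v)" "head (lex_tree w num v) e = u"
      by (auto simp: in_arcs_def)
    then have "(tail G e, u) \<in> arcs_ends (lex_tree w num v)"
      by (auto simp: arcs_ends_def arc_to_ends_def lex_tree_def)
    then show False using assms(2) by (auto simp: arcs_ends_lex_tree)
  qed
  ultimately show ?thesis by (simp add: leaves_def)
qed

lemma leaves_subset: "leaves (lex_tree w num v) \<subseteq> verts G"
proof
  fix x assume "x \<in> leaves (lex_tree w num v)"
  then obtain u p where "lex_first w num u p v" "x \<in> set (awalk_verts u p)"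
    by (auto simp: leaves_def lex_tree_def)
  then show "x \<in> verts G" using lex_first_shortest shortest_awalk_iff awalk_conv by blast
qed

lemma finite_leaves: "finite (leaves (lex_tree w num v))"
  by (rule finite_subset[OF leaves_subset finite_verts])

end

section \<open>Program transformations\<close>

primrec nnames :: "nexp \<Rightarrow> vname set" where
  "nnames (NLit k) = {}"
| "nnames (NCell a i) = insert a (nnames i)"
| "nnames (NAdd x y) = nnames x \<union> nnames y"
| "nnames (NSub x y) = nnames x \<union> nnames y"
| "nnames (NMul x y) = nnames x \<union> nnames y"
| "nnames (NDiv x y) = nnames x \<union> nnames y"
| "nnames (NMod x y) = nnames x \<union> nnames y"

primrec rnames :: "rexp \<Rightarrow> vname set" where
  "rnames (RLit k) = {}"
| "rnames (RCell a i) = nnames i"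
| "rnames (RAdd x y) = rnames x \<union> rnames y"
| "rnames (RSub x y) = rnames x \<union> rnames y"
| "rnames (RMul x y) = rnames x \<union> rnames y"
| "rnames (RDiv x y) = rnames x \<union> rnames y"

primrec bnames :: "bexp \<Rightarrow> vname set" where
  "bnames (NLess x y) = nnames x \<union> nnames y"
| "bnames (RLess x y) = rnames x \<union> rnames y"
| "bnames (BNot b) = bnames b"
| "bnames (BAnd b c) = bnames b \<union> bnames c"

text \<open>Only the names of word arrays are collected; \<open>clocked\<close> does not use real arrays.\<close>

primrec cnames :: "com \<Rightarrow> vname set" where
  "cnames Skip = {}"
| "cnames (NAssign a i e) = insert a (nnames i \<union> nnames e)"
| "cnames (RAssign a i e) = nnames i \<union> rnames e"
| "cnames (Seq c d) = cnames c \<union> cnames d"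
| "cnames (Cond b c d) = bnames b \<union> cnames c \<union> cnames d"
| "cnames (While b c) = bnames b \<union> cnames c"

lemma nval_setw: "a \<notin> nnames e \<Longrightarrow> nval e (setw a i x s) = nval e s"
  by (induction e) auto

lemma rval_setw: "a \<notin> rnames e \<Longrightarrow> rval e (setw a i x s) = rval e s"
  by (induction e) (auto simp: nval_setw)

lemma bval_setw: "a \<notin> bnames b \<Longrightarrow> bval b (setw a i x s) = bval b s"
  by (induction b) (auto simp: nval_setw rval_setw)

lemma setw_setw: "setw a i x (setw a i y s) = setw a i x s"
  by (simp add: setw_def)

lemma setw_commute: "a \<noteq> b \<Longrightarrow> setw a i x (setw b j y s) = setw b j y (setw a i x s)"
  by (simp add: setw_def fun_upd_twist)

lemma setw_setr: "setw a i x (setr b j y s) = setr b j y (setw a i x s)"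
  by (simp add: setw_def setr_def)

subsection \<open>Interrupting a program\<close>

abbreviation running :: bexp where "running \<equiv> NLess (V ''clock'') (V ''budget'')"

text \<open>
  The clock counts loop iterations, which determine the running time up to a constant factor.
  Word assignments are suppressed once the budget is exhausted, since on the inconsistent data
  left by an aborted loop they might exceed the word bound.
\<close>

primrec clocked :: "com \<Rightarrow> com" where
  "clocked Skip = Skip"
| "clocked (NAssign a i e) = Cond running (NAssign a i e) Skip"
| "clocked (RAssign a i e) = RAssign a i e"
| "clocked (Seq c d) = Seq (clocked c) (clocked d)"
| "clocked (Cond b c d) = Cond b (clocked c) (clocked d)"
| "clocked (While b c) = While (BAnd running b)
     (Seq (Var_assign ''clock'' (NAdd (V ''clock'') (NLit 1))) (clocked c))"

text \<open>Chosen so that the running time is at most \<open>overhead c\<close> times one more than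
  the number of ticks. A word assignment costs 2 because of its guard; the 2 of a loop pays for the
  test and the tick of an iteration.\<close>

primrec overhead :: "com \<Rightarrow> nat" where
  "overhead Skip = 1"
| "overhead (NAssign a i e) = 2"
| "overhead (RAssign a i e) = 1"
| "overhead (Seq c d) = overhead c + overhead d"
| "overhead (Cond b c d) = 1 + overhead c + overhead d"
| "overhead (While b c) = overhead c + 2"

lemma wvars_clocked: "wvars (clocked c) \<subseteq> insert ''clock'' (wvars c)"
  by (induction c) auto

lemma rvars_clocked: "rvars (clocked c) = rvars c"
  by (induction c) auto

text \<open>After expiry every loop ends at its first test and every word assignment is skipped, so
  what remains is loop-free code that halts on arbitrary data.\<close>

lemma clocked_expired:
  assumes "words s ''budget'' 0 \<le> words s ''clock'' 0"
  shows "\<exists>t s'. run W (clocked c) s t s' \<and> t \<le> overhead c \<and>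
    words s' ''clock'' 0 = words s ''clock'' 0 \<and> words s' ''budget'' 0 = words s ''budget'' 0"
  using assms
proof (induction c arbitrary: s)
  case Skip
  then show ?case using wp_Skip[unfolded wp_def] by auto
next
  case (NAssign a i e)
  have "wp W (clocked (NAssign a i e)) (\<lambda>t s'. t \<le> 2 \<and> s' = s) s" using NAssign by simp
  then show ?case unfolding wp_def by auto
next
  case (RAssign a i e)
  have "wp W (clocked (RAssign a i e)) (\<lambda>t s'. t \<le> 1 \<and> words s' = words s) s"
    by (simp add: setr_def)
  then show ?case unfolding wp_def by force
next
  case (Seq c d)
  from Seq.IH(1)[OF Seq.prems] obtain t s' where 1: "run W (clocked c) s t s'" "t \<le> overhead c"
    "words s' ''clock'' 0 = words s ''clock'' 0" "words s' ''budget'' 0 = words s ''budget'' 0" by blast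
  with Seq.prems have "words s' ''budget'' 0 \<le> words s' ''clock'' 0" by simp
  from Seq.IH(2)[OF this] 1 show ?case by (fastforce intro: run.Seq)
next
  case (Cond b c d)
  from Cond.IH(1)[OF Cond.prems] Cond.IH(2)[OF Cond.prems] show ?case
    by (cases "bval b s") (fastforce dest: run_intros(5,6))+
next
  case (While b c)
  then have "run W (clocked (While b c)) s (Suc 0) s" by (auto intro: run_intros)
  then show ?case by fastforce
qed

text \<open>\<open>s0\<close> and \<open>k\<close> are the state and the clock value at the start of
  the clocked run, which ends after \<open>t'\<close> steps in \<open>s'\<close> with clock value
  \<open>k'\<close>; \<open>t\<close> and \<open>s\<close> are the time and the result of the
  original run that it imitates. Nothing is claimed about the data once the budget is used
  up.\<close>

definition clock_spec ::
  "nat \<Rightarrow> nat \<Rightarrow> com \<Rightarrow> state \<Rightarrow> nat \<Rightarrow> nat \<Rightarrow> state \<Rightarrow> nat \<Rightarrow> state \<Rightarrow> nat \<Rightarrow> bool" where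
  "clock_spec W B c s0 k t s t' s' k' \<longleftrightarrow> run W (clocked c) s0 t' s' \<and> k \<le> k' \<and> k' \<le> k + t \<and> k' \<le> B \<and>
     t' \<le> overhead c * (k' - k) + overhead c \<and> words s' ''clock'' 0 = k' \<and> words s' ''budget'' 0 = B \<and>
     (k' < B \<longrightarrow> s' = setw ''clock'' 0 k' s)"

lemma clock_specD:
  assumes "clock_spec W B c s0 k t s t' s' k'"
  shows "run W (clocked c) s0 t' s'" "k \<le> k'" "k' \<le> k + t" "k' \<le> B" "t' \<le> overhead c * (k' - k) + overhead c"
    "words s' ''clock'' 0 = k'" "words s' ''budget'' 0 = B" "k' < B \<longrightarrow> s' = setw ''clock'' 0 k' s"
  using assms by (auto simp: clock_spec_def)

text \<open>As long as ticks remain, the clocked program simulates the original one; when they run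
  out within a sequence or a loop, \<open>clocked_expired\<close> takes over. There are at most
  \<open>t\<close> ticks because an iteration costs the original run a step as well, and
  \<open>B \<le> W\<close> keeps the clock within the word bound.\<close>

lemma run_clocked:
  assumes "run W c s t s'" "''clock'' \<notin> cnames c" "''budget'' \<notin> cnames c"
    and "words s ''budget'' 0 = B" "k < B" "B \<le> W"
  shows "\<exists>t' s'' k'. clock_spec W B c (setw ''clock'' 0 k s) k t s' t' s'' k'"
  using assms
proof (induction arbitrary: k rule: run.induct)
  case (Skip s)
  have "wp W (clocked Skip) (\<lambda>t' s''. t' = 1 \<and> s'' = setw ''clock'' 0 k s) (setw ''clock'' 0 k s)" by simp
  then obtain t' where "t' = 1" "run W (clocked Skip) (setw ''clock'' 0 k s) t' (setw ''clock'' 0 k s)"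
    unfolding wp_def by blast
  then show ?case using Skip
    by (intro exI[of _ t'] exI[of _ "setw ''clock'' 0 k s"] exI[of _ k]) (auto simp: clock_spec_def)
next
  case (NAssign e s a i)
  let ?r = "setw ''clock'' 0 k (setw a (nval i s) (nval e s) s)"
  from NAssign have "wp W (clocked (NAssign a i e)) (\<lambda>t' s''. t' = 2 \<and> s'' = ?r)
     (setw ''clock'' 0 k s)" by (simp add: nval_setw setw_commute)
  then have "run W (clocked (NAssign a i e)) (setw ''clock'' 0 k s) 2 ?r"
    unfolding wp_def by blast
  then show ?case using NAssign
    by (intro exI[of _ 2] exI[of _ ?r] exI[of _ k]) (auto simp: clock_spec_def setw_def)
next
  case (RAssign a i e s)
  let ?r = "setw ''clock'' 0 k (setr a (nval i s) (rval e s) s)"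
  from RAssign have "wp W (clocked (RAssign a i e)) (\<lambda>t' s''. t' = 1 \<and> s'' = ?r)
     (setw ''clock'' 0 k s)" by (simp add: nval_setw rval_setw setw_setr)
  then have "run W (clocked (RAssign a i e)) (setw ''clock'' 0 k s) 1 ?r"
    unfolding wp_def by blast
  then show ?case using RAssign
    by (intro exI[of _ 1] exI[of _ ?r] exI[of _ k]) (auto simp: clock_spec_def setr_def)
next
  case (Seq c s t s' d t' s'')
  have nm: "''clock'' \<notin> cnames c" "''budget'' \<notin> cnames c" "''clock'' \<notin> cnames d" "''budget'' \<notin> cnames d"
    using Seq.prems by auto
  from Seq.IH(1)[OF nm(1,2) Seq.prems(3-5)] obtain t1 s1 k1 where "clock_spec W B c (setw ''clock'' 0 k s) k t s' t1 s1 k1" by blast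
  note 1 = clock_specD[OF this]
  have "\<exists>t2 s2 k2. clock_spec W B d s1 k1 t' s'' t2 s2 k2"
  proof (cases "k1 < B")
    case True
    with 1 have s1: "s1 = setw ''clock'' 0 k1 s'" by blast
    with 1 have "words s' ''budget'' 0 = B" by simp
    from Seq.IH(2)[OF nm(3,4) this True Seq.prems(5)] show ?thesis unfolding s1 .
  next
    case False
    then have "words s1 ''budget'' 0 \<le> words s1 ''clock'' 0" using 1 by simp
    from clocked_expired[OF this, of W d] show ?thesis using 1 False unfolding clock_spec_def by fastforce
  qed
  then obtain t2 s2 k2 where "clock_spec W B d s1 k1 t' s'' t2 s2 k2" by blast
  note 2 = clock_specD[OF this]
  \<comment> \<open>Explicit differences replace the truncated subtractions in the time
    bounds.\<close>
  obtain d1 d2 where d: "k1 = k + d1" "k2 = k1 + d2" using 1(2) 2(2) by (meson le_Suc_ex)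
  have "t1 + t2 \<le> overhead (Seq c d) * (k2 - k) + overhead (Seq c d)"
    using 1(5) 2(5) unfolding d by (simp add: algebra_simps)
  moreover have "run W (clocked (Seq c d)) (setw ''clock'' 0 k s) (t1 + t2) s2"
    using 1 2 by (auto intro: run.Seq)
  ultimately show ?case using 1 2
    by (intro exI[where x = "t1 + t2"], intro exI[where x = s2], intro exI[where x = k2]) (simp add: clock_spec_def)
next
  case (CondTrue b s c t s' d)
  have nm: "''clock'' \<notin> cnames c" "''budget'' \<notin> cnames c" "''clock'' \<notin> bnames b"
    using CondTrue.prems by auto
  from CondTrue.IH[OF nm(1,2) CondTrue.prems(3-5)] obtain t1 s1 k1 where "clock_spec W B c (setw ''clock'' 0 k s) k t s' t1 s1 k1" by blast
  note 1 = clock_specD[OF this]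
  have "run W (clocked (Cond b c d)) (setw ''clock'' 0 k s) (1 + t1) s1"
    unfolding clocked.simps by (rule run.CondTrue) (use 1 CondTrue.hyps nm in \<open>auto simp: bval_setw\<close>)
  moreover have "1 + t1 \<le> overhead (Cond b c d) * (k1 - k) + overhead (Cond b c d)"
    using 1(5) by (simp add: add_mult_distrib)
  ultimately show ?case using 1
    by (intro exI[where x = "1 + t1"], intro exI[where x = s1], intro exI[where x = k1]) (simp add: clock_spec_def)
next
  case (CondFalse b s d t s' c)
  have nm: "''clock'' \<notin> cnames d" "''budget'' \<notin> cnames d" "''clock'' \<notin> bnames b"
    using CondFalse.prems by auto
  from CondFalse.IH[OF nm(1,2) CondFalse.prems(3-5)] obtain t1 s1 k1 where "clock_spec W B d (setw ''clock'' 0 k s) k t s' t1 s1 k1" by blast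
  note 1 = clock_specD[OF this]
  have "run W (clocked (Cond b c d)) (setw ''clock'' 0 k s) (1 + t1) s1"
    unfolding clocked.simps by (rule run.CondFalse) (use 1 CondFalse.hyps nm in \<open>auto simp: bval_setw\<close>)
  moreover have "1 + t1 \<le> overhead (Cond b c d) * (k1 - k) + overhead (Cond b c d)"
    using 1(5) by (simp add: add_mult_distrib)
  ultimately show ?case using 1
    by (intro exI[where x = "1 + t1"], intro exI[where x = s1], intro exI[where x = k1]) (simp add: clock_spec_def)
next
  case (WhileFalse b s c)
  then have "run W (clocked (While b c)) (setw ''clock'' 0 k s) (Suc 0) (setw ''clock'' 0 k s)"
    by (auto intro!: run_intros simp: bval_setw)
  then show ?case using WhileFalse
    by (intro exI[of _ "Suc 0"] exI[of _ "setw ''clock'' 0 k s"] exI[of _ k]) (auto simp: clock_spec_def)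
next
  case (WhileTrue b s c t s' t' s'')
  let ?L = "While b c"
  have nm: "''clock'' \<notin> cnames c" "''budget'' \<notin> cnames c" "''clock'' \<notin> bnames b"
    using WhileTrue.prems by auto
  have tick: "run W (Var_assign ''clock'' (NAdd (V ''clock'') (NLit 1))) (setw ''clock'' 0 k s) (Suc 0)
     (setw ''clock'' 0 (Suc k) s)"
  proof -
    have "wp W (Var_assign ''clock'' (NAdd (V ''clock'') (NLit 1)))
      (\<lambda>t s'. t = Suc 0 \<and> s' = setw ''clock'' 0 (Suc k) s) (setw ''clock'' 0 k s)"
      using WhileTrue.prems by (simp add: setw_setw)
    then show ?thesis by (simp add: wp_def)
  qed
  have g: "bval (BAnd running b) (setw ''clock'' 0 k s)"
    using WhileTrue.prems WhileTrue.hyps nm by (simp add: bval_setw)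
  \<comment> \<open>The tick may itself exhaust the budget before the body starts.\<close>
  have "\<exists>t1 s1 k1. clock_spec W B c (setw ''clock'' 0 (Suc k) s) (Suc k) t s' t1 s1 k1"
  proof (cases "Suc k < B")
    case True
    from WhileTrue.IH(1)[OF nm(1,2) WhileTrue.prems(3) True WhileTrue.prems(5)] show ?thesis .
  next
    case False
    then have "words (setw ''clock'' 0 (Suc k) s) ''budget'' 0 \<le> words (setw ''clock'' 0 (Suc k) s) ''clock'' 0"
      using WhileTrue.prems by simp
    from clocked_expired[OF this, of W c] show ?thesis using WhileTrue.prems False unfolding clock_spec_def by fastforce
  qed
  then obtain t1 s1 k1 where "clock_spec W B c (setw ''clock'' 0 (Suc k) s) (Suc k) t s' t1 s1 k1" by blast
  note 1 = clock_specD[OF this]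
  have "\<exists>t2 s2 k2. clock_spec W B ?L s1 k1 t' s'' t2 s2 k2"
  proof (cases "k1 < B")
    case True
    with 1 have s1: "s1 = setw ''clock'' 0 k1 s'" by blast
    with 1 have "words s' ''budget'' 0 = B" by simp
    from WhileTrue.IH(2)[OF WhileTrue.prems(1,2) this True WhileTrue.prems(5)] show ?thesis unfolding s1 .
  next
    case False
    then have "words s1 ''budget'' 0 \<le> words s1 ''clock'' 0" using 1 by simp
    from clocked_expired[OF this, of W ?L] show ?thesis using 1 False unfolding clock_spec_def by fastforce
  qed
  then obtain t2 s2 k2 where "clock_spec W B ?L s1 k1 t' s'' t2 s2 k2" by blast
  note 2 = clock_specD[OF this]
  have r: "run W (clocked ?L) (setw ''clock'' 0 k s) (1 + (Suc 0 + t1) + t2) s2"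
    unfolding clocked.simps
    by (rule run.WhileTrue[OF g run.Seq[OF tick 1(1)] 2(1)[unfolded clocked.simps]])
  obtain d1 d2 where d: "k1 = Suc k + d1" "k2 = k1 + d2" using 1(2) 2(2) by (meson le_Suc_ex)
  have "1 + (Suc 0 + t1) + t2 \<le> overhead ?L * (k2 - k) + overhead ?L"
    using 1(5) 2(5) unfolding d by (simp add: algebra_simps)
  with r show ?case using 1 2
    by (intro exI[where x = "1 + (Suc 0 + t1) + t2"], intro exI[where x = s2], intro exI[where x = k2]) (simp add: clock_spec_def)
qed

subsection \<open>Renaming variables\<close>

primrec nren :: "(vname \<Rightarrow> vname) \<Rightarrow> nexp \<Rightarrow> nexp" where
  "nren f (NLit k) = NLit k"
| "nren f (NCell a i) = NCell (f a) (nren f i)"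
| "nren f (NAdd x y) = NAdd (nren f x) (nren f y)"
| "nren f (NSub x y) = NSub (nren f x) (nren f y)"
| "nren f (NMul x y) = NMul (nren f x) (nren f y)"
| "nren f (NDiv x y) = NDiv (nren f x) (nren f y)"
| "nren f (NMod x y) = NMod (nren f x) (nren f y)"

primrec rren :: "(vname \<Rightarrow> vname) \<Rightarrow> rexp \<Rightarrow> rexp" where
  "rren f (RLit k) = RLit k"
| "rren f (RCell a i) = RCell (f a) (nren f i)"
| "rren f (RAdd x y) = RAdd (rren f x) (rren f y)"
| "rren f (RSub x y) = RSub (rren f x) (rren f y)"
| "rren f (RMul x y) = RMul (rren f x) (rren f y)"
| "rren f (RDiv x y) = RDiv (rren f x) (rren f y)"

primrec bren :: "(vname \<Rightarrow> vname) \<Rightarrow> bexp \<Rightarrow> bexp" where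
  "bren f (NLess x y) = NLess (nren f x) (nren f y)"
| "bren f (RLess x y) = RLess (rren f x) (rren f y)"
| "bren f (BNot b) = BNot (bren f b)"
| "bren f (BAnd b c) = BAnd (bren f b) (bren f c)"

primrec cren :: "(vname \<Rightarrow> vname) \<Rightarrow> com \<Rightarrow> com" where
  "cren f Skip = Skip"
| "cren f (NAssign a i e) = NAssign (f a) (nren f i) (nren f e)"
| "cren f (RAssign a i e) = RAssign (f a) (nren f i) (rren f e)"
| "cren f (Seq c d) = Seq (cren f c) (cren f d)"
| "cren f (Cond b c d) = Cond (bren f b) (cren f c) (cren f d)"
| "cren f (While b c) = While (bren f b) (cren f c)"

text \<open>The state as the original program sees it when its renamed version runs in
  \<open>s\<close>.\<close>

definition pull :: "(vname \<Rightarrow> vname) \<Rightarrow> state \<Rightarrow> state" where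
  "pull f s = \<lparr>words = words s \<circ> f, reals = reals s \<circ> f\<rparr>"

lemma pull_sel [simp]: "words (pull f s) a = words s (f a)" "reals (pull f s) a = reals s (f a)"
  by (auto simp: pull_def)

lemma nval_nren: "nval (nren f e) s = nval e (pull f s)"
  by (induction e) (auto simp: pull_def)

lemma rval_rren: "rval (rren f e) s = rval e (pull f s)"
  by (induction e) (auto simp: pull_def nval_nren)

lemma bval_bren: "bval (bren f b) s = bval b (pull f s)"
  by (induction b) (auto simp: nval_nren rval_rren)

lemma nnames_nren: "nnames (nren f e) \<subseteq> range f"
  by (induction e) auto

lemma rnames_rren: "rnames (rren f e) \<subseteq> range f"
  by (induction e) (use nnames_nren in auto)

lemma bnames_bren: "bnames (bren f e) \<subseteq> range f"
  by (induction e) (use nnames_nren rnames_rren in auto)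

lemma cnames_cren: "cnames (cren f c) \<subseteq> range f"
  by (induction c) (use nnames_nren rnames_rren bnames_bren in auto)

lemma wvars_cren: "wvars (cren f c) = f ` wvars c"
  by (induction c) auto

lemma rvars_cren: "rvars (cren f c) = f ` rvars c"
  by (induction c) auto

lemma pull_setw: "inj f \<Longrightarrow> pull f (setw (f a) i x s) = setw a i x (pull f s)"
  by (auto simp: pull_def setw_def fun_eq_iff inj_eq)

lemma pull_setr: "inj f \<Longrightarrow> pull f (setr (f a) i x s) = setr a i x (pull f s)"
  by (auto simp: pull_def setr_def fun_eq_iff inj_eq)

text \<open>Injectivity of \<open>f\<close> makes a write to \<open>f a\<close> visible at
  \<open>a\<close> only.\<close>

lemma run_cren:
  assumes "run W c s t s'" "inj f" "s = pull f r"
  shows "\<exists>r'. run W (cren f c) r t r' \<and> s' = pull f r'"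
  using assms
proof (induction arbitrary: r rule: run.induct)
  case (Skip s)
  then show ?case by (auto intro: run_intros)
next
  case (NAssign e s a i)
  then have "run W (cren f (NAssign a i e)) r 1 (setw (f a) (nval i s) (nval e s) r)"
    unfolding setw_def cren.simps by (metis nval_nren run.NAssign)
  then show ?case using NAssign pull_setw by (metis setw_def)
next
  case (RAssign a i e s)
  then have "run W (cren f (RAssign a i e)) r 1 (setr (f a) (nval i s) (rval e s) r)"
    unfolding setr_def cren.simps by (metis nval_nren rval_rren run.RAssign)
  then show ?case using RAssign pull_setr by (metis setr_def)
next
  case (Seq c s t s' d t' s'')
  then show ?case by (metis cren.simps(4) run.Seq)
next
  case (CondTrue b s c t s' d)
  then show ?case by (metis bval_bren cren.simps(5) run.CondTrue)
next
  case (CondFalse b s d t s' c)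
  then show ?case by (metis bval_bren cren.simps(5) run.CondFalse)
next
  case (WhileFalse b s c)
  then show ?case by (metis bval_bren cren.simps(6) run.WhileFalse)
next
  case (WhileTrue b s c t s' t' s'')
  then obtain r1 where r1: "run W (cren f c) r t r1" "s' = pull f r1" by blast
  with WhileTrue obtain r2 where "run W (cren f (While b c)) r1 t' r2" "s'' = pull f r2" by blast
  with r1 WhileTrue show ?case by (metis bval_bren cren.simps(6) run.WhileTrue)
qed

section \<open>Bounds on the exponent of matrix multiplication\<close>

text \<open>A step writes at most one cell, so the number of changed cells is a lower bound for the
  running time.\<close>

lemma run_changed_cells:
  assumes "run W c s t s'"
  shows "finite {i. reals s' a i \<noteq> reals s a i} \<and> card {i. reals s' a i \<noteq> reals s a i} \<le> t"
  using assms
proof (induction rule: run.induct)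
  case (RAssign b i e s)
  have "{j. reals (s\<lparr>reals := (reals s)(b := (reals s b)(nval i s := rval e s))\<rparr>) a j \<noteq> reals s a j} \<subseteq> {nval i s}"
    by auto
  then show ?case using card_mono[of "{nval i s}"] finite_subset[of _ "{nval i s}"] by fastforce
next
  case (Seq c s t s' d t' s'')
  have "{i. reals s'' a i \<noteq> reals s a i} \<subseteq> {i. reals s' a i \<noteq> reals s a i} \<union> {i. reals s'' a i \<noteq> reals s' a i}"
    by auto
  with Seq.IH show ?case
    by (meson add_mono card_Un_le card_mono finite_UnI finite_subset le_trans)
next
  case (WhileTrue b s c t s' t' s'')
  have "{i. reals s'' a i \<noteq> reals s a i} \<subseteq> {i. reals s' a i \<noteq> reals s a i} \<union> {i. reals s'' a i \<noteq> reals s' a i}"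
    by auto
  then have "finite {i. reals s'' a i \<noteq> reals s a i} \<and> card {i. reals s'' a i \<noteq> reals s a i} \<le> t + t'"
    using WhileTrue.IH by (meson add_mono card_Un_le card_mono finite_UnI finite_subset le_trans)
  then show ?case by simp
qed auto

lemma mm_exponent_ge_2:
  assumes "\<tau> \<in> mm_exponents"
  shows "2 \<le> \<tau>"
proof (rule ccontr)
  assume "\<not> 2 \<le> \<tau>"
  obtain c C d where P: "\<And>n s. words s ''n'' 0 = n \<Longrightarrow>
     (\<exists>t s'. run ((n + 2) ^ d) c s t s' \<and>
        (\<forall>i<n. \<forall>j<n. reals s' ''C'' (i * n + j) =
           (\<Sum>k<n. reals s ''A'' (i * n + k) * reals s ''B'' (k * n + j))) \<and>
        (1 \<le> n \<longrightarrow> real t \<le> C * real n powr \<tau>))"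
    using assms unfolding mm_exponents_def by blast
  have bound: "real n ^ 2 \<le> C * real n powr \<tau>" if "1 \<le> n" for n
  proof -
    \<comment> \<open>The product is zero while every cell of \<open>C\<close> holds 1, so all
      \<open>n * n\<close> output cells have to be changed.\<close>
    define s where "s = \<lparr>words = (\<lambda>_ _. n), reals = (\<lambda>a _. if a = ''C'' then 1 else 0 :: real)\<rparr>"
    have "words s ''n'' 0 = n" by (simp add: s_def)
    from P[OF this] that obtain t s' where r: "run ((n + 2) ^ d) c s t s'"
      and z: "\<forall>i<n. \<forall>j<n. reals s' ''C'' (i * n + j) = (\<Sum>k<n. reals s ''A'' (i * n + k) * reals s ''B'' (k * n + j))"
      and t: "real t \<le> C * real n powr \<tau>" by blast
    have "reals s' ''C'' x = 0" if "x < n * n" for x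
    proof -
      have "x div n < n" "x mod n < n" using that by (auto simp: less_mult_imp_div_less)
        (metis mod_less_divisor mult_is_0 neq0_conv not_less_zero)
      with z have "reals s' ''C'' (x div n * n + x mod n) =
        (\<Sum>k<n. reals s ''A'' (x div n * n + k) * reals s ''B'' (k * n + x mod n))" by blast
      then show ?thesis by (simp add: s_def)
    qed
    then have "{..<n * n} \<subseteq> {i. reals s' ''C'' i \<noteq> reals s ''C'' i}" by (auto simp: s_def)
    from card_mono[OF _ this] run_changed_cells[OF r, of "''C''"] have "n * n \<le> t" by simp
    then have "real (n * n) \<le> real t" by (rule of_nat_mono)
    then show ?thesis using t by (simp add: power2_eq_square)
  qed
  have "C > 0" using bound[of 1] by simp
  define \<epsilon> where "\<epsilon> = 2 - \<tau>"
  have "\<epsilon> > 0" using \<open>\<not> 2 \<le> \<tau>\<close> by (simp add: \<epsilon>_def)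
  \<comment> \<open>Beyond \<open>C powr (1 / \<epsilon>)\<close> the power
    \<open>n powr (2 - \<tau>)\<close> exceeds \<open>C\<close>, against the bound just
    proved.\<close>
  obtain n :: nat where n': "real n > max 1 (C powr (1 / \<epsilon>))" using reals_Archimedean2 by blast
  then have "(C powr (1 / \<epsilon>)) powr \<epsilon> < real n powr \<epsilon>" using \<open>\<epsilon> > 0\<close> by (intro powr_less_mono2) auto
  then have n: "n \<ge> 1" "real n powr (2 - \<tau>) > C"
    using n' \<open>\<epsilon> > 0\<close> \<open>C > 0\<close> by (auto simp: powr_powr \<epsilon>_def)
  have "real n ^ 2 = real n powr (2 - \<tau>) * real n powr \<tau>" using n
    by (simp add: powr_add[symmetric] powr_numeral)
  also have "\<dots> > C * real n powr \<tau>" using n by simp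
  finally show False using bound[OF n(1)] by simp
qed

section \<open>Double loops that fill an array, and naive matrix multiplication\<close>

definition filled :: "('b \<Rightarrow> 'c) \<Rightarrow> ('a \<Rightarrow> 'b) \<Rightarrow> ('a \<Rightarrow> 'c) \<Rightarrow> 'a set \<Rightarrow> ('b \<Rightarrow> 'c) \<Rightarrow> bool" where
  "filled h0 g f S h \<longleftrightarrow> (\<forall>p\<in>S. h (g p) = f p) \<and> (\<forall>z. z \<notin> g ` S \<longrightarrow> h z = h0 z)"

lemma filled_empty: "filled h0 g f {} h0"
  by (simp add: filled_def)

lemma filled_insert:
  "filled h0 g f S h \<Longrightarrow> inj_on g (insert p S) \<Longrightarrow> filled h0 g f (insert p S) (h(g p := f p))"
  unfolding filled_def by (auto simp: inj_on_def)

text \<open>One rule for all double loops that write one cell per index pair; \<open>get\<close>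
  selects the array and may read words or reals. Injectivity of \<open>g\<close> protects the cells
  written before. That all other cells keep their contents matters for updating a block inside a
  larger matrix.\<close>

lemma wp_fill:
  fixes get :: "state \<Rightarrow> nat \<Rightarrow> 'b" and g :: "nat \<times> nat \<Rightarrow> nat" and K :: nat
  assumes ij: "i \<noteq> j" "i \<notin> wvars c" "j \<notin> wvars c" and n: "n1 \<le> W" "n2 \<le> W"
    and e1: "\<And>s. same (insert i (insert j (wvars c))) (rvars c) s0 s \<Longrightarrow> nval e1 s = n1"
    and e2: "\<And>s. same (insert i (insert j (wvars c))) (rvars c) s0 s \<Longrightarrow> nval e2 s = n2"
    and get: "\<And>x s. get (setw i 0 x s) = get s" "\<And>x s. get (setw j 0 x s) = get s"
    and inj: "inj_on g ({..<n1} \<times> {..<n2})"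
    and cell: "\<And>x y s. x < n1 \<Longrightarrow> y < n2 \<Longrightarrow> same (insert i (insert j (wvars c))) (rvars c) s0 s \<Longrightarrow>
      words s i 0 = x \<Longrightarrow> words s j 0 = y \<Longrightarrow>
      wp W c (\<lambda>t s'. t \<le> K \<and> get s' = (get s)(g (x, y) := f (x, y))) s"
    and post: "\<And>t s. same (insert i (insert j (wvars c))) (rvars c) s0 s \<Longrightarrow>
      filled (get s0) g f ({..<n1} \<times> {..<n2}) (get s) \<Longrightarrow> t \<le> n1 * (n2 * (K + 2) + 4) + 2 \<Longrightarrow> Q t s"
  shows "wp W (For i e1 (For j e2 c)) Q s0"
proof (rule wp_For[where n = n1 and K = "n2 * (K + 2) + 2"
      and I = "\<lambda>k s. filled (get s0) g f ({..<k} \<times> {..<n2}) (get s)"])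
  show "filled (get s0) g f ({..<0} \<times> {..<n2}) (get (setw i 0 0 s0))" by (simp add: get filled_empty)
next
  fix x s assume x: "x < n1" and "same (insert i (wvars (For j e2 c))) (rvars (For j e2 c)) s0 s"
    and xi: "words s i 0 = x" and I: "filled (get s0) g f ({..<x} \<times> {..<n2}) (get s)"
  then have S: "same (insert i (insert j (wvars c))) (rvars c) s0 s" by simp
  show "wp W (For j e2 c) (\<lambda>t s'. filled (get s0) g f ({..<Suc x} \<times> {..<n2}) (get (setw i 0 (Suc x) s')) \<and>
     t \<le> n2 * (K + 2) + 2) s"
  proof (rule wp_For[where n = n2 and K = K
        and I = "\<lambda>l s. filled (get s0) g f ({..<x} \<times> {..<n2} \<union> {x} \<times> {..<l}) (get s)"])
    show "nval e2 s' = n2" if "same (insert j (wvars c)) (rvars c) s s'" for s'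
      using e2 same_trans[OF S] same_mono[OF that] by blast
    show "filled (get s0) g f ({..<x} \<times> {..<n2} \<union> {x} \<times> {..<0}) (get (setw j 0 0 s))"
      using I by (simp add: get)
  next
    fix y s' assume y: "y < n2" and S': "same (insert j (wvars c)) (rvars c) s s'"
      and yj: "words s' j 0 = y"
      and I': "filled (get s0) g f ({..<x} \<times> {..<n2} \<union> {x} \<times> {..<y}) (get s')"
    have S'': "same (insert i (insert j (wvars c))) (rvars c) s0 s'"
      by (rule same_trans[OF S same_mono[OF S']]) auto
    have "words s' i 0 = x" using sameD(1)[OF S', of i] xi ij by simp
    from cell[OF x y S'' this yj]
    show "wp W c (\<lambda>t s'. filled (get s0) g f ({..<x} \<times> {..<n2} \<union> {x} \<times> {..<Suc y}) (get (setw j 0 (Suc y) s'))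
      \<and> t \<le> K) s'"
    proof (rule wp_mono)
      fix t s2 assume *: "t \<le> K \<and> get s2 = (get s')(g (x, y) := f (x, y))"
      have eq: "{..<x} \<times> {..<n2} \<union> {x} \<times> {..<Suc y} = insert (x, y) ({..<x} \<times> {..<n2} \<union> {x} \<times> {..<y})"
        by auto
      have "inj_on g (insert (x, y) ({..<x} \<times> {..<n2} \<union> {x} \<times> {..<y}))"
        by (rule inj_on_subset[OF inj]) (use x y in auto)
      from filled_insert[OF I' this] * show "filled (get s0) g f ({..<x} \<times> {..<n2} \<union> {x} \<times> {..<Suc y}) (get (setw j 0 (Suc y) s2))
      \<and> t \<le> K" unfolding eq by (simp add: get)
    qed
  next
    fix t s' assume "filled (get s0) g f ({..<x} \<times> {..<n2} \<union> {x} \<times> {..<n2}) (get s')" "t \<le> n2 * (K + 2) + 2"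
    moreover have "{..<x} \<times> {..<n2} \<union> {x} \<times> {..<n2} = {..<Suc x} \<times> {..<n2}" by auto
    ultimately show "filled (get s0) g f ({..<Suc x} \<times> {..<n2}) (get (setw i 0 (Suc x) s')) \<and> t \<le> n2 * (K + 2) + 2"
      by (simp add: get)
  qed (use ij n in auto)
qed (use ij n e1 post in \<open>auto simp: algebra_simps\<close>)

text \<open>Division and remainder by the row length recover row and column, provided the block ends
  within the row.\<close>

lemma row_major_inj:
  fixes N :: nat
  assumes "b + n2 \<le> N"
  shows "inj_on (\<lambda>(x, y). (a + x) * N + (b + y)) ({..<n1} \<times> {..<n2})"
proof (rule inj_onI)
  fix p q assume p: "p \<in> {..<n1} \<times> {..<n2}" and q: "q \<in> {..<n1} \<times> {..<n2}"
    and eq: "(case p of (x, y) \<Rightarrow> (a + x) * N + (b + y)) = (case q of (x, y) \<Rightarrow> (a + x) * N + (b + y))"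
  have *: "(b + snd r + N * (a + fst r)) div N = a + fst r" "(b + snd r + N * (a + fst r)) mod N = b + snd r"
    if "r \<in> {..<n1} \<times> {..<n2}" for r using that assms by auto
  have "b + snd p + N * (a + fst p) = b + snd q + N * (a + fst q)"
    using eq by (simp add: case_prod_unfold algebra_simps)
  with *[OF p] *[OF q] have "a + fst p = a + fst q" "b + snd p = b + snd q" by metis+
  then show "p = q" by (simp add: prod_eq_iff)
qed

lemma row_major_eq_iff: "j < n \<Longrightarrow> j' < n \<Longrightarrow> i * n + j = i' * n + j' \<longleftrightarrow> i = i' \<and> j = (j' :: nat)"
  using row_major_inj[of 0 n n 0 "Suc (max i i')"] by (fastforce simp: inj_on_def)

lemma row_major_inj0: "inj_on (\<lambda>(x, y). x * N + y) ({..<n1} \<times> {..<N::nat})"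
  using row_major_inj[of 0 N N 0 n1] by simp

definition naive_mm_entry :: com where
  "naive_mm_entry =
     (let c = NAdd (NMul (V ''i'') (V ''n'')) (V ''j'') in
       Seq (RAssign ''C'' c (RLit 0))
         (For ''k'' (V ''n'') (RAssign ''C'' c (RAdd (RCell ''C'' c)
           (RMul (RCell ''A'' (NAdd (NMul (V ''i'') (V ''n'')) (V ''k'')))
             (RCell ''B'' (NAdd (NMul (V ''k'') (V ''n'')) (V ''j''))))))))"

definition naive_mm :: com where
  "naive_mm = For ''i'' (V ''n'') (For ''j'' (V ''n'') naive_mm_entry)"

lemma vars_naive_mm_entry [simp]: "wvars naive_mm_entry = {''k''}" "rvars naive_mm_entry = {''C''}"
  by (auto simp: naive_mm_entry_def Let_def)

lemma wp_naive_mm: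
  assumes n: "words s0 ''n'' 0 = n" "n \<le> W"
  shows "wp W naive_mm (\<lambda>t s. (\<forall>i<n. \<forall>j<n. reals s ''C'' (i * n + j) =
      (\<Sum>k<n. reals s0 ''A'' (i * n + k) * reals s0 ''B'' (k * n + j))) \<and>
     t \<le> n * (n * (n * 3 + 5) + 4) + 2) s0"
proof -
  define f where "f l = (\<lambda>(i, j). (\<Sum>k<l. reals s0 ''A'' (i * n + k) * reals s0 ''B'' (k * n + j)))" for l :: nat
  show ?thesis unfolding naive_mm_def
  proof (rule wp_fill[where get = "\<lambda>s. reals s ''C''" and g = "\<lambda>(i, j). i * n + j" and f = "f n"
      and ?n1.0 = n and ?n2.0 = n and K = "n * 3 + 3"])
    fix x y s assume xy: "x < n" "y < n" "words s ''i'' 0 = x" "words s ''j'' 0 = y"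
      and S: "same (insert ''i'' (insert ''j'' (wvars naive_mm_entry))) (rvars naive_mm_entry) s0 s"
    show "wp W naive_mm_entry
      (\<lambda>t s'. t \<le> n * 3 + 3 \<and> reals s' ''C'' = (reals s ''C'')((case (x, y) of (i, j) \<Rightarrow> i * n + j) := f n (x, y))) s"
      unfolding naive_mm_entry_def Let_def wp_Seq wp_RAssign
      by (rule wp_For[where n = n and K = 1 and
            I = "\<lambda>l s'. reals s' ''C'' = (reals s ''C'')(x * n + y := f l (x, y))"])
        (use n xy in \<open>auto simp: sameD[OF S] f_def same_def\<close>)
  qed (use n row_major_inj0 in \<open>auto simp: same_def filled_def f_def add_mult_distrib2\<close>)
qed

lemma three_mem_mm_exponents: "3 \<in> mm_exponents"
  unfolding mm_exponents_def
\<comment> \<open>The coefficients of the polynomial time bound add up to 3 + 5 + 4 + 2 = 14, below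
  20. Only counters up to \<open>n\<close> are stored, so exponent 1 suffices for the word
  bound.\<close>
proof (rule CollectI, rule exI[of _ naive_mm], rule exI[of _ 20], rule exI[of _ 1], intro allI impI)
  fix n :: nat and s :: state assume "words s ''n'' 0 = n"
  from wp_naive_mm[OF this, of "(n + 2) ^ 1"] obtain t s' where r: "run ((n + 2) ^ 1) naive_mm s t s'"
    "\<forall>i<n. \<forall>j<n. reals s' ''C'' (i * n + j) =
       (\<Sum>k<n. reals s ''A'' (i * n + k) * reals s ''B'' (k * n + j))"
    and t: "t \<le> n * (n * (n * 3 + 5) + 4) + 2" unfolding wp_def by auto
  have "real t \<le> 20 * real n powr 3" if "1 \<le> n"
  proof -
    have "n * n \<le> n * n * n" "n \<le> n * n * n" "1 \<le> n * n * n" using that by auto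
    moreover have "t \<le> 3 * (n * n * n) + 5 * (n * n) + 4 * n + 2" using t by (simp add: algebra_simps)
    ultimately have "t \<le> 20 * (n * n * n)" by linarith
    then have "real t \<le> real (20 * (n * n * n))" by (rule of_nat_mono)
    then show ?thesis using that by (simp add: powr_numeral power3_eq_cube)
  qed
  with r show "\<exists>t s'. run ((n + 2) ^ 1) naive_mm s t s' \<and>
    (\<forall>i<n. \<forall>j<n. reals s' ''C'' (i * n + j) =
       (\<Sum>k<n. reals s ''A'' (i * n + k) * reals s ''B'' (k * n + j))) \<and>
    (1 \<le> n \<longrightarrow> real t \<le> 20 * real n powr 3)" by blast
qed

text \<open>The infimum need not be attained, but every number above it lies above some exponent
  that comes with a program.\<close>

lemma ex_mm_exponent_le:
  assumes "mm_omega < \<tau> \<or> (mm_omega \<in> mm_exponents \<and> \<tau> = mm_omega)"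
  shows "\<exists>\<tau>'\<in>mm_exponents. \<tau>' \<le> \<tau>"
  using assms three_mem_mm_exponents cInf_lessD[of mm_exponents \<tau>] unfolding mm_omega_def
  by (metis empty_iff less_imp_le order_refl)

section \<open>Reading and numbering the graph\<close>

text \<open>The fourth power leaves room for every word stored outside the multiplication program.
  The largest is the clock budget n m + n^2, which is at most (n + 2)^3.\<close>

locale dag_instance = digraph G for G :: "(nat, nat) pre_digraph" (structure) +
  fixes w :: "nat weight_fun" and n m W :: nat
  assumes verts_G: "verts G = {..<n}" and arcs_G: "arcs G = {..<m}"
    and acyclic_G: "acyclic (arcs_ends G)"
    and W: "(n + 2) ^ 4 \<le> W"
begin

lemma le_W: "x \<le> (n + 2) ^ 3 \<Longrightarrow> x \<le> W" "x \<le> (n + 2) ^ 2 \<Longrightarrow> x \<le> W" "x \<le> n + 2 \<Longrightarrow> x \<le> W"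
proof -
  have *: "(n + 2) ^ k \<le> W" if "k \<le> 4" for k
    using W power_increasing[OF that, of "n + 2"] by linarith
  show "x \<le> (n + 2) ^ 3 \<Longrightarrow> x \<le> W" "x \<le> (n + 2) ^ 2 \<Longrightarrow> x \<le> W" "x \<le> n + 2 \<Longrightarrow> x \<le> W"
    using *[of 1] *[of 2] *[of 3] by simp_all
qed

lemma n_le_W: "n \<le> W"
  by (rule le_W) simp

lemma arc_bounds: "e < m \<Longrightarrow> tail G e < n" "e < m \<Longrightarrow> head G e < n"
  using tail_in_verts head_in_verts verts_G arcs_G by auto

lemma dominates_bounds: "u \<rightarrow> v \<Longrightarrow> u < n" "u \<rightarrow> v \<Longrightarrow> v < n"
  using adj_in_verts verts_G by auto

lemma dominates_iff: "u \<rightarrow> v \<longleftrightarrow> (\<exists>e<m. tail G e = u \<and> head G e = v)"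
  using arcs_G by (auto simp: arcs_ends_conv)

lemma arc_eqI: "e < m \<Longrightarrow> f < m \<Longrightarrow> tail G e = tail G f \<Longrightarrow> head G e = head G f \<Longrightarrow> e = f"
  using no_multi_arcs arcs_G by (auto simp: arc_to_ends_def)

lemma in_arcs_eq: "in_arcs G v = {e. e < m \<and> head G e = v}"
  using arcs_G by (auto simp: in_arcs_def)

lemma in_degree_eq: "in_degree G v = card {e. e < m \<and> head G e = v}"
  by (simp add: in_degree_def in_arcs_eq)

lemma tail_inj_on_in_arcs: "inj_on (tail G) (in_arcs G v)"
  by (rule inj_onI) (auto simp: in_arcs_eq intro: arc_eqI)

lemma tail_in_arcs: "tail G ` in_arcs G v = {u. u \<rightarrow> v}"
  by (auto simp: in_arcs_eq dominates_iff)

lemma in_degree_card: "in_degree G v = card {u. u \<rightarrow> v}"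
  unfolding in_degree_def tail_in_arcs[symmetric] using tail_inj_on_in_arcs by (simp add: card_image)

lemma in_degree_le: "in_degree G v \<le> n"
proof -
  have "card {u. u \<rightarrow> v} \<le> card {..<n}" by (rule card_mono) (auto dest: dominates_bounds)
  then show ?thesis by (simp add: in_degree_card)
qed

lemma m_le: "m \<le> n * n"
proof -
  have "arc_to_ends G ` {..<m} \<subseteq> {..<n} \<times> {..<n}" using arc_bounds by (auto simp: arc_to_ends_def)
  moreover have "inj_on (arc_to_ends G) {..<m}" using inj_on_arc_to_ends arcs_G by simp
  ultimately have "card {..<m} \<le> card ({..<n} \<times> {..<n})"
    by (metis card_image card_mono finite_SigmaI finite_lessThan)
  then show ?thesis by simp
qed

lemma m_le_W: "m \<le> W"
  by (rule le_W(2)) (use m_le in \<open>simp add: power2_eq_square\<close>)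

definition input_ok :: "state \<Rightarrow> bool" where
  "input_ok s \<longleftrightarrow> words s ''n'' 0 = n \<and> words s ''m'' 0 = m \<and>
     (\<forall>e<m. words s ''tail'' e = tail G e \<and> words s ''head'' e = head G e \<and> reals s ''weight'' e = w e)"

text \<open>Row \<open>v\<close> of \<open>inl\<close> lists the in-neighbours of \<open>v\<close>
  in the arbitrary order of the arc list, so only its image is specified. Cells of
  \<open>inl\<close> beyond the indegree and cells of \<open>wt\<close> at non-arcs keep arbitrary
  contents.\<close>

definition loaded :: "state \<Rightarrow> bool" where
  "loaded s \<longleftrightarrow>
     (\<forall>u<n. \<forall>v<n. words s ''adj'' (u * n + v) = (if u \<rightarrow> v then 1 else 0)) \<and>
     (\<forall>e<m. reals s ''wt'' (tail G e * n + head G e) = w e) \<and>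
     (\<forall>v<n. words s ''indeg'' v = in_degree G v) \<and>
     (\<forall>v<n. (\<lambda>k. words s ''inl'' (v * n + k)) ` {..<in_degree G v} = {u. u \<rightarrow> v})"

end

abbreviation idx :: "nexp \<Rightarrow> nexp \<Rightarrow> nexp" where
  "idx x y \<equiv> NAdd (NMul x (V ''n'')) y"

definition load_arc :: com where
  "load_arc =
     Seq (Var_assign ''t'' (NCell ''tail'' (V ''e'')))
    (Seq (Var_assign ''h'' (NCell ''head'' (V ''e'')))
    (Seq (NAssign ''adj'' (idx (V ''t'') (V ''h'')) (NLit 1))
    (Seq (RAssign ''wt'' (idx (V ''t'') (V ''h'')) (RCell ''weight'' (V ''e'')))
    (Seq (NAssign ''inl'' (idx (V ''h'') (NCell ''indeg'' (V ''h''))) (V ''t''))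
         (NAssign ''indeg'' (V ''h'') (NAdd (NCell ''indeg'' (V ''h'')) (NLit 1)))))))"

definition load :: com where
  "load =
     Seq (For ''i'' (V ''n'') (For ''j'' (V ''n'') (NAssign ''adj'' (idx (V ''i'') (V ''j'')) (NLit 0))))
    (Seq (For ''i'' (V ''n'') (NAssign ''indeg'' (V ''i'') (NLit 0)))
         (For ''e'' (V ''m'') load_arc))"

lemma vars_load_arc [simp]:
  "wvars load_arc = {''t'', ''h'', ''adj'', ''inl'', ''indeg''}" "rvars load_arc = {''wt''}"
  by (auto simp: load_arc_def)

context dag_instance
begin

definition load_inv :: "nat \<Rightarrow> state \<Rightarrow> bool" where
  "load_inv k s \<longleftrightarrow>
     (\<forall>u<n. \<forall>v<n. words s ''adj'' (u * n + v) = (if \<exists>e<k. tail G e = u \<and> head G e = v then 1 else 0)) \<and>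
     (\<forall>e<k. reals s ''wt'' (tail G e * n + head G e) = w e) \<and>
     (\<forall>v<n. words s ''indeg'' v = card {e. e < k \<and> head G e = v}) \<and>
     (\<forall>v<n. (\<lambda>k. words s ''inl'' (v * n + k)) ` {..<card {e. e < k \<and> head G e = v}} =
        tail G ` {e. e < k \<and> head G e = v})"

lemma load_inv_final: "load_inv m s \<longleftrightarrow> loaded s"
  unfolding load_inv_def loaded_def dominates_iff in_degree_eq[symmetric] in_arcs_eq[symmetric]
    tail_in_arcs by (simp add: dominates_iff in_degree_def)

text \<open>The next free position of a row of \<open>inl\<close> still lies within the row, so no
  neighbouring row is overwritten.\<close>

lemma card_earlier_in_arcs:
  assumes "k < m" "head G k = v"
  shows "card {e. e < k \<and> head G e = v} < n"
proof -
  have "{e. e < k \<and> head G e = v} \<subset> in_arcs G v" using assms by (auto simp: in_arcs_eq)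
  then have "card {e. e < k \<and> head G e = v} < in_degree G v"
    unfolding in_degree_def by (rule psubset_card_mono[OF finite_in_arcs])
  with in_degree_le[of v] show ?thesis by simp
qed

lemma wp_load_arc:
  assumes I: "load_inv k s" and k: "k < m" "words s ''e'' 0 = k"
    and inp: "words s ''n'' 0 = n" "words s ''tail'' k = tail G k" "words s ''head'' k = head G k"
      "reals s ''weight'' k = w k"
  shows "wp W load_arc (\<lambda>t s'. load_inv (Suc k) (setw ''e'' 0 (Suc k) s') \<and> t \<le> 6) s"
proof -
  define t h d where "t = tail G k" and "h = head G k" and "d = card {e. e < k \<and> head G e = h}"
  have b: "t < n" "h < n" "d < n" using arc_bounds[OF k(1)] card_earlier_in_arcs[OF k(1)]
    by (auto simp: t_def h_def d_def)
  then have bW: "t \<le> W" "h \<le> W" "Suc d \<le> W" "Suc 0 \<le> W" using n_le_W by auto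
  have ins: "{e. e < Suc k \<and> head G e = v} = (if v = h then insert k {e. e < k \<and> head G e = v}
     else {e. e < k \<and> head G e = v})" for v
    by (auto simp: h_def less_Suc_eq)
  have card_ins: "card {e. e < Suc k \<and> head G e = v} = (if v = h then Suc d else card {e. e < k \<and> head G e = v})" for v
    unfolding ins by (auto simp: d_def)
  have ex: "(\<exists>e<Suc k. tail G e = u \<and> head G e = v) \<longleftrightarrow> u = t \<and> v = h \<or> (\<exists>e<k. tail G e = u \<and> head G e = v)" for u v
    by (auto simp: t_def h_def less_Suc_eq)
  have d: "words s ''indeg'' h = d" using I b by (auto simp: load_inv_def d_def)
  define s' where "s' = setw ''indeg'' h (Suc d) (setw ''inl'' (h * n + d) t (setr ''wt'' (t * n + h) (w k)
    (setw ''adj'' (t * n + h) 1 (setw ''h'' 0 h (setw ''t'' 0 t s)))))"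
  have "load_inv (Suc k) (setw ''e'' 0 (Suc k) s')"
    unfolding load_inv_def card_ins ex
  proof (intro conjI allI impI)
    fix u v assume "u < n" "v < n"
    then show "words (setw ''e'' 0 (Suc k) s') ''adj'' (u * n + v) =
      (if u = t \<and> v = h \<or> (\<exists>e<k. tail G e = u \<and> head G e = v) then 1 else 0)"
      using I b by (auto simp: s'_def load_inv_def row_major_eq_iff)
  next
    fix e assume "e < Suc k"
    then show "reals (setw ''e'' 0 (Suc k) s') ''wt'' (tail G e * n + head G e) = w e"
      using I b arc_bounds[of e] arc_eqI[of e k] k
      by (auto simp: s'_def load_inv_def row_major_eq_iff t_def h_def less_Suc_eq)
  next
    fix v assume "v < n"
    then show "words (setw ''e'' 0 (Suc k) s') ''indeg'' v = (if v = h then Suc d else card {e. e < k \<and> head G e = v})"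
      using I by (auto simp: s'_def load_inv_def)
  next
    fix v assume v: "v < n"
    have *: "(\<lambda>l. words s ''inl'' (v * n + l)) ` {..<card {e. e < k \<and> head G e = v}} = tail G ` {e. e < k \<and> head G e = v}"
      using I v by (simp add: load_inv_def)
    show "(\<lambda>l. words (setw ''e'' 0 (Suc k) s') ''inl'' (v * n + l)) ` {..<if v = h then Suc d else card {e. e < k \<and> head G e = v}} =
        tail G ` {e. e < Suc k \<and> head G e = v}"
    proof (cases "v = h")
      case True
      have "(\<lambda>l. words (setw ''e'' 0 (Suc k) s') ''inl'' (v * n + l)) ` {..<Suc d} =
        insert t ((\<lambda>l. words s ''inl'' (v * n + l)) ` {..<d})"
        using True by (auto simp: s'_def lessThan_Suc)
      then show ?thesis using * True unfolding ins by (simp add: d_def t_def)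
    next
      case False
      have "card {e. e < k \<and> head G e = v} \<le> in_degree G v"
        unfolding in_degree_def by (rule card_mono) (use k in \<open>auto simp: in_arcs_eq\<close>)
      then have le: "card {e. e < k \<and> head G e = v} \<le> n" using in_degree_le[of v] by simp
      have "(\<lambda>l. words (setw ''e'' 0 (Suc k) s') ''inl'' (v * n + l)) ` {..<card {e. e < k \<and> head G e = v}} =
        (\<lambda>l. words s ''inl'' (v * n + l)) ` {..<card {e. e < k \<and> head G e = v}}"
        using False b le by (intro image_cong) (auto simp: s'_def row_major_eq_iff)
      then show ?thesis using * False unfolding ins by simp
    qed
  qed
  then show ?thesis unfolding load_arc_def using bW b d inp k
    by (simp add: s'_def t_def[symmetric] h_def[symmetric])
qed

lemma wp_load:
  assumes inp: "input_ok s0"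
  shows "wp W load (\<lambda>t s. loaded s \<and> t \<le> 20 * (n * n) + 20 * n + 20) s0"
  unfolding load_def wp_Seq
proof (rule wp_fill[where get = "\<lambda>s. words s ''adj''" and g = "\<lambda>(i, j). i * n + j" and f = "\<lambda>_. 0"
      and ?n1.0 = n and ?n2.0 = n and K = 1])
  fix t1 s1
  assume S1: "same (insert ''i'' (insert ''j'' (wvars (NAssign ''adj'' (idx (V ''i'') (V ''j'')) (NLit 0)))))
     (rvars (NAssign ''adj'' (idx (V ''i'') (V ''j'')) (NLit 0))) s0 s1"
    and f: "filled (words s0 ''adj'') (\<lambda>(i, j). i * n + j) (\<lambda>_. 0) ({..<n} \<times> {..<n}) (words s1 ''adj'')"
    and t1: "t1 \<le> n * (n * (1 + 2) + 4) + 2"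
  have n1: "words s1 ''n'' 0 = n" using S1 inp by (simp add: same_def input_ok_def)
  show "wp W (For ''i'' (V ''n'') (NAssign ''indeg'' (V ''i'') (NLit 0)))
     (\<lambda>t'. wp W (For ''e'' (V ''m'') load_arc) (\<lambda>t'a s. loaded s \<and> t1 + (t' + t'a) \<le> 20 * (n * n) + 20 * n + 20)) s1"
  proof (rule wp_For[where n = n and K = 1 and I = "\<lambda>k s. \<forall>i<k. words s ''indeg'' i = 0"])
    fix t2 s2
    assume S2: "same (insert ''i'' (wvars (NAssign ''indeg'' (V ''i'') (NLit 0))))
      (rvars (NAssign ''indeg'' (V ''i'') (NLit 0))) s1 s2"
      and z: "\<forall>i<n. words s2 ''indeg'' i = 0" and t2: "t2 \<le> n * (1 + 2) + 2"
    have inp2: "input_ok s2" using S1 S2 inp by (auto simp: same_def input_ok_def)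
    show "wp W (For ''e'' (V ''m'') load_arc) (\<lambda>t'a s. loaded s \<and> t1 + (t2 + t'a) \<le> 20 * (n * n) + 20 * n + 20) s2"
    proof (rule wp_For[where n = m and K = 6 and I = load_inv])
      show "load_inv 0 (setw ''e'' 0 0 s2)" using z f S2
        by (auto simp: load_inv_def filled_def same_def)
    next
      fix k s assume "k < m" "same (insert ''e'' (wvars load_arc)) (rvars load_arc) s2 s" "words s ''e'' 0 = k" "load_inv k s"
      then show "wp W load_arc (\<lambda>t s'. load_inv (Suc k) (setw ''e'' 0 (Suc k) s') \<and> t \<le> 6) s"
        using inp2 by (intro wp_load_arc) (auto simp: same_def input_ok_def)
    next
      fix t3 s assume "load_inv m s" "t3 \<le> m * (6 + 2) + 2"
      then show "loaded s \<and> t1 + (t2 + t3) \<le> 20 * (n * n) + 20 * n + 20"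
        using t1 t2 m_le load_inv_final by (simp add: algebra_simps)
    qed (use inp2 m_le_W in \<open>auto simp: same_def input_ok_def\<close>)
  qed (use n1 n_le_W in \<open>auto simp: same_def less_Suc_eq\<close>)
qed (use inp n_le_W row_major_inj0 in \<open>auto simp: same_def input_ok_def\<close>)

end

section \<open>Topological numbering with the sources first\<close>

definition topo_push :: "nexp \<Rightarrow> com" where
  "topo_push v =
     Seq (NAssign ''ord'' (V ''q'') v)
    (Seq (Var_assign ''q'' (NAdd (V ''q'') (NLit 1)))
         (NAssign ''num'' v (V ''q'')))"

definition topo_relax :: com where
  "topo_relax =
     Cond (NLess (NLit 0) (NCell ''adj'' (idx (V ''u'') (V ''j''))))
       (Seq (NAssign ''deg'' (V ''j'') (NSub (NCell ''deg'' (V ''j'')) (NLit 1)))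
            (Cond (NLess (NCell ''deg'' (V ''j'')) (NLit 1)) (topo_push (V ''j'')) Skip))
       Skip"

definition topo_init :: com where
  "topo_init =
     Seq (NAssign ''deg'' (V ''i'') (NCell ''indeg'' (V ''i'')))
         (Cond (NLess (NCell ''deg'' (V ''i'')) (NLit 1)) (topo_push (V ''i'')) Skip)"

definition topo_step :: com where
  "topo_step = Seq (Var_assign ''u'' (NCell ''ord'' (V ''k''))) (For ''j'' (V ''n'') topo_relax)"

definition topo :: com where
  "topo = Seq (Var_assign ''q'' (NLit 0))
     (Seq (For ''i'' (V ''n'') topo_init) (For ''k'' (V ''n'') topo_step))"

lemma vars_topo [simp]:
  "wvars (topo_push v) = {''ord'', ''q'', ''num''}" "rvars (topo_push v) = {}"
  "wvars topo_relax = {''deg'', ''ord'', ''q'', ''num''}" "rvars topo_relax = {}"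
  "wvars topo_init = {''deg'', ''ord'', ''q'', ''num''}" "rvars topo_init = {}"
  "wvars topo_step = {''u'', ''j'', ''deg'', ''ord'', ''q'', ''num''}" "rvars topo_step = {}"
  by (auto simp: topo_push_def topo_relax_def topo_init_def topo_step_def)

text \<open>Numbers start at 1 and queue positions at 0, hence the \<open>Suc\<close>; up to this
  shift \<open>ord\<close> inverts \<open>num\<close>.\<close>

definition queue :: "nat list \<Rightarrow> state \<Rightarrow> bool" where
  "queue L s \<longleftrightarrow> words s ''q'' 0 = length L \<and>
     (\<forall>i<length L. words s ''ord'' i = L ! i \<and> words s ''num'' (L ! i) = Suc i)"

lemma wp_topo_push:
  assumes "queue L s" "x \<notin> set L" "Suc (length L) \<le> W" "x \<le> W"
    and v: "\<And>s'. same {''ord'', ''q'', ''num''} {} s s' \<Longrightarrow> nval v s' = x"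
    and post: "\<And>s'. queue (L @ [x]) s' \<Longrightarrow> same {''ord'', ''q'', ''num''} {} s s' \<Longrightarrow> Q 3 s'"
  shows "wp W (topo_push v) Q s"
proof -
  let ?s1 = "setw ''ord'' (length L) x s"
  let ?s2 = "setw ''q'' 0 (Suc (length L)) ?s1"
  have v': "nval v s = x" "nval v ?s1 = x" "nval v ?s2 = x" by (rule v; simp add: same_def)+
  have "queue (L @ [x]) (setw ''num'' x (Suc (length L)) ?s2)"
    using assms(1,2) by (auto simp: queue_def nth_append less_Suc_eq in_set_conv_nth)
  from post[OF this] show ?thesis
    using assms(1,3,4) v' by (simp add: topo_push_def queue_def same_def numeral_3_eq_3)
qed

context dag_instance
begin

text \<open>\<open>L\<close> is everything that was ever enqueued and \<open>D v\<close> the set of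
  vertices already processed as far as \<open>v\<close> is concerned. It depends on \<open>v\<close>
  because in the middle of a relaxation loop the current vertex has been processed for some targets
  only. The last two conjuncts say that the order is topological and that the sources form a
  prefix.\<close>

definition topo_inv :: "(nat \<Rightarrow> nat set) \<Rightarrow> nat list \<Rightarrow> state \<Rightarrow> bool" where
  "topo_inv D L s \<longleftrightarrow> queue L s \<and> distinct L \<and>
     set L = {v. v < n \<and> (\<forall>u. u \<rightarrow> v \<longrightarrow> u \<in> D v)} \<and>
     (\<forall>v<n. words s ''deg'' v = card {u. u \<rightarrow> v \<and> u \<notin> D v}) \<and>
     (\<forall>i<length L. \<forall>u. u \<rightarrow> L ! i \<longrightarrow> u \<in> set (take i L)) \<and>
     (\<exists>r. set (take r L) = {v. v < n \<and> in_degree G v = 0})"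

lemma finite_dominating: "finite {u. u \<rightarrow> v \<and> P u}"
  by (rule finite_subset[of _ "{..<n}"]) (auto dest: dominates_bounds)

lemma topo_inv_length: "topo_inv D L s \<Longrightarrow> length L \<le> n"
proof -
  assume I: "topo_inv D L s"
  then have "card (set L) \<le> card {..<n}" by (intro card_mono) (auto simp: topo_inv_def)
  moreover have "card (set L) = length L" using I by (intro distinct_card) (simp add: topo_inv_def)
  ultimately show ?thesis by simp
qed

lemma topo_inv_setw [simp]:
  "x \<notin> {''q'', ''ord'', ''num'', ''deg''} \<Longrightarrow> topo_inv D L (setw x i y s) \<longleftrightarrow> topo_inv D L s"
proof -
  assume "x \<notin> {''q'', ''ord'', ''num'', ''deg''}"
  then have "words (setw x i y s) ''q'' = words s ''q''" "words (setw x i y s) ''ord'' = words s ''ord''"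
    "words (setw x i y s) ''num'' = words s ''num''" "words (setw x i y s) ''deg'' = words s ''deg''"
    by auto
  then show ?thesis by (simp only: topo_inv_def queue_def)
qed

lemma wp_topo_relax:
  assumes I: "topo_inv D L s" and j: "j < n" "words s ''j'' 0 = j" and u: "words s ''u'' 0 = u" "u < n"
    and D: "u \<notin> D j" "insert u (D j) \<subseteq> set L"
    and s: "words s ''n'' 0 = n" "words s ''adj'' (u * n + j) = (if u \<rightarrow> j then 1 else 0)"
  shows "wp W topo_relax (\<lambda>t s'. t \<le> 6 \<and> (\<exists>L'. topo_inv (D(j := insert u (D j))) (L @ L') s')) s"
proof (cases "u \<rightarrow> j")
  case False
  then have "topo_inv (D(j := insert u (D j))) L s"
  proof -
    have "{v. v < n \<and> (\<forall>x. x \<rightarrow> v \<longrightarrow> x \<in> (D(j := insert u (D j))) v)} = {v. v < n \<and> (\<forall>x. x \<rightarrow> v \<longrightarrow> x \<in> D v)}"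
      "{x. x \<rightarrow> v \<and> x \<notin> (D(j := insert u (D j))) v} = {x. x \<rightarrow> v \<and> x \<notin> D v}" for v
      using False by auto
    then show ?thesis using I unfolding topo_inv_def by presburger
  qed
  then show ?thesis using False j u s by (auto simp: topo_relax_def intro!: exI[of _ "[]"])
next
  case True
  define D' where "D' = D(j := insert u (D j))"
  let ?A = "{x. x \<rightarrow> j \<and> x \<notin> D j}" and ?B = "{x. x \<rightarrow> j \<and> x \<notin> insert u (D j)}"
  have "?A = insert u ?B" using True D by auto
  then have card: "card ?A = Suc (card ?B)" using finite_dominating[of j] by simp
  have "card ?A \<le> n" using card_mono[of "{..<n}" ?A] dominates_bounds by auto
  then have bW: "card ?B \<le> W" using card n_le_W by simp
  have deg: "words s ''deg'' j = Suc (card ?B)" using I j card by (simp add: topo_inv_def)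
  define s1 where "s1 = setw ''deg'' j (card ?B) s"
  have q1: "queue L s1" using I by (simp add: topo_inv_def queue_def s1_def)
  \<comment> \<open>The in-neighbour \<open>u\<close> of \<open>j\<close> is not yet in
    \<open>D j\<close>, so \<open>j\<close> cannot have been enqueued.\<close>
  have notin: "j \<notin> set L" using I True D by (auto simp: topo_inv_def)
  have setD': "{v. v < n \<and> (\<forall>x. x \<rightarrow> v \<longrightarrow> x \<in> D' v)} = (if ?B = {} then insert j (set L) else set L)"
    using I j notin by (auto simp: topo_inv_def D'_def)
  have degD': "\<forall>v<n. words s1 ''deg'' v = card {x. x \<rightarrow> v \<and> x \<notin> D' v}"
    using I by (auto simp: topo_inv_def D'_def s1_def)
  define body where "body = Cond (NLess (NCell ''deg'' (V ''j'')) (NLit 1)) (topo_push (V ''j'')) Skip"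
  have "wp W body (\<lambda>t s'. t \<le> 4 \<and> (\<exists>L'. topo_inv D' (L @ L') s')) s1"
  proof (cases "?B = {}")
    case False
    with setD' have "set L = {v. v < n \<and> (\<forall>x. x \<rightarrow> v \<longrightarrow> x \<in> D' v)}" by argo
    then have "topo_inv D' (L @ []) s1" using I degD' q1 by (simp add: topo_inv_def)
    moreover have "card ?B \<noteq> 0" using False finite_dominating by simp
    moreover have "words s1 ''j'' 0 = j" "words s1 ''deg'' j = card ?B" using j by (auto simp: s1_def)
    ultimately show ?thesis by (auto simp: body_def intro!: exI[of _ "[]"])
  next
    case B: True
    have len: "Suc (length L) \<le> n"
    proof -
      have "card (insert j (set L)) \<le> card {..<n}" using I j by (intro card_mono) (auto simp: topo_inv_def)
      moreover have "card (set L) = length L" using I by (intro distinct_card) (simp add: topo_inv_def)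
      ultimately show ?thesis using notin by simp
    qed
    have "wp W (topo_push (V ''j'')) (\<lambda>t s'. t \<le> 3 \<and> (\<exists>L'. topo_inv D' (L @ L') s')) s1"
    proof (rule wp_topo_push[OF q1 notin])
      fix s' assume q: "queue (L @ [j]) s'" and S: "same {''ord'', ''q'', ''num''} {} s1 s'"
      \<comment> \<open>No in-neighbour of \<open>j\<close> is outstanding and those processed lie
        in \<open>L\<close>, so \<open>j\<close> may be appended.\<close>
      have "x \<in> set L" if "x \<rightarrow> j" for x using B that D by auto
      then have pre: "\<forall>i<length (L @ [j]). \<forall>u. u \<rightarrow> (L @ [j]) ! i \<longrightarrow> u \<in> set (take i (L @ [j]))"
        using I by (auto simp: topo_inv_def nth_append less_Suc_eq)
      obtain r where r: "set (take r L) = {v. v < n \<and> in_degree G v = 0}" using I by (auto simp: topo_inv_def)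
      then have r': "\<exists>r. set (take r (L @ [j])) = {v. v < n \<and> in_degree G v = 0}"
        by (intro exI[of _ "min r (length L)"]) (cases "r \<le> length L"; simp)
      have dist: "distinct (L @ [j])" using I notin by (simp add: topo_inv_def)
      have setE: "set (L @ [j]) = {v. v < n \<and> (\<forall>x. x \<rightarrow> v \<longrightarrow> x \<in> D' v)}"
        unfolding setD' using B by simp
      have dg: "words s' ''deg'' = words s1 ''deg''" using S by (simp add: same_def)
      have "topo_inv D' (L @ [j]) s'"
        unfolding topo_inv_def dg by (intro conjI) (fact q dist setE degD' pre r')+
      then show "3 \<le> (3 :: nat) \<and> (\<exists>L'. topo_inv D' (L @ L') s')" by blast
    qed (use j n_le_W len in \<open>auto simp: same_def s1_def\<close>)
    moreover have "words s1 ''j'' 0 = j" "words s1 ''deg'' j = 0"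
      unfolding s1_def B using j by auto
    ultimately show ?thesis by (auto simp: body_def elim!: wp_mono)
  qed
  then have "wp W body (\<lambda>t s'. 1 + (1 + t) \<le> 6 \<and> (\<exists>L'. topo_inv D' (L @ L') s')) s1"
    by (rule wp_mono) auto
  then show ?thesis using True j u s deg bW unfolding topo_relax_def body_def[symmetric]
    by (simp add: s1_def D'_def[symmetric])
qed

lemma wp_topo_init:
  assumes I: "queue L s" "distinct L" "set L = {v. v < k \<and> in_degree G v = 0}" "\<forall>v<k. words s ''deg'' v = in_degree G v"
    and k: "k < n" "words s ''i'' 0 = k" and d: "words s ''indeg'' k = in_degree G k"
  shows "wp W topo_init (\<lambda>t s'. t \<le> 5 \<and> (\<exists>L. queue L s' \<and> distinct L \<and> set L = {v. v < Suc k \<and> in_degree G v = 0} \<and>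
    (\<forall>v<Suc k. words s' ''deg'' v = in_degree G v))) s"
proof (cases "in_degree G k = 0")
  case False
  then have "set L = {v. v < Suc k \<and> in_degree G v = 0}" using I by (auto simp: less_Suc_eq)
  then show ?thesis using False I k d in_degree_le[of k] n_le_W
    by (auto simp: topo_init_def queue_def less_Suc_eq intro!: exI[of _ L])
next
  case True
  define s1 where "s1 = setw ''deg'' k 0 s"
  have q1: "queue L s1" using I by (simp add: queue_def s1_def)
  have notin: "k \<notin> set L" using I by simp
  have "card (insert k (set L)) \<le> card {..<n}" using I k by (intro card_mono) auto
  then have len: "Suc (length L) \<le> n" using I(2) notin by (simp add: distinct_card)
  have "wp W (topo_push (V ''i'')) (\<lambda>t s'. t \<le> 3 \<and> (\<exists>L. queue L s' \<and> distinct L \<and> set L = {v. v < Suc k \<and> in_degree G v = 0} \<and>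
    (\<forall>v<Suc k. words s' ''deg'' v = in_degree G v))) s1"
    by (rule wp_topo_push[OF q1 notin])
      (use I True notin k n_le_W len in \<open>auto simp: same_def s1_def less_Suc_eq intro!: exI[of _ "L @ [k]"]\<close>)
  then show ?thesis using k d True
    by (auto simp: topo_init_def s1_def elim!: wp_mono)
qed

text \<open>If the queue ran empty too early, every vertex outside \<open>L\<close> would have an
  in-neighbour outside \<open>L\<close>, which contradicts the well-foundedness of a finite acyclic
  relation.\<close>

lemma topo_progress:
  assumes I: "topo_inv (\<lambda>_. set (take k L)) L s" and k: "k \<le> length L" "k < n"
  shows "k < length L"
proof (rule ccontr)
  assume "\<not> k < length L"
  then have L: "length L = k" "set L = {v. v < n \<and> (\<forall>u. u \<rightarrow> v \<longrightarrow> u \<in> set L)}"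
    using I k by (auto simp: topo_inv_def)
  have "finite (arcs_ends G)" unfolding arcs_ends_conv by simp
  then have "wf (arcs_ends G)" using acyclic_G by (rule finite_acyclic_wf)
  moreover have "{..<n} - set L \<noteq> {}"
  proof
    assume "{..<n} - set L = {}"
    then have "card {..<n} \<le> card (set L)" by (intro card_mono) auto
    then show False using L k card_length[of L] by simp
  qed
  ultimately obtain v where v: "v \<in> {..<n} - set L" "\<And>u. u \<rightarrow> v \<Longrightarrow> u \<notin> {..<n} - set L"
    using wfE_min by (metis ex_in_conv)
  then have "\<forall>u. u \<rightarrow> v \<longrightarrow> u \<in> set L" using dominates_bounds by blast
  with v(1) L(2) show False by blast
qed

lemma wp_topo_step:
  assumes I: "topo_inv (\<lambda>_. set (take k L)) L s" and k: "k < length L" "words s ''k'' 0 = k"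
    and s: "words s ''n'' 0 = n" "\<forall>u<n. \<forall>v<n. words s ''adj'' (u * n + v) = (if u \<rightarrow> v then 1 else 0)"
  shows "wp W topo_step (\<lambda>t s'. t \<le> n * 8 + 3 \<and> (\<exists>L'. Suc k \<le> length (L @ L') \<and>
    topo_inv (\<lambda>_. set (take (Suc k) (L @ L'))) (L @ L') s')) s"
proof -
  define u where "u = L ! k"
  let ?S = "set (take k L)"
  have u: "u < n" "words s ''ord'' k = u" "u \<in> set L" using I k by (auto simp: topo_inv_def queue_def u_def)
  have uS: "u \<notin> ?S" using I k by (auto simp: topo_inv_def u_def in_set_conv_nth nth_eq_iff_index_eq)
  have tk: "set (take (Suc k) (L @ L')) = insert u ?S" for L'
    using k by (simp add: take_Suc_conv_app_nth u_def)
  define s1 where "s1 = setw ''u'' 0 u s"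
  \<comment> \<open>After \<open>l\<close> rounds of the inner loop, \<open>u\<close> counts as
    processed for the targets below \<open>l\<close>.\<close>
  define D where "D l v = (if v < l then insert u ?S else ?S)" for l v :: nat
  have I1: "topo_inv (\<lambda>_. ?S) L s1" using I by (simp add: topo_inv_def queue_def s1_def)
  have "wp W (For ''j'' (V ''n'') topo_relax) (\<lambda>t s'. t \<le> n * 8 + 2 \<and>
     (\<exists>L'. topo_inv (\<lambda>_. insert u ?S) (L @ L') s')) s1"
  proof (rule wp_For[where n = n and K = 6 and I = "\<lambda>l s. \<exists>L'. topo_inv (D l) (L @ L') s"], goal_cases)
    case 4
    have "D 0 = (\<lambda>_. ?S)" by (simp add: D_def fun_eq_iff)
    then show ?case using I1 by (auto intro!: exI[of _ "[]"])
  next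
    case (5 l s')
    then obtain L' where L': "topo_inv (D l) (L @ L') s'" by blast
    have upd: "(D l)(l := insert u (D l l)) = D (Suc l)" by (auto simp: fun_eq_iff D_def)
    have "wp W topo_relax (\<lambda>t s'. t \<le> 6 \<and> (\<exists>L''. topo_inv (D (Suc l)) ((L @ L') @ L'') s')) s'"
      unfolding upd[symmetric]
    proof (rule wp_topo_relax[OF L' 5(1,3)])
      show "words s' ''u'' 0 = u" "words s' ''n'' 0 = n" using 5(2) s by (simp_all add: same_def s1_def)
      show "words s' ''adj'' (u * n + l) = (if u \<rightarrow> l then 1 else 0)"
        using 5(1,2) s u(1) by (simp add: same_def s1_def)
      show "insert u (D l l) \<subseteq> set (L @ L')" using u(3) set_take_subset[of k L] by (auto simp: D_def)
    qed (use u(1) uS in \<open>auto simp: D_def\<close>)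
    then show ?case by (rule wp_mono) auto
  next
    case (6 t s')
    then show ?case by (simp add: topo_inv_def D_def cong: conj_cong)
  qed (use s n_le_W in \<open>auto simp: same_def s1_def\<close>)
  then show ?thesis using u n_le_W k unfolding topo_step_def tk
    by (auto simp: s1_def elim!: wp_mono)
qed

definition topo_ok :: "state \<Rightarrow> bool" where
  "topo_ok s \<longleftrightarrow> source_first_numbering (words s ''num'') \<and>
     (\<forall>i<n. words s ''ord'' i < n \<and> words s ''num'' (words s ''ord'' i) = Suc i)"

lemma topo_inv_final:
  assumes I: "topo_inv D L s" and L: "n \<le> length L"
  shows "topo_ok s"
proof -
  have d: "distinct L" and sub: "set L \<subseteq> {..<n}" using I by (auto simp: topo_inv_def)
  have len: "length L = n" using topo_inv_length[OF I] L by simp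
  then have set: "set L = {..<n}" using sub d by (metis card_lessThan card_subset_eq distinct_card finite_lessThan)
  have num: "words s ''num'' (L ! i) = Suc i" and ord: "words s ''ord'' i = L ! i" if "i < n" for i
    using I that len by (auto simp: topo_inv_def queue_def)
  have ex: "\<exists>i<n. v = L ! i" if "v < n" for v using that set len by (metis in_set_conv_nth lessThan_iff)
  have bnd: "L ! i < n" if "i < n" for i using that set len nth_mem by fastforce
  have less: "words s ''num'' u < words s ''num'' v" if uv: "u \<rightarrow> v" for u v
  proof -
    obtain i where i: "i < n" "v = L ! i" using ex[OF dominates_bounds(2)[OF uv]] by blast
    then have "u \<in> set (take i L)" using I uv len by (auto simp: topo_inv_def)
    then obtain k where "k < i" "u = L ! k" using i len by (auto simp: in_set_conv_nth)
    then show ?thesis using num i by simp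
  qed
  have "bij_betw (words s ''num'') {..<n} {1..n}"
  proof (rule bij_betwI')
    fix x y assume "x \<in> {..<n}" "y \<in> {..<n}"
    then show "(words s ''num'' x = words s ''num'' y) = (x = y)" using ex num by (metis lessThan_iff nat.inject)
  next
    fix x assume "x \<in> {..<n}" then show "words s ''num'' x \<in> {1..n}" using ex[of x] num by auto
  next
    fix y assume "y \<in> {1..n}"
    then have "y - 1 < n" "Suc (y - 1) = y" by auto
    then show "\<exists>x\<in>{..<n}. y = words s ''num'' x" using num bnd by (metis lessThan_iff)
  qed
  moreover have "words s ''num'' u < words s ''num'' v"
    if uv: "u < n" "v < n" and src: "in_degree G u = 0" "in_degree G v \<noteq> 0" for u v
  proof -
    obtain i j where i: "i < n" "u = L ! i" and j: "j < n" "v = L ! j" using ex uv by metis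
    obtain r where r: "set (take r L) = {v. v < n \<and> in_degree G v = 0}" using I by (auto simp: topo_inv_def)
    have "i < r"
    proof -
      have "u \<in> set (take r L)" using r uv src by simp
      then obtain k where "k < r" "k < n" "u = L ! k" using len by (auto simp: in_set_conv_nth)
      then show ?thesis using i d len by (simp add: nth_eq_iff_index_eq)
    qed
    moreover have "\<not> j < r"
    proof
      assume "j < r"
      then have "v \<in> set (take r L)" using j len by (auto simp: in_set_conv_nth intro!: exI[of _ j])
      then show False using r src by simp
    qed
    ultimately show ?thesis using i j num by simp
  qed
  ultimately show ?thesis
    unfolding topo_ok_def source_first_numbering_def verts_G
    using less num ord bnd arcs_ends_conv[of G] by auto
qed

lemma wp_topo:
  assumes n: "words s0 ''n'' 0 = n" and l: "loaded s0"
  shows "wp W topo (\<lambda>t s. topo_ok s \<and> t \<le> 20 * (n * n) + 20 * n + 20) s0"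
proof -
  define s1 where "s1 = setw ''q'' 0 0 s0"
  have "wp W (For ''i'' (V ''n'') topo_init) (\<lambda>t s. wp W (For ''k'' (V ''n'') topo_step)
     (\<lambda>t' s. topo_ok s \<and> 1 + (t + t') \<le> 20 * (n * n) + 20 * n + 20) s) s1"
  proof (rule wp_For[where n = n and K = 5 and I = "\<lambda>k s. \<exists>L. queue L s \<and> distinct L \<and>
        set L = {v. v < k \<and> in_degree G v = 0} \<and> (\<forall>v<k. words s ''deg'' v = in_degree G v)"], goal_cases)
    case 4
    then show ?case by (auto simp: s1_def queue_def)
  next
    case (5 k s)
    then obtain L where L: "queue L s" "distinct L" "set L = {v. v < k \<and> in_degree G v = 0}"
      "\<forall>v<k. words s ''deg'' v = in_degree G v" by blast
    have "words s ''indeg'' k = in_degree G k" using l 5(1,2) by (auto simp: loaded_def same_def s1_def)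
    from wp_topo_init[OF L 5(1,3) this] show ?case by (rule wp_mono) (simp add: queue_def)
  next
    case (6 t s)
    note S = 6(1) and t = 6(4)
    from 6 obtain L where L: "queue L s" "distinct L" "set L = {v. v < n \<and> in_degree G v = 0}"
      "\<forall>v<n. words s ''deg'' v = in_degree G v" by blast
    have src: "in_degree G v = 0 \<longleftrightarrow> (\<forall>u. \<not> u \<rightarrow> v)" for v
      using finite_dominating[of v "\<lambda>_. True"] by (simp add: in_degree_card)
    have "topo_inv (\<lambda>_. set (take 0 L)) L s"
      unfolding topo_inv_def
    proof (intro conjI)
      show "\<exists>r. set (take r L) = {v. v < n \<and> in_degree G v = 0}" using L by (intro exI[of _ "length L"]) simp
      show "\<forall>i<length L. \<forall>u. u \<rightarrow> L ! i \<longrightarrow> u \<in> set (take i L)"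
        using L(3) src nth_mem by blast
    qed (use L src in \<open>auto simp: in_degree_card\<close>)
    then have I0: "\<exists>L. 0 \<le> length L \<and> topo_inv (\<lambda>_. set (take 0 L)) L (setw ''k'' 0 0 s)"
      by (auto simp: topo_inv_def queue_def)
    have s: "words s ''n'' 0 = n" "\<forall>u<n. \<forall>v<n. words s ''adj'' (u * n + v) = (if u \<rightarrow> v then 1 else 0)"
      using S l n by (auto simp: same_def s1_def loaded_def)
    show ?case
    proof (rule wp_For[where n = n and K = "n * 8 + 3"
          and I = "\<lambda>k s. \<exists>L. k \<le> length L \<and> topo_inv (\<lambda>_. set (take k L)) L s", OF _ _ _ I0], goal_cases)
      case (4 k s')
      then obtain L where L: "k \<le> length L" "topo_inv (\<lambda>_. set (take k L)) L s'" by blast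
      have "words s' ''n'' 0 = n" "\<forall>u<n. \<forall>v<n. words s' ''adj'' (u * n + v) = (if u \<rightarrow> v then 1 else 0)"
        using 4(2) s by (auto simp: same_def)
      from wp_topo_step[OF L(2) topo_progress[OF L(2,1) 4(1)] 4(3) this] show ?case
      proof (rule wp_mono, elim conjE exE, goal_cases)
        case (1 t s2 L')
        then show ?case by (auto intro!: exI[of _ "L @ L'"] simp del: length_append)
      qed
    next
      case (5 t' s')
      then show ?case using t topo_inv_final by (auto simp: algebra_simps)
    qed (use s n_le_W in \<open>auto simp: same_def\<close>)
  qed (use n n_le_W in \<open>auto simp: same_def s1_def\<close>)
  then show ?thesis by (simp add: topo_def s1_def)
qed

end

section \<open>Transitive closure by fast matrix multiplication\<close>

text \<open>Numbering and order are fixed as data instead of being read from a state, since the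
  later phases never change them.\<close>

locale numbered_instance = dag_instance G w n m W
  for G :: "(nat, nat) pre_digraph" (structure) and w n m W +
  fixes num ord :: "nat \<Rightarrow> nat"
  assumes num: "source_first_numbering num"
    and ord: "i < n \<Longrightarrow> ord i < n" "i < n \<Longrightarrow> num (ord i) = Suc i"
begin

lemma num_inj: "inj_on num {..<n}" and num_image: "num ` {..<n} = {1..n}"
  using num verts_G unfolding source_first_numbering_def bij_betw_def by auto

lemma num_mono: "u \<rightarrow> v \<Longrightarrow> num u < num v"
  using num unfolding source_first_numbering_def arcs_ends_conv by auto

sublocale nd: numbered_dag G w num
  by unfold_locales (use num_inj num verts_G in \<open>auto simp: source_first_numbering_def\<close>)

lemma ord_num: "u < n \<Longrightarrow> ord (num u - 1) = u" and num_bounds: "u < n \<Longrightarrow> 1 \<le> num u \<and> num u \<le> n"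
proof -
  assume u: "u < n"
  then have "num u \<in> {1..n}" using num_image by blast
  then show b: "1 \<le> num u \<and> num u \<le> n" by simp
  then have "num (ord (num u - 1)) = num u" "ord (num u - 1) < n" using ord[of "num u - 1"] by auto
  then show "ord (num u - 1) = u" using num_inj u by (auto dest: inj_onD)
qed

lemma ord_inj: "i < n \<Longrightarrow> j < n \<Longrightarrow> ord i = ord j \<longleftrightarrow> i = j"
  using ord(2) by (metis nat.inject)

text \<open>Adjacency between positions of the topological order, counted from 0. The positions from
  \<open>n\<close> on, which pad the matrix to a power of two, have no edges.\<close>

definition edge :: "nat \<Rightarrow> nat \<Rightarrow> bool" where
  "edge i j \<longleftrightarrow> i < n \<and> j < n \<and> ord i \<rightarrow> ord j"

abbreviation reach :: "nat \<Rightarrow> nat \<Rightarrow> bool" where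
  "reach \<equiv> edge\<^sup>*\<^sup>*"

lemma edge_less: "edge i j \<Longrightarrow> i < j"
  using num_mono[of "ord i" "ord j"] ord(2) by (simp add: edge_def)

lemma reach_le: "reach i j \<Longrightarrow> i \<le> j"
  by (induction rule: rtranclp_induct) (auto dest: edge_less)

text \<open>Positions increase along edges, so a path from below \<open>c\<close> to
  \<open>c\<close> or above uses one edge across the cut. It splits the path into a part within the
  first half of a block, this edge, and a part within the second half.\<close>

lemma reach_crossing:
  assumes "reach i j" "i < c" "c \<le> j"
  shows "\<exists>x y. i \<le> x \<and> x < c \<and> c \<le> y \<and> y \<le> j \<and> reach i x \<and> edge x y \<and> reach y j"
  using assms
proof (induction rule: rtranclp_induct)
  case base
  then show ?case by simp
next
  case (step y z)
  show ?case
  proof (cases "c \<le> y")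
    case True
    with step edge_less[OF step.hyps(2)] show ?thesis by (meson le_trans less_imp_le rtranclp.rtrancl_into_rtrancl)
  next
    case False
    then show ?thesis using step reach_le[OF step.hyps(1)] by (intro exI[of _ y] exI[of _ z]) auto
  qed
qed

lemma reach_ord_iff:
  assumes "i < n" "j < n"
  shows "reach i j \<longleftrightarrow> ord i \<rightarrow>\<^sup>* ord j"
proof
  assume "reach i j"
  then show "ord i \<rightarrow>\<^sup>* ord j" using assms(1)
  proof (induction rule: converse_rtranclp_induct)
    case base
    then show ?case using ord verts_G assms by simp
  next
    case (step x y)
    then show ?case by (auto simp: edge_def intro: adj_reachable_trans)
  qed
next
  have "ord i \<rightarrow>\<^sup>* v \<Longrightarrow> reach i (num v - 1)" for v
  proof (induction rule: reachable_induct)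
    case base
    then show ?case using ord(2)[OF assms(1)] by simp
  next
    case (step x y)
    then have "edge (num x - 1) (num y - 1)"
      using dominates_bounds[of x y] num_bounds[of x] num_bounds[of y] ord_num[of x] ord_num[of y]
      by (auto simp: edge_def)
    with step show ?case by simp
  qed
  from this[of "ord j"] show "ord i \<rightarrow>\<^sup>* ord j \<Longrightarrow> reach i j" using ord(2)[OF assms(2)] by simp
qed

definition lg :: nat where "lg = (LEAST l. n \<le> 2 ^ l)"

text \<open>With a power of two, every diagonal block can be halved exactly, down to single
  entries.\<close>

definition dim :: nat where "dim = 2 ^ lg"

lemma n_le_dim: "n \<le> dim"
  unfolding dim_def lg_def by (rule LeastI[of "\<lambda>l. n \<le> 2 ^ l" n]) simp

lemma power_less_n: "k < lg \<Longrightarrow> 2 ^ k < n"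
  using not_less_Least[of k "\<lambda>l. n \<le> 2 ^ l"] by (simp add: lg_def)

lemma dim_le: "dim \<le> 2 * n + 1"
  using power_less_n[of "lg - 1"] by (cases lg) (auto simp: dim_def)

lemma dim_pos: "0 < dim"
  by (simp add: dim_def)

lemma dim_le_W: "dim \<le> W"
proof (rule le_W(2))
  show "dim \<le> (n + 2) ^ 2" using dim_le by (simp add: power2_eq_square)
qed

end

text \<open>Puts an underscore in front of every array of the multiplication program. No other array
  name begins with one, except those that pass the dimension, the factors and the product.\<close>

abbreviation under :: "vname \<Rightarrow> vname" where "under \<equiv> (#) CHR ''_''"

lemma mem_under_image [simp]: "a # x \<in> under ` S \<longleftrightarrow> a = CHR ''_'' \<and> x \<in> S"
  by auto

abbreviation bidx :: "nexp \<Rightarrow> nexp \<Rightarrow> nexp" where "bidx x y \<equiv> NAdd (NMul x (V ''b'')) y"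
abbreviation xidx :: "nexp \<Rightarrow> nexp \<Rightarrow> nexp" where "xidx x y \<equiv> NAdd (NMul x (V ''N'')) y"

section \<open>The block program for the closure of an upper triangular matrix\<close>

definition pow2 :: com where
  "pow2 = Seq (Var_assign ''N'' (NLit 1))
     (While (NLess (V ''N'') (V ''n'')) (Var_assign ''N'' (NMul (NLit 2) (V ''N''))))"

definition mat_cell :: com where
  "mat_cell = (let c = xidx (V ''i'') (V ''j'') in
     Cond (BAnd (BNot (NLess (V ''i'') (V ''j''))) (BNot (NLess (V ''j'') (V ''i'')))) (RAssign ''X'' c (RLit 1))
      (Cond (BAnd (BAnd (NLess (V ''i'') (V ''n'')) (NLess (V ''j'') (V ''n'')))
          (NLess (NLit 0) (NCell ''adj'' (idx (NCell ''ord'' (V ''i'')) (NCell ''ord'' (V ''j''))))))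
        (RAssign ''X'' c (RLit 1)) (RAssign ''X'' c (RLit 0))))"

definition mat_init :: com where
  "mat_init = For ''i'' (V ''N'') (For ''j'' (V ''N'') mat_cell)"

definition block_loop :: "com \<Rightarrow> com" where
  "block_loop c = For ''i'' (V ''b'') (For ''j'' (V ''b'') c)"

definition copy_in :: "vname \<Rightarrow> nexp \<Rightarrow> nexp \<Rightarrow> com" where
  "copy_in a x y = block_loop (RAssign a (bidx (V ''i'') (V ''j''))
     (RCell ''X'' (xidx (NAdd x (V ''i'')) (NAdd y (V ''j'')))))"

definition copy_back :: com where
  "copy_back = block_loop (RAssign ''_A'' (bidx (V ''i'') (V ''j'')) (RCell ''_C'' (bidx (V ''i'') (V ''j''))))"

definition copy_out :: com where
  "copy_out = block_loop (RAssign ''X'' (xidx (NAdd (V ''r'') (V ''i'')) (NAdd (NAdd (V ''r'') (V ''b'')) (V ''j'')))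
     (RCell ''_C'' (bidx (V ''i'') (V ''j''))))"

definition mult :: "com \<Rightarrow> com" where
  "mult c = Seq (Var_assign ''_n'' (V ''b'')) (cren under c)"

text \<open>Treats the diagonal block with first row P, U and second row 0, Q, all of size
  \<open>b\<close>, where P and Q are closed already while U still holds the edges: U is replaced by
  P U Q.\<close>

definition block_step :: "com \<Rightarrow> com" where
  "block_step c =
     Seq (Var_assign ''r'' (NMul (NMul (NLit 2) (V ''b'')) (V ''p'')))
    (Seq (copy_in ''_A'' (V ''r'') (V ''r''))
    (Seq (copy_in ''_B'' (V ''r'') (NAdd (V ''r'') (V ''b'')))
    (Seq (mult c)
    (Seq copy_back
    (Seq (copy_in ''_B'' (NAdd (V ''r'') (V ''b'')) (NAdd (V ''r'') (V ''b'')))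
    (Seq (mult c) copy_out))))))"

definition level :: "com \<Rightarrow> com" where
  "level c = Seq (For ''p'' (NDiv (V ''N'') (NMul (NLit 2) (V ''b''))) (block_step c))
     (Var_assign ''b'' (NMul (NLit 2) (V ''b'')))"

definition extract_cell :: com where
  "extract_cell = Cond (RLess (RLit 0) (RCell ''X'' (xidx (V ''i'') (V ''j''))))
     (NAssign ''RP'' (idx (V ''i'') (V ''j'')) (NLit 1)) (NAssign ''RP'' (idx (V ''i'') (V ''j'')) (NLit 0))"

definition mat_closure :: "com \<Rightarrow> com" where
  "mat_closure c = Seq pow2 (Seq mat_init (Seq (Var_assign ''b'' (NLit 1))
     (Seq (While (NLess (V ''b'') (V ''N'')) (level c))
       (For ''i'' (V ''n'') (For ''j'' (V ''n'') extract_cell)))))"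

lemma vars_mat [simp]:
  "wvars mat_cell = {}" "rvars mat_cell = {''X''}"
  "wvars (copy_in a x y) = {''i'', ''j''}" "rvars (copy_in a x y) = {a}"
  "wvars copy_back = {''i'', ''j''}" "rvars copy_back = {''_A''}"
  "wvars copy_out = {''i'', ''j''}" "rvars copy_out = {''X''}"
  "wvars (mult c) = insert ''_n'' (under ` wvars c)" "rvars (mult c) = under ` rvars c"
  "wvars extract_cell = {''RP''}" "rvars extract_cell = {}"
  by (auto simp: mat_cell_def copy_in_def block_loop_def copy_back_def copy_out_def mult_def
      extract_cell_def Let_def wvars_cren rvars_cren)

lemma vars_block_step [simp]:
  "wvars (block_step c) = {''r'', ''i'', ''j'', ''_n''} \<union> under ` wvars c"
  "rvars (block_step c) = {''_A'', ''_B'', ''X''} \<union> under ` rvars c"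
  by (auto simp: block_step_def)

text \<open>The running time is an arbitrary \<open>Mt\<close> with natural values; the exponent
  enters only in the final estimate.\<close>

locale mm_program =
  fixes c0 :: com and Mt :: "nat \<Rightarrow> nat" and d0 :: nat
  assumes mm: "words s ''n'' 0 = k \<Longrightarrow> \<exists>t s'. run ((k + 2) ^ d0) c0 s t s' \<and>
     (\<forall>i<k. \<forall>j<k. reals s' ''C'' (i * k + j) = (\<Sum>l<k. reals s ''A'' (i * k + l) * reals s ''B'' (l * k + j))) \<and>
     (1 \<le> k \<longrightarrow> t \<le> Mt k)"
begin

lemma wp_mult:
  assumes "words s ''b'' 0 = b" "1 \<le> b" "b \<le> W" "(b + 2) ^ d0 \<le> W"
  shows "wp W (mult c0) (\<lambda>t s'. t \<le> Mt b + 1 \<and> (\<forall>i<b. \<forall>j<b. reals s' ''_C'' (i * b + j) =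
     (\<Sum>l<b. reals s ''_A'' (i * b + l) * reals s ''_B'' (l * b + j)))) s"
proof -
  let ?s1 = "setw ''_n'' 0 b s"
  have "words (pull under ?s1) ''n'' 0 = b" by simp
  from mm[OF this] obtain t s' where
    1: "run ((b + 2) ^ d0) c0 (pull under ?s1) t s'" "t \<le> Mt b"
      "\<forall>i<b. \<forall>j<b. reals s' ''C'' (i * b + j) =
         (\<Sum>l<b. reals (pull under ?s1) ''A'' (i * b + l) * reals (pull under ?s1) ''B'' (l * b + j))"
    using assms by blast
  have "run W c0 (pull under ?s1) t s'" using run_mono[OF 1(1) assms(4)] .
  from run_cren[OF this _ refl] obtain r where "run W (cren under c0) ?s1 t r" "s' = pull under r" by auto
  then have "wp W (cren under c0) (\<lambda>t s'. t \<le> Mt b \<and> (\<forall>i<b. \<forall>j<b. reals s' ''_C'' (i * b + j) =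
     (\<Sum>l<b. reals s ''_A'' (i * b + l) * reals s ''_B'' (l * b + j)))) ?s1"
    using 1 by (auto simp: wp_def)
  then show ?thesis using assms by (simp add: mult_def)
qed

end

lemma wp_block_loop:
  assumes b: "words s ''b'' 0 = b" "b \<le> W" and g: "inj_on g ({..<b} \<times> {..<b})"
    and e: "\<And>s' i j. i < b \<Longrightarrow> j < b \<Longrightarrow> same {''i'', ''j''} {a} s s' \<Longrightarrow> words s' ''i'' 0 = i \<Longrightarrow> words s' ''j'' 0 = j \<Longrightarrow>
      nval ix s' = g (i, j) \<and> rval e s' = f (i, j)"
    and post: "\<And>t s'. t \<le> b * (b * 3 + 4) + 2 \<Longrightarrow> same {''i'', ''j''} {a} s s' \<Longrightarrow>
      filled (reals s a) g f ({..<b} \<times> {..<b}) (reals s' a) \<Longrightarrow> Q t s'"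
  shows "wp W (block_loop (RAssign a ix e)) Q s"
  unfolding block_loop_def
proof (rule wp_fill[where get = "\<lambda>s. reals s a" and g = g and f = f and K = 1 and ?n1.0 = b and ?n2.0 = b], goal_cases)
  case (11 x y s')
  then show ?case using e[of x y s'] by simp
next
  case (12 t s')
  then show ?case using post[of t s'] by (simp add: mult.commute)
qed (use b g in \<open>auto simp: same_def\<close>)

text \<open>The entry of P U Q at \<open>(i, j)\<close>, where P, U and Q are the parts of size
  \<open>b\<close> of the diagonal block of \<open>X\<close> that starts at
  \<open>r\<close>.\<close>

definition block_product :: "(nat \<Rightarrow> nat \<Rightarrow> real) \<Rightarrow> nat \<Rightarrow> nat \<Rightarrow> nat \<Rightarrow> nat \<Rightarrow> real" where
  "block_product X r b i j =
     (\<Sum>l<b. (\<Sum>k<b. X (r + i) (r + k) * X (r + k) (r + b + l)) * X (r + b + l) (r + b + j))"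

lemma filled_row_major:
  "filled h0 (\<lambda>(i, j). i * b + j) f ({..<b} \<times> {..<b}) h \<Longrightarrow> i < b \<Longrightarrow> j < b \<Longrightarrow> h (i * b + j) = f (i, j)"
  by (auto simp: filled_def)

context mm_program
begin

lemma wp_block_step:
  fixes X :: "nat \<Rightarrow> nat \<Rightarrow> real"
  assumes b: "words s ''b'' 0 = b" "1 \<le> b" "b \<le> W" "(b + 2) ^ d0 \<le> W"
    and r: "r = 2 * b * words s ''p'' 0" "r \<le> W" "r + 2 * b \<le> N" and N: "words s ''N'' 0 = N"
    and X: "X = (\<lambda>i j. reals s ''X'' (i * N + j))"
  shows "wp W (block_step c0) (\<lambda>t s'. t \<le> 60 * (b * b) + 2 * Mt b \<and>
     filled (reals s ''X'') (\<lambda>(i, j). (r + i) * N + (r + b + j))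
       (\<lambda>(i, j). block_product X r b i j)
       ({..<b} \<times> {..<b}) (reals s' ''X'')) s" (is "wp W _ ?Q s")
proof -
  have inj: "inj_on (\<lambda>(i, j). i * b + j) ({..<b} \<times> {..<b})" by (rule row_major_inj0)
  have injX: "inj_on (\<lambda>(i, j). (r + i) * N + (r + b + j)) ({..<b} \<times> {..<b})"
    by (rule row_major_inj) (use r in simp)
  define Q where "Q = ?Q"
  define s1 where "s1 = setw ''r'' 0 r s"
  have s1: "words s1 ''b'' 0 = b" "words s1 ''N'' 0 = N" "words s1 ''r'' 0 = r"
    "\<And>i j. reals s1 ''X'' (i * N + j) = X i j" using b N X by (simp_all add: s1_def)
  let ?c7 = "copy_out" let ?c6 = "Seq (mult c0) ?c7"
  let ?c5 = "Seq (copy_in ''_B'' (NAdd (V ''r'') (V ''b'')) (NAdd (V ''r'') (V ''b''))) ?c6"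
  let ?c4 = "Seq copy_back ?c5" let ?c3 = "Seq (mult c0) ?c4"
  let ?c2 = "Seq (copy_in ''_B'' (V ''r'') (NAdd (V ''r'') (V ''b''))) ?c3"
  let ?t = "b * (b * 3 + 4) + 2"
  have "wp W (copy_in ''_A'' (V ''r'') (V ''r'')) (\<lambda>t1. wp W ?c2 (\<lambda>t2. Q (1 + (t1 + t2)))) s1"
    unfolding copy_in_def
  proof (rule wp_block_loop[where b = b and g = "\<lambda>(i, j). i * b + j" and f = "\<lambda>(i, j). X (r + i) (r + j)"], goal_cases)
    case (5 t1 s2)
    then have A2: "\<And>i j. i < b \<Longrightarrow> j < b \<Longrightarrow> reals s2 ''_A'' (i * b + j) = X (r + i) (r + j)"
      by (simp add: filled_row_major)
    have s2: "words s2 ''b'' 0 = b" "words s2 ''N'' 0 = N" "words s2 ''r'' 0 = r"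
      "\<And>i j. reals s2 ''X'' (i * N + j) = X i j" "reals s2 ''X'' = reals s ''X''"
      using 5(2) s1 by (auto simp: same_def s1_def)
    show ?case unfolding wp_Seq copy_in_def[of "''_B''" "V ''r''"]
    proof (rule wp_block_loop[where b = b and g = "\<lambda>(i, j). i * b + j" and f = "\<lambda>(i, j). X (r + i) (r + b + j)"], goal_cases)
      case (5 t2 s3)
      then have B3: "\<And>i j. i < b \<Longrightarrow> j < b \<Longrightarrow> reals s3 ''_B'' (i * b + j) = X (r + i) (r + b + j)"
        by (simp add: filled_row_major)
      have s3: "words s3 ''b'' 0 = b" "words s3 ''N'' 0 = N" "words s3 ''r'' 0 = r"
        "\<And>i j. reals s3 ''X'' (i * N + j) = X i j" "reals s3 ''X'' = reals s ''X''" "reals s3 ''_A'' = reals s2 ''_A''"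
        using 5(2) s2 by (auto simp: same_def)
      show ?case
      proof (rule wp_same[OF wp_mult[OF s3(1) b(2-4)]], elim conjE, goal_cases)
        case (1 t3 s4)
        note S = 1(1) and t3 = 1(2) and C = 1(3)
        have C4: "\<And>i j. i < b \<Longrightarrow> j < b \<Longrightarrow> reals s4 ''_C'' (i * b + j) = (\<Sum>k<b. X (r + i) (r + k) * X (r + k) (r + b + j))"
          using C s3 A2 B3 by simp
        have s4: "words s4 ''b'' 0 = b" "words s4 ''N'' 0 = N" "words s4 ''r'' 0 = r"
          "\<And>i j. reals s4 ''X'' (i * N + j) = X i j" "reals s4 ''X'' = reals s ''X''"
          using S s3 by (auto simp: same_def)
        show ?case
          unfolding copy_back_def
        proof (rule wp_block_loop[where b = b and g = "\<lambda>(i, j). i * b + j"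
              and f = "\<lambda>(i, j). (\<Sum>k<b. X (r + i) (r + k) * X (r + k) (r + b + j))"], goal_cases)
          case (5 t4 s5)
          then have A5: "\<And>i j. i < b \<Longrightarrow> j < b \<Longrightarrow> reals s5 ''_A'' (i * b + j) = (\<Sum>k<b. X (r + i) (r + k) * X (r + k) (r + b + j))"
            by (simp add: filled_row_major)
          have s5: "words s5 ''b'' 0 = b" "words s5 ''N'' 0 = N" "words s5 ''r'' 0 = r"
            "\<And>i j. reals s5 ''X'' (i * N + j) = X i j" "reals s5 ''X'' = reals s ''X''"
            using 5(2) s4 by (auto simp: same_def)
          show ?case unfolding copy_in_def
          proof (rule wp_block_loop[where b = b and g = "\<lambda>(i, j). i * b + j"
                and f = "\<lambda>(i, j). X (r + b + i) (r + b + j)"], goal_cases)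
            case (5 t5 s6)
            then have B6: "\<And>i j. i < b \<Longrightarrow> j < b \<Longrightarrow> reals s6 ''_B'' (i * b + j) = X (r + b + i) (r + b + j)"
              by (simp add: filled_row_major)
            have s6: "words s6 ''b'' 0 = b" "words s6 ''N'' 0 = N" "words s6 ''r'' 0 = r"
              "reals s6 ''X'' = reals s ''X''" "reals s6 ''_A'' = reals s5 ''_A''"
              using 5(2) s5 by (auto simp: same_def)
            show ?case
            proof (rule wp_same[OF wp_mult[OF s6(1) b(2-4)]], elim conjE)
              fix t6 s7 assume S: "same (wvars (mult c0)) (rvars (mult c0)) s6 s7" and t6: "t6 \<le> Mt b + 1"
                and C: "\<forall>i<b. \<forall>j<b. reals s7 ''_C'' (i * b + j) =
                  (\<Sum>l<b. reals s6 ''_A'' (i * b + l) * reals s6 ''_B'' (l * b + j))"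
              have C7: "\<And>i j. i < b \<Longrightarrow> j < b \<Longrightarrow> reals s7 ''_C'' (i * b + j) =
                block_product X r b i j"
                using C s6 A5 B6 by (simp add: block_product_def)
              have s7: "words s7 ''b'' 0 = b" "words s7 ''N'' 0 = N" "words s7 ''r'' 0 = r"
                "reals s7 ''X'' = reals s ''X''" using S s6 by (auto simp: same_def)
              show "wp W copy_out (\<lambda>t'b. Q (1 + (t1 + (t2 + (t3 + (t4 + (t5 + (t6 + t'b)))))))) s7"
                unfolding copy_out_def
              proof (rule wp_block_loop[where b = b and g = "\<lambda>(i, j). (r + i) * N + (r + b + j)"
                    and f = "\<lambda>(i, j). block_product X r b i j"],
                  goal_cases)
                case (5 t7 s8)
                obtain T where T: "T = ?t" by blast
                \<comment> \<open>Five copying loops, two products and one assignment. With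
                  \<open>b \<ge> 1\<close> the resulting 15 b^2 + 20 b + 13 is at most 60
                  b^2.\<close>
                have "1 + (t1 + (t2 + (t3 + (t4 + (t5 + (t6 + t7)))))) \<le> 5 * T + 2 * (Mt b + 1) + 1"
                  using 5(1) t3 t6 \<open>t1 \<le> ?t\<close> \<open>t2 \<le> ?t\<close> \<open>t4 \<le> ?t\<close> \<open>t5 \<le> ?t\<close>
                  unfolding T[symmetric] by simp
                also have "\<dots> \<le> 60 * (b * b) + 2 * Mt b"
                proof -
                  obtain c where "b = Suc c" using b(2) by (cases b) auto
                  then show ?thesis unfolding T by (simp add: algebra_simps)
                qed
                finally have "1 + (t1 + (t2 + (t3 + (t4 + (t5 + (t6 + t7)))))) \<le> 60 * (b * b) + 2 * Mt b" .
                then show ?case unfolding Q_def using 5(3) s7(4) by simp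
              qed (use s7 b injX C7 in \<open>auto simp: same_def\<close>)
            qed
          qed (use s5 b inj in \<open>auto simp: same_def\<close>)
        qed (use s4 b inj C4 in \<open>auto simp: same_def\<close>)
      qed
    qed (use s2 b inj in \<open>auto simp: same_def\<close>)
  qed (use s1 b inj in \<open>auto simp: same_def\<close>)
  then have "wp W (block_step c0) Q s" using b r N
    unfolding block_step_def by (simp only: wp_Seq wp_NAssign) (simp add: s1_def)
  then show ?thesis unfolding Q_def .
qed

end


section \<open>Correctness and cost of the block recursion\<close>

lemma sum_pos_iff_real:
  fixes f :: "'a \<Rightarrow> real"
  assumes "finite A" "\<And>x. x \<in> A \<Longrightarrow> 0 \<le> f x"
  shows "0 < sum f A \<longleftrightarrow> (\<exists>x\<in>A. 0 < f x)"
  using assms sum_nonneg_eq_0_iff[of A f] sum_nonneg[of A f] by (metis less_le)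

locale closure_instance = numbered_instance G w n m W num ord + mm_program c0 Mt d0
  for G :: "(nat, nat) pre_digraph" (structure) and w n m W num ord c0 Mt d0 +
  assumes Wd: "(n + 2) ^ d0 \<le> W"
begin

text \<open>The intended support of the matrix in the middle of a level: closed on all diagonal
  blocks of size \<open>b\<close> and on the first \<open>p\<close> ones of size
  \<open>2 * b\<close>, and still the bare edges elsewhere.\<close>

definition blk :: "nat \<Rightarrow> nat \<Rightarrow> nat \<Rightarrow> nat \<Rightarrow> bool" where
  "blk b p i j \<longleftrightarrow> (if i div (2 * b) = j div (2 * b) \<and> i div (2 * b) < p \<or> i div b = j div b
     then reach i j else edge i j)"

definition mat_inv :: "nat \<Rightarrow> nat \<Rightarrow> state \<Rightarrow> bool" where
  "mat_inv b p s \<longleftrightarrow> (\<forall>i<dim. \<forall>j<dim. 0 \<le> reals s ''X'' (i * dim + j) \<and>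
     (0 < reals s ''X'' (i * dim + j) \<longleftrightarrow> blk b p i j))"

lemma mat_inv_setw [simp]: "mat_inv b p (setw x i y s) = mat_inv b p s"
  by (simp add: mat_inv_def)

lemma block_div:
  fixes b p k :: nat
  assumes "k < b"
  shows "(2 * b * p + k) div (2 * b) = p" "(2 * b * p + b + k) div (2 * b) = p"
    "(2 * b * p + k) div b = 2 * p" "(2 * b * p + b + k) div b = 2 * p + 1"
proof -
  have "(p * (2 * b) + k) div (2 * b) = p" "(p * (2 * b) + (b + k)) div (2 * b) = p"
    "((2 * p) * b + k) div b = 2 * p" "((2 * p + 1) * b + k) div b = 2 * p + 1"
    using assms by (simp_all only: div_mult_self3 div_less)
  then show "(2 * b * p + k) div (2 * b) = p" "(2 * b * p + b + k) div (2 * b) = p"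
    "(2 * b * p + k) div b = 2 * p" "(2 * b * p + b + k) div b = 2 * p + 1"
    by (simp_all add: algebra_simps)
qed

text \<open>Entries are nonnegative, so nothing cancels and the sum is positive exactly when one
  summand is. Such a summand is a path that is split at the edge crossing the middle of the
  block.\<close>

lemma block_sum_pos:
  fixes X :: "nat \<Rightarrow> nat \<Rightarrow> real"
  assumes X: "\<And>i j. i < dim \<Longrightarrow> j < dim \<Longrightarrow> 0 \<le> X i j \<and> (0 < X i j \<longleftrightarrow> blk b p i j)"
    and r: "r = 2 * b * p" "r + 2 * b \<le> dim" and ij: "i < b" "j < b"
  shows "0 \<le> block_product X r b i j" (is "0 \<le> ?S")
    and "0 < block_product X r b i j \<longleftrightarrow> reach (r + i) (r + b + j)"
proof -
  define P where "P l = (\<Sum>k<b. X (r + i) (r + k) * X (r + k) (r + b + l))" for l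
  have eq: "?S = (\<Sum>l<b. P l * X (r + b + l) (r + b + j))" by (simp add: block_product_def P_def)
  have lt: "r + k < dim" "r + b + k < dim" if "k < b" for k using that r by auto
  have nn: "0 \<le> X (r + i) (r + k)" "0 \<le> X (r + k) (r + b + l)" "0 \<le> X (r + b + l) (r + b + j)"
    if "k < b" "l < b" for k l using X lt that ij by simp_all
  have pos: "0 < X (r + i) (r + k) \<longleftrightarrow> reach (r + i) (r + k)" "0 < X (r + k) (r + b + l) \<longleftrightarrow> edge (r + k) (r + b + l)"
    "0 < X (r + b + l) (r + b + j) \<longleftrightarrow> reach (r + b + l) (r + b + j)"
    if "k < b" "l < b" for k l using X lt that ij block_div[of _ b p] unfolding blk_def r(1) by simp_all
  have P: "0 \<le> P l" "0 < P l \<longleftrightarrow> (\<exists>k<b. reach (r + i) (r + k) \<and> edge (r + k) (r + b + l))" if l: "l < b" for l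
  proof -
    show "0 \<le> P l" unfolding P_def using nn l by (intro sum_nonneg) auto
    have "0 < X (r + i) (r + k) * X (r + k) (r + b + l) \<longleftrightarrow> reach (r + i) (r + k) \<and> edge (r + k) (r + b + l)"
      if "k < b" for k
      using nn[OF that l] pos[OF that l] by (auto simp: zero_less_mult_iff)
    then show "0 < P l \<longleftrightarrow> (\<exists>k<b. reach (r + i) (r + k) \<and> edge (r + k) (r + b + l))"
      unfolding P_def using nn l by (subst sum_pos_iff_real) auto
  qed
  show "0 \<le> ?S" unfolding eq using nn P by (intro sum_nonneg) auto
  have "0 < P l * X (r + b + l) (r + b + j) \<longleftrightarrow>
     (\<exists>k<b. reach (r + i) (r + k) \<and> edge (r + k) (r + b + l)) \<and> reach (r + b + l) (r + b + j)" if "l < b" for l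
    using nn[OF _ that] P[OF that] pos[OF _ that] ij by (auto simp: zero_less_mult_iff)
  then have "0 < ?S \<longleftrightarrow> (\<exists>l<b. (\<exists>k<b. reach (r + i) (r + k) \<and> edge (r + k) (r + b + l)) \<and> reach (r + b + l) (r + b + j))"
    unfolding eq using nn P by (subst sum_pos_iff_real) auto
  also have "\<dots> \<longleftrightarrow> reach (r + i) (r + b + j)"
  proof
    assume "reach (r + i) (r + b + j)"
    from reach_crossing[OF this, of "r + b"] ij obtain x y where
      xy: "r + i \<le> x" "x < r + b" "r + b \<le> y" "y \<le> r + b + j" "reach (r + i) x" "edge x y" "reach y (r + b + j)"
      by auto
    then have "x = r + (x - r)" "y = r + b + (y - (r + b))" "x - r < b" "y - (r + b) < b" using ij by auto
    with xy show "\<exists>l<b. (\<exists>k<b. reach (r + i) (r + k) \<and> edge (r + k) (r + b + l)) \<and> reach (r + b + l) (r + b + j)"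
      by metis
  qed (meson rtranclp.rtrancl_into_rtrancl rtranclp_trans)
  finally show "0 < ?S \<longleftrightarrow> reach (r + i) (r + b + j)" .
qed

lemma mat_inv_block:
  assumes I: "mat_inv b p s" and r: "r = 2 * b * p" "r + 2 * b \<le> dim" and b: "1 \<le> b"
    and f: "filled (reals s ''X'') (\<lambda>(i, j). (r + i) * dim + (r + b + j))
       (\<lambda>(i, j). block_product X r b i j)
       ({..<b} \<times> {..<b}) (reals s' ''X'')"
    and X: "X = (\<lambda>i j. reals s ''X'' (i * dim + j))"
  shows "mat_inv b (Suc p) s'"
  unfolding mat_inv_def
proof (intro allI impI)
  fix i j assume ij: "i < dim" "j < dim"
  have X': "\<And>i j. i < dim \<Longrightarrow> j < dim \<Longrightarrow> 0 \<le> X i j \<and> (0 < X i j \<longleftrightarrow> blk b p i j)"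
    using I by (auto simp: mat_inv_def X)
  show "0 \<le> reals s' ''X'' (i * dim + j) \<and> (0 < reals s' ''X'' (i * dim + j)) = blk b (Suc p) i j"
  proof (cases "\<exists>i'<b. \<exists>j'<b. i = r + i' \<and> j = r + b + j'")
    case True
    then obtain i' j' where *: "i' < b" "j' < b" "i = r + i'" "j = r + b + j'" by blast
    then have "reals s' ''X'' (i * dim + j) = block_product X r b i' j'"
      using f by (auto simp: filled_def)
    moreover have "blk b (Suc p) i j = reach i j" using block_div[OF *(1), of p] block_div[OF *(2), of p] *
      by (simp add: blk_def r)
    ultimately show ?thesis using block_sum_pos[OF X' r *(1,2)] *(3,4) by simp
  next
    case False
    have "i * dim + j \<notin> (\<lambda>(i, j). (r + i) * dim + (r + b + j)) ` ({..<b} \<times> {..<b})"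
    proof
      assume "i * dim + j \<in> (\<lambda>(i, j). (r + i) * dim + (r + b + j)) ` ({..<b} \<times> {..<b})"
      then obtain i' j' where *: "i' < b" "j' < b" "i * dim + j = (r + i') * dim + (r + b + j')" by auto
      then have "i = r + i'" "j = r + b + j'" using row_major_eq_iff[of j dim "r + b + j'" i "r + i'"] ij r by auto
      with False * show False by blast
    qed
    then have eq: "reals s' ''X'' (i * dim + j) = X i j" using f by (simp add: filled_def X)
    have "blk b (Suc p) i j = blk b p i j"
    \<comment> \<open>The two predicates can differ only when both indices lie in block
      \<open>p\<close> of the doubled size, but in different halves.\<close>
    proof (cases "i div (2 * b) = p \<and> j div (2 * b) = p \<and> i div b \<noteq> j div b")
      case True
      have half: "x div (2 * b) = x div b div 2" for x by (metis div_mult2_eq mult.commute)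
      have "i div b div 2 = p" "j div b div 2 = p" using True half by auto
      then have "i div b = 2 * p \<and> j div b = 2 * p + 1 \<or> i div b = 2 * p + 1 \<and> j div b = 2 * p" using True by linarith
      then show ?thesis
      proof
        assume d: "i div b = 2 * p \<and> j div b = 2 * p + 1"
        have "i = i div b * b + i mod b" "j = j div b * b + j mod b" by simp_all
        then have "i = r + i mod b" "j = r + b + j mod b" using d r by (simp_all add: algebra_simps)
        moreover have "i mod b < b" "j mod b < b" using b by auto
        ultimately show ?thesis using False by blast
      next
        \<comment> \<open>This half lies below the diagonal, where neither \<open>reach\<close> nor
          \<open>edge\<close> can hold.\<close>
        assume d: "i div b = 2 * p + 1 \<and> j div b = 2 * p"
        then have "j < i" by (metis div_le_mono less_add_one not_le)
        then show ?thesis using reach_le[of i j] edge_less[of i j] by (auto simp: blk_def)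
      qed
    next
      case False
      then show ?thesis by (auto simp: blk_def)
    qed
    then show ?thesis using eq X' ij by simp
  qed
qed

definition level_time :: "nat \<Rightarrow> nat" where
  "level_time b = (dim div (2 * b)) * (60 * (b * b) + 2 * Mt b + 2) + 3"

lemma wp_level:
  assumes I: "mat_inv b 0 s" and b: "b = 2 ^ k" "k < lg" and s: "words s ''b'' 0 = b" "words s ''N'' 0 = dim"
  shows "wp W (level c0) (\<lambda>t s'. t \<le> level_time b \<and> mat_inv (2 * b) 0 s' \<and> words s' ''b'' 0 = 2 * b) s"
proof -
  have dvd: "2 * b dvd dim" unfolding dim_def b power_Suc[symmetric] by (rule le_imp_power_dvd) (use b in simp)
  then have le: "2 * b \<le> dim" using dim_pos dvd_imp_le by blast
  have bn: "b < n" using power_less_n b by simp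
  have bW: "1 \<le> b" "b \<le> W" "2 * b \<le> W" "(b + 2) ^ d0 \<le> W"
  proof -
    \<comment> \<open>Blocks that are still multiplied are smaller than \<open>n\<close>, so the
      word bound of one product stays below that of the run.\<close>
    have "(b + 2) ^ d0 \<le> (n + 2) ^ d0" using bn by (intro power_mono) auto
    with Wd show "(b + 2) ^ d0 \<le> W" by simp
  qed (use b le dim_le_W in auto)
  \<comment> \<open>When all blocks of a level are done, the invariant becomes that of the next
    level before its first block.\<close>
  have fin: "blk b (dim div (2 * b)) i j = blk (2 * b) 0 i j" if "i < dim" "j < dim" for i j
  proof -
    have "i div (2 * b) < dim div (2 * b)" using that dvd by (simp add: less_mult_imp_div_less)
    moreover have "x div (2 * b) = x div b div 2" for x by (metis div_mult2_eq mult.commute)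
    ultimately show ?thesis by (auto simp: blk_def)
  qed
  show ?thesis unfolding level_def wp_Seq
  proof (rule wp_For[where n = "dim div (2 * b)" and K = "60 * (b * b) + 2 * Mt b" and I = "mat_inv b"])
    show "dim div (2 * b) \<le> W" using dim_le_W by (meson div_le_dividend le_trans)
    show "mat_inv b 0 (setw ''p'' 0 0 s)" using I by simp
  next
    fix p s' assume p: "p < dim div (2 * b)" and S: "same (insert ''p'' (wvars (block_step c0))) (rvars (block_step c0)) s s'"
      and pp: "words s' ''p'' 0 = p" and I': "mat_inv b p s'"
    have "Suc p \<le> dim div (2 * b)" using p by simp
    then have "Suc p * (2 * b) \<le> dim" using dvd by (metis dvd_div_mult_self mult_le_mono1)
    then have r: "2 * b * p + 2 * b \<le> dim" by (simp add: algebra_simps)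
    have s': "words s' ''b'' 0 = b" "words s' ''N'' 0 = dim" using S s by (auto simp: same_def)
    show "wp W (block_step c0) (\<lambda>t s'. mat_inv b (Suc p) (setw ''p'' 0 (Suc p) s') \<and> t \<le> 60 * (b * b) + 2 * Mt b) s'"
      by (rule wp_mono, rule wp_block_step[where r = "2 * b * p" and N = dim])
        (use s' bW r dim_le_W pp mat_inv_block[OF I' refl r bW(1)] in auto)
  next
    fix t s' assume S: "same (insert ''p'' (wvars (block_step c0))) (rvars (block_step c0)) s s'"
      and I': "mat_inv b (dim div (2 * b)) s'" and t: "t \<le> dim div (2 * b) * (60 * (b * b) + 2 * Mt b + 2) + 2"
    have "words s' ''b'' 0 = b" using S s by (auto simp: same_def)
    moreover have "mat_inv (2 * b) 0 s'" using I' fin by (simp add: mat_inv_def)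
    ultimately show "wp W (Var_assign ''b'' (NMul (NLit 2) (V ''b'')))
      (\<lambda>t' s'. t + t' \<le> level_time b \<and> mat_inv (2 * b) 0 s' \<and> words s' ''b'' 0 = 2 * b) s'"
      using t bW by (simp add: level_time_def)
  qed (use s in \<open>auto simp: same_def\<close>)
qed

text \<open>Doubling raises \<open>N \<ge> 1\<close> by at least 1. This crude count gives a linear
  bound, which is enough here.\<close>

lemma wp_pow2:
  assumes n: "words s ''n'' 0 = n"
  shows "wp W pow2 (\<lambda>t s'. t \<le> 2 * n + 2 \<and> words s' ''N'' 0 = dim) s"
proof -
  have "wp W (While (NLess (V ''N'') (V ''n'')) (Var_assign ''N'' (NMul (NLit 2) (V ''N''))))
    (\<lambda>t s'. 1 + t \<le> 2 * n + 2 \<and> words s' ''N'' 0 = dim) (setw ''N'' 0 1 s)"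
  proof (rule wp_While[where I = "\<lambda>s. words s ''n'' 0 = n \<and> (\<exists>k\<le>lg. words s ''N'' 0 = 2 ^ k)"
        and \<Phi> = "\<lambda>s. 2 * (n - words s ''N'' 0)"])
    show "words (setw ''N'' 0 1 s) ''n'' 0 = n \<and> (\<exists>k\<le>lg. words (setw ''N'' 0 1 s) ''N'' 0 = 2 ^ k)"
      using n by (auto intro: exI[of _ 0])
  next
    fix s assume I: "words s ''n'' 0 = n \<and> (\<exists>k\<le>lg. words s ''N'' 0 = 2 ^ k)"
      and lt: "bval (NLess (V ''N'') (V ''n'')) s"
    then obtain k where k: "k \<le> lg" "words s ''N'' 0 = 2 ^ k" by blast
    have "k \<noteq> lg" using lt I k n_le_dim by (auto simp: dim_def)
    then have k': "Suc k \<le> lg" "2 * words s ''N'' 0 = 2 ^ Suc k" using k by auto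
    have "(2::nat) ^ Suc k \<le> dim" unfolding dim_def by (rule power_increasing) (use k' in auto)
    then have "2 * words s ''N'' 0 \<le> W" using k' dim_le_W by simp
    moreover have "1 \<le> words s ''N'' 0" "words s ''N'' 0 < n" using k lt I by auto
    then have "1 + 1 + 2 * (n - 2 * words s ''N'' 0) \<le> 2 * (n - words s ''N'' 0)" by linarith
    ultimately show "wp W (Var_assign ''N'' (NMul (NLit 2) (V ''N'')))
      (\<lambda>t s'. (words s' ''n'' 0 = n \<and> (\<exists>k\<le>lg. words s' ''N'' 0 = 2 ^ k)) \<and>
        1 + t + 2 * (n - words s' ''N'' 0) \<le> 2 * (n - words s ''N'' 0)) s"
      using I lt k' by (auto simp del: power_Suc)
  next
    fix t s' assume I: "words s' ''n'' 0 = n \<and> (\<exists>k\<le>lg. words s' ''N'' 0 = 2 ^ k)"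
      and "\<not> bval (NLess (V ''N'') (V ''n'')) s'"
      and t: "t + 2 * (n - words s' ''N'' 0) \<le> Suc (2 * (n - words (setw ''N'' 0 1 s) ''N'' 0))"
    then obtain k where k: "k \<le> lg" "words s' ''N'' 0 = 2 ^ k" "n \<le> 2 ^ k" by auto
    then have "lg \<le> k" unfolding lg_def by (intro Least_le)
    with k t show "1 + t \<le> 2 * n + 2 \<and> words s' ''N'' 0 = dim" by (auto simp: dim_def)
  qed
  then show ?thesis using dim_pos dim_le_W by (simp add: pow2_def)
qed

definition levels_time :: nat where
  "levels_time = (\<Sum>i<lg. level_time (2 ^ i) + 1)"

text \<open>The potential adds up the costs of the levels still to come, each with one step for the
  loop test.\<close>

lemma wp_levels:
  assumes I: "mat_inv 1 0 s" and s: "words s ''b'' 0 = 1" "words s ''N'' 0 = dim"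
  shows "wp W (While (NLess (V ''b'') (V ''N'')) (level c0))
     (\<lambda>t s'. t \<le> levels_time + 1 \<and> mat_inv dim 0 s') s"
proof (rule wp_While[where I = "\<lambda>s. words s ''N'' 0 = dim \<and> (\<exists>k\<le>lg. words s ''b'' 0 = 2 ^ k) \<and>
      mat_inv (words s ''b'' 0) 0 s"
      and \<Phi> = "\<lambda>s. \<Sum>i | i < lg \<and> words s ''b'' 0 \<le> 2 ^ i. level_time (2 ^ i) + 1"])
  show "words s ''N'' 0 = dim \<and> (\<exists>k\<le>lg. words s ''b'' 0 = 2 ^ k) \<and> mat_inv (words s ''b'' 0) 0 s"
    using assms by (auto intro: exI[of _ 0])
next
  fix s assume I: "words s ''N'' 0 = dim \<and> (\<exists>k\<le>lg. words s ''b'' 0 = 2 ^ k) \<and> mat_inv (words s ''b'' 0) 0 s"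
    and lt: "bval (NLess (V ''b'') (V ''N'')) s"
  then obtain k where k: "k \<le> lg" "words s ''b'' 0 = 2 ^ k" by blast
  have "k \<noteq> lg" using lt I k by (auto simp: dim_def)
  then have klt: "k < lg" using k by simp
  have "{i. i < lg \<and> (2::nat) ^ k \<le> 2 ^ i} = insert k {i. i < lg \<and> (2::nat) * 2 ^ k \<le> 2 ^ i}"
    using klt by (auto simp: power_Suc[symmetric] simp del: power_Suc)
  moreover have "k \<notin> {i. i < lg \<and> (2::nat) * 2 ^ k \<le> 2 ^ i}" by simp
  ultimately have sum: "(\<Sum>i | i < lg \<and> 2 ^ k \<le> (2::nat) ^ i. level_time (2 ^ i) + 1) =
     level_time (2 ^ k) + 1 + (\<Sum>i | i < lg \<and> 2 * 2 ^ k \<le> (2::nat) ^ i. level_time (2 ^ i) + 1)" by simp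
  have I': "mat_inv (2 ^ k) 0 s" "words s ''N'' 0 = dim" using I k by auto
  show "wp W (level c0) (\<lambda>t s'. (words s' ''N'' 0 = dim \<and> (\<exists>k\<le>lg. words s' ''b'' 0 = 2 ^ k) \<and> mat_inv (words s' ''b'' 0) 0 s') \<and>
      1 + t + (\<Sum>i | i < lg \<and> words s' ''b'' 0 \<le> 2 ^ i. level_time (2 ^ i) + 1) \<le>
      (\<Sum>i | i < lg \<and> words s ''b'' 0 \<le> 2 ^ i. level_time (2 ^ i) + 1)) s"
  proof (rule wp_same[OF wp_level[OF I'(1) refl klt k(2) I'(2)]], elim conjE)
    fix t s' assume S: "same (wvars (level c0)) (rvars (level c0)) s s'" and t: "t \<le> level_time (2 ^ k)"
      and inv: "mat_inv (2 * 2 ^ k) 0 s'" and b: "words s' ''b'' 0 = 2 * 2 ^ k"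
    have "words s' ''N'' = words s ''N''" using S by (simp add: same_def level_def)
    moreover have "\<exists>k\<le>lg. words s' ''b'' 0 = 2 ^ k" using b klt by (intro exI[of _ "Suc k"]) simp
    ultimately show "(words s' ''N'' 0 = dim \<and> (\<exists>k\<le>lg. words s' ''b'' 0 = 2 ^ k) \<and> mat_inv (words s' ''b'' 0) 0 s') \<and>
      1 + t + (\<Sum>i | i < lg \<and> words s' ''b'' 0 \<le> 2 ^ i. level_time (2 ^ i) + 1) \<le>
      (\<Sum>i | i < lg \<and> words s ''b'' 0 \<le> 2 ^ i. level_time (2 ^ i) + 1)"
      using inv I' t unfolding k(2) sum b by simp
  qed
next
  fix t s' assume I: "words s' ''N'' 0 = dim \<and> (\<exists>k\<le>lg. words s' ''b'' 0 = 2 ^ k) \<and> mat_inv (words s' ''b'' 0) 0 s'"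
    and nlt: "\<not> bval (NLess (V ''b'') (V ''N'')) s'"
    and t: "t + (\<Sum>i | i < lg \<and> words s' ''b'' 0 \<le> 2 ^ i. level_time (2 ^ i) + 1)
      \<le> Suc (\<Sum>i | i < lg \<and> words s ''b'' 0 \<le> 2 ^ i. level_time (2 ^ i) + 1)"
  obtain k where k: "k \<le> lg" "words s' ''b'' 0 = 2 ^ k" using I by blast
  then have "lg \<le> k" using I nlt by (simp add: dim_def)
  then have "words s' ''b'' 0 = dim" using k by (simp add: dim_def)
  moreover have "{i. i < lg \<and> words s ''b'' 0 \<le> 2 ^ i} = {..<lg}" using s by auto
  ultimately show "t \<le> levels_time + 1 \<and> mat_inv dim 0 s'" using I t by (simp add: levels_time_def)
qed

lemma wp_mat_closure:
  assumes n: "words s0 ''n'' 0 = n"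
    and adj: "\<forall>u<n. \<forall>v<n. words s0 ''adj'' (u * n + v) = (if u \<rightarrow> v then 1 else 0)"
    and o: "\<forall>i<n. words s0 ''ord'' i = ord i"
  shows "wp W (mat_closure c0) (\<lambda>t s. t \<le> 50 * (n * n) + 50 * n + 50 + levels_time \<and>
     (\<forall>i<n. \<forall>j<n. words s ''RP'' (i * n + j) = (if reach i j then 1 else 0))) s0" (is "wp W _ ?Q s0")
  unfolding mat_closure_def wp_Seq
proof (rule wp_same[OF wp_pow2[OF n]], elim conjE, goal_cases)
  case (1 t1 s1)
  note S1 = 1(1) and t1 = 1(2) and N1 = 1(3)
  have s1: "words s1 ''n'' 0 = n" "words s1 ''adj'' = words s0 ''adj''" "words s1 ''ord'' = words s0 ''ord''"
    using S1 n by (auto simp: same_def pow2_def)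
  show ?case
    unfolding mat_init_def
  proof (rule wp_fill[where get = "\<lambda>s. reals s ''X''" and g = "\<lambda>(i, j). i * dim + j"
        and f = "\<lambda>(i, j). if i = j \<or> edge i j then 1 else 0" and ?n1.0 = dim and ?n2.0 = dim and K = 3], goal_cases)
    case (11 i j s)
    then have s: "words s ''n'' 0 = n" "words s ''adj'' = words s0 ''adj''" "words s ''ord'' = words s0 ''ord''" "words s ''N'' 0 = dim"
      using s1 N1 by (auto simp: same_def)
    have "(i < n \<and> j < n \<and> 0 < words s0 ''adj'' (words s0 ''ord'' i * n + words s0 ''ord'' j)) = edge i j"
    proof (cases "i < n \<and> j < n")
      case True
      then have "words s0 ''adj'' (words s0 ''ord'' i * n + words s0 ''ord'' j) = (if ord i \<rightarrow> ord j then 1 else 0)"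
        using adj o ord by simp
      then show ?thesis using True by (simp add: edge_def)
    qed (auto simp: edge_def)
    then show ?case using 11 s by (auto simp: mat_cell_def Let_def not_less)
  next
    case (12 t2 s2)
    have s2: "words s2 ''n'' 0 = n" "words s2 ''N'' 0 = dim" using 12 s1 N1 by (auto simp: same_def)
    \<comment> \<open>At block size 1 the invariant describes the initial matrix, with ones on the
      diagonal and at the edges.\<close>
    have "mat_inv 1 0 (setw ''b'' 0 1 s2)" using filled_row_major[OF 12(2)] by (auto simp: mat_inv_def blk_def dest: reach_le)
    from wp_levels[OF this] s2 have lv: "wp W (While (NLess (V ''b'') (V ''N'')) (level c0))
      (\<lambda>t s'. t \<le> levels_time + 1 \<and> mat_inv dim 0 s') (setw ''b'' 0 1 s2)" by simp
    have "wp W (While (NLess (V ''b'') (V ''N'')) (level c0))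
      (\<lambda>t3. wp W (For ''i'' (V ''n'') (For ''j'' (V ''n'') extract_cell)) (\<lambda>t4. ?Q (t1 + (t2 + (1 + (t3 + t4)))))) (setw ''b'' 0 1 s2)"
    proof (rule wp_same[OF lv], elim conjE, goal_cases)
      case (1 t3 s3)
      note S3 = 1(1) and t3 = 1(2) and I = 1(3)
      have s3: "words s3 ''n'' 0 = n" "words s3 ''N'' 0 = dim" using S3 s2 by (auto simp: same_def level_def)
      show ?case
      proof (rule wp_fill[where get = "\<lambda>s. words s ''RP''" and g = "\<lambda>(i, j). i * n + j"
            and f = "\<lambda>(i, j). if reach i j then 1 else 0" and ?n1.0 = n and ?n2.0 = n and K = 2], goal_cases)
        case (11 i j s)
        then have s: "words s ''n'' 0 = n" "words s ''N'' 0 = dim" "reals s ''X'' = reals s3 ''X''"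
          using s3 by (auto simp: same_def)
        \<comment> \<open>At block size \<open>dim\<close> all positions share one block, so the
          positive entries are the reachable pairs.\<close>
        have "0 < reals s3 ''X'' (i * dim + j) \<longleftrightarrow> reach i j"
          using I 11(1,2) n_le_dim by (simp add: mat_inv_def blk_def)
        then show ?case using 11 s n_le_W by (auto simp: extract_cell_def)
      next
        case (12 t4 s4)
        obtain D where D: "D = dim * dim" by blast
        have "D \<le> (2 * n + 1) * (2 * n + 1)" unfolding D using dim_le by (intro mult_le_mono) auto
        then have "D \<le> 4 * (n * n) + 4 * n + 1" by (simp add: algebra_simps)
        moreover have "t2 \<le> 5 * D + 4 * dim + 2" using \<open>t2 \<le> _\<close> unfolding D by (simp add: algebra_simps)
        moreover have "t4 \<le> 4 * (n * n) + 4 * n + 2" using 12(3) by (simp add: algebra_simps)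
        ultimately have "t1 + (t2 + (1 + (t3 + t4))) \<le> 50 * (n * n) + 50 * n + 50 + levels_time"
          using t1 t3 dim_le by linarith
        then show ?case using filled_row_major[OF 12(2)] by simp
      qed (use s3 n_le_W row_major_inj0 in \<open>auto simp: same_def\<close>)
    qed
    then show ?case using n_le_W dim_pos dim_le_W by simp
  qed (use N1 dim_le_W row_major_inj0 in \<open>auto simp: same_def\<close>)
qed

end

section \<open>Transitive closure by merging columns\<close>

definition nm_update :: com where
  "nm_update = Cond (NLess (NLit 0) (NCell ''RP'' (idx (V ''i'') (V ''a''))))
     (NAssign ''RP'' (idx (V ''i'') (V ''j'')) (NLit 1)) Skip"

definition nm_merge :: com where
  "nm_merge = Seq (Var_assign ''a'' (NSub (NCell ''num'' (NCell ''inl'' (idx (V ''v'') (V ''k'')))) (NLit 1)))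
     (For ''i'' (V ''n'') nm_update)"

definition nm_init :: com where
  "nm_init = NAssign ''RP'' (idx (V ''i'') (V ''j'')) (NLit 0)"

definition nm_column :: com where
  "nm_column =
     Seq (Var_assign ''v'' (NCell ''ord'' (V ''j'')))
    (Seq (For ''i'' (V ''n'') nm_init)
    (Seq (NAssign ''RP'' (idx (V ''j'') (V ''j'')) (NLit 1))
         (For ''k'' (NCell ''indeg'' (V ''v'')) nm_merge)))"

definition nm_closure :: com where
  "nm_closure = For ''j'' (V ''n'') nm_column"

lemma vars_nm [simp]:
  "wvars nm_update = {''RP''}" "rvars nm_update = {}"
  "wvars nm_merge = {''a'', ''i'', ''RP''}" "rvars nm_merge = {}"
  "wvars nm_init = {''RP''}" "rvars nm_init = {}"
  "wvars nm_column = {''v'', ''i'', ''k'', ''a'', ''RP''}" "rvars nm_column = {}"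
  by (auto simp: nm_update_def nm_merge_def nm_init_def nm_column_def)

context numbered_instance
begin

definition graph_ok :: "state \<Rightarrow> bool" where
  "graph_ok s \<longleftrightarrow> words s ''n'' 0 = n \<and> words s ''m'' 0 = m \<and> loaded s \<and>
     (\<forall>i<n. words s ''ord'' i = ord i) \<and> words s ''num'' = num"

lemma graph_ok_same:
  "same A B s s' \<Longrightarrow> graph_ok s \<Longrightarrow> {''n'', ''m'', ''adj'', ''indeg'', ''inl'', ''ord'', ''num''} \<inter> A = {} \<Longrightarrow>
   ''wt'' \<notin> B \<Longrightarrow> graph_ok s'"
  unfolding graph_ok_def loaded_def same_def by (simp add: disjoint_iff)

definition columns :: "nat \<Rightarrow> state \<Rightarrow> bool" where
  "columns k s \<longleftrightarrow> (\<forall>j<k. \<forall>i<n. words s ''RP'' (i * n + j) = (if reach i j then 1 else 0))"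

lemma columns_setw [simp]: "x \<noteq> ''RP'' \<Longrightarrow> columns k (setw x i y s) = columns k s"
  by (simp add: columns_def)

lemma edge_pos: "j < n \<Longrightarrow> u \<rightarrow> ord j \<Longrightarrow> edge (num u - 1) j"
  using num_bounds[of u] ord_num[of u] dominates_bounds[of u "ord j"] by (auto simp: edge_def)

text \<open>The recurrence of the elementary algorithm: column \<open>j\<close> is the union of the
  columns of its in-neighbours and the diagonal entry. An arc costs one pass over \<open>n\<close>
  rows, which makes \<open>n * m\<close> in total.\<close>

lemma reach_column:
  assumes "j < n"
  shows "reach i j \<longleftrightarrow> i = j \<or> (\<exists>u. u \<rightarrow> ord j \<and> reach i (num u - 1))"
proof
  assume "reach i j"
  then show "i = j \<or> (\<exists>u. u \<rightarrow> ord j \<and> reach i (num u - 1))"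
  proof (cases rule: rtranclp.cases)
    case (rtrancl_into_rtrancl b)
    then show ?thesis using ord(2)[of b] by (auto simp: edge_def intro!: exI[of _ "ord b"])
  qed simp
next
  assume "i = j \<or> (\<exists>u. u \<rightarrow> ord j \<and> reach i (num u - 1))"
  then show "reach i j" using edge_pos[OF assms] by (meson rtranclp.simps)
qed

text \<open>\<open>P\<close> is the part of column \<open>j\<close> collected so far. The column
  that is read lies before \<open>j\<close>, so it is complete and unaffected by the writes.\<close>

lemma wp_nm_merge:
  assumes g: "graph_ok s" and c: "columns j s" and j: "j < n" "words s ''j'' 0 = j" and v: "words s ''v'' 0 = v" "v = ord j"
    and k: "k < in_degree G v" "words s ''k'' 0 = k"
    and P: "\<forall>i<n. words s ''RP'' (i * n + j) = (if P i then 1 else 0)"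
  shows "wp W nm_merge (\<lambda>t s'. t \<le> n * 4 + 3 \<and> columns j s' \<and> (\<forall>i<n. words s' ''RP'' (i * n + j) =
     (if P i \<or> reach i (num (words s ''inl'' (v * n + k)) - 1) then 1 else 0))) s"
proof -
  define u where "u = words s ''inl'' (v * n + k)"
  have vn: "v < n" using j ord v by simp
  have "u \<in> (\<lambda>k. words s ''inl'' (v * n + k)) ` {..<in_degree G v}" using k by (auto simp: u_def)
  then have u: "u \<rightarrow> v" using g vn unfolding graph_ok_def loaded_def by blast
  then have a: "num u - 1 < j" using edge_pos[OF j(1)] edge_less v(2) by blast
  have R: "\<forall>i<n. words s ''RP'' (i * n + (num u - 1)) = (if reach i (num u - 1) then 1 else 0)"
    using c a by (auto simp: columns_def)
  let ?s1 = "setw ''a'' 0 (num u - 1) s"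
  have "wp W (For ''i'' (V ''n'') nm_update) (\<lambda>t s'. 1 + t \<le> n * 4 + 3 \<and> columns j s' \<and> (\<forall>i<n. words s' ''RP'' (i * n + j) =
     (if P i \<or> reach i (num u - 1) then 1 else 0))) ?s1"
  proof (rule wp_For[where n = n and K = 2 and I = "\<lambda>l s'. columns j s' \<and>
        (\<forall>i<n. words s' ''RP'' (i * n + j) = (if P i \<or> i < l \<and> reach i (num u - 1) then 1 else 0))"], goal_cases)
    case (5 l s')
    have nz: "words s' ''n'' 0 = n" "words s' ''j'' 0 = j" "words s' ''a'' 0 = num u - 1"
      using 5(2) g j by (auto simp: same_def graph_ok_def)
    have r: "words s' ''RP'' (l * n + (num u - 1)) = (if reach l (num u - 1) then 1 else 0)"
      using 5(1,4) a by (auto simp: columns_def)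
    show ?case
    proof (cases "reach l (num u - 1)")
      case True
      have "columns j (setw ''RP'' (l * n + j) 1 s')" using 5(4) j by (auto simp: columns_def row_major_eq_iff)
      moreover have "\<forall>i<n. words (setw ''RP'' (l * n + j) 1 s') ''RP'' (i * n + j) =
         (if P i \<or> i < Suc l \<and> reach i (num u - 1) then 1 else 0)"
        using 5(1,4) j True by (auto simp: row_major_eq_iff less_Suc_eq)
      ultimately show ?thesis using 5(3) nz r True n_le_W 5(1) by (simp add: nm_update_def)
    next
      case False
      then show ?thesis using 5(3,4) nz r by (auto simp: nm_update_def less_Suc_eq)
    qed
  next
    case (6 t s')
    then show ?case by auto
  qed (use g n_le_W P c in \<open>auto simp: same_def graph_ok_def\<close>)
  moreover have "num u - 1 \<le> W" using a j n_le_W by simp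
  moreover have "words s ''num'' = num" "words s ''n'' 0 = n" using g by (auto simp: graph_ok_def)
  ultimately show ?thesis using v k unfolding nm_merge_def by (simp add: u_def)
qed

lemma wp_nm_column:
  assumes g: "graph_ok s" and c: "columns j s" and j: "j < n" "words s ''j'' 0 = j"
  shows "wp W nm_column (\<lambda>t s'. t \<le> in_degree G (ord j) * (n * 4 + 5) + n * 3 + 6 \<and> columns (Suc j) s') s"
proof -
  define v where "v = ord j"
  have vn: "v < n" using j ord by (simp add: v_def)
  define s1 where "s1 = setw ''v'' 0 v s"
  have g1: "graph_ok s1" by (rule graph_ok_same[OF _ g, of "{''v''}" "{}"]) (auto simp: same_def s1_def)
  have s1: "words s1 ''j'' 0 = j" "words s1 ''v'' 0 = v" "columns j s1" using j c by (auto simp: s1_def)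
  have "wp W (For ''i'' (V ''n'') nm_init) (\<lambda>t1. wp W (NAssign ''RP'' (idx (V ''j'') (V ''j'')) (NLit 1))
     (\<lambda>t2. wp W (For ''k'' (NCell ''indeg'' (V ''v'')) nm_merge)
       (\<lambda>t3 s'. 1 + (t1 + (t2 + t3)) \<le> in_degree G v * (n * 4 + 5) + n * 3 + 6 \<and> columns (Suc j) s'))) s1"
  proof (rule wp_For[where n = n and K = 1 and I = "\<lambda>l s. columns j s \<and> (\<forall>i<l. words s ''RP'' (i * n + j) = 0)"], goal_cases)
    case (5 l s')
    then show ?case using g1 s1 j
      by (auto simp: nm_init_def columns_def row_major_eq_iff less_Suc_eq same_def graph_ok_def)
  next
    case (6 t1 s2)
    have g2: "graph_ok s2" by (rule graph_ok_same[OF 6(1) g1]) auto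
    have s2: "words s2 ''j'' 0 = j" "words s2 ''v'' 0 = v" "words s2 ''n'' 0 = n" using s1 g1 6(1)
      by (auto simp: same_def graph_ok_def)
    define s3 where "s3 = setw ''RP'' (j * n + j) 1 s2"
    have g3: "graph_ok s3" by (rule graph_ok_same[OF _ g2, of "{''RP''}" "{}"]) (auto simp: same_def s3_def)
    have s3: "words s3 ''j'' 0 = j" "words s3 ''v'' 0 = v" "columns j s3"
      "\<forall>i<n. words s3 ''RP'' (i * n + j) = (if i = j then 1 else 0)"
      using 6(3) s2 j by (auto simp: s3_def columns_def row_major_eq_iff)
    define Pk where "Pk k i \<longleftrightarrow> i = j \<or> (\<exists>k'<k. reach i (num (words s3 ''inl'' (v * n + k')) - 1))" for k i
    have "wp W (For ''k'' (NCell ''indeg'' (V ''v'')) nm_merge) (\<lambda>t3 s'. 1 + (t1 + (1 + t3)) \<le> in_degree G v * (n * 4 + 5) + n * 3 + 6 \<and> columns (Suc j) s') s3"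
    proof (rule wp_For[where n = "in_degree G v" and K = "n * 4 + 3" and I = "\<lambda>k s. columns j s \<and>
        (\<forall>i<n. words s ''RP'' (i * n + j) = (if Pk k i then 1 else 0))"], goal_cases)
      case (5 k s')
      have g': "graph_ok s'" by (rule graph_ok_same[OF 5(2) g3]) auto
      have s': "words s' ''j'' 0 = j" "words s' ''v'' 0 = v" "words s' ''inl'' = words s3 ''inl''"
        using 5(2) s3 by (auto simp: same_def)
      have "Pk (Suc k) i = (Pk k i \<or> reach i (num (words s' ''inl'' (v * n + k)) - 1))" for i
        by (auto simp: Pk_def less_Suc_eq s')
      then show ?case
        using wp_nm_merge[OF g' _ j(1) s'(1,2) v_def 5(1,3), of "Pk k"] 5(4)
        by (auto elim!: wp_mono)
    next
      case (6 t3 s')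
      have "Pk (in_degree G v) i = reach i j" for i
      proof -
        have "(\<exists>k'<in_degree G v. reach i (num (words s3 ''inl'' (v * n + k')) - 1)) \<longleftrightarrow>
          (\<exists>u\<in>(\<lambda>k. words s3 ''inl'' (v * n + k)) ` {..<in_degree G v}. reach i (num u - 1))" by auto
        also have "(\<lambda>k. words s3 ''inl'' (v * n + k)) ` {..<in_degree G v} = {u. u \<rightarrow> v}"
          using g3 vn by (auto simp: graph_ok_def loaded_def)
        finally show ?thesis unfolding Pk_def reach_column[OF j(1), of i] v_def by auto
      qed
      then have "columns (Suc j) s'" using 6(3) by (auto simp: columns_def less_Suc_eq)
      then show ?case using 6(4) \<open>t1 \<le> n * (1 + 2) + 2\<close> by (simp add: algebra_simps)
    qed (use g3 s3 vn in_degree_le[of v] n_le_W in \<open>auto simp: same_def graph_ok_def loaded_def Pk_def\<close>)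
    then show ?case using s2 n_le_W j by (simp add: s3_def)
  qed (use g1 s1 n_le_W in \<open>auto simp: same_def graph_ok_def\<close>)
  moreover have "words s ''ord'' j = v" using g j by (simp add: graph_ok_def v_def)
  ultimately show ?thesis unfolding nm_column_def wp_Seq_eta using j vn n_le_W by (simp add: s1_def v_def[symmetric])
qed

lemma sum_in_degree: "(\<Sum>v<n. in_degree G v) = m"
proof -
  have "card (\<Union>v\<in>{..<n}. in_arcs G v) = (\<Sum>v<n. card (in_arcs G v))"
    by (rule card_UN_disjoint) (auto simp: in_arcs_eq)
  moreover have "(\<Union>v\<in>{..<n}. in_arcs G v) = {..<m}" using arc_bounds by (auto simp: in_arcs_eq)
  ultimately show ?thesis by (simp add: in_degree_def)
qed

lemma ord_bij: "bij_betw ord {..<n} {..<n}"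
proof (rule bij_betw_byWitness[where f' = "\<lambda>u. num u - 1"])
  show "(\<lambda>u. num u - 1) ` {..<n} \<subseteq> {..<n}" using num_bounds by fastforce
qed (use ord ord_num in auto)

lemma sum_ord: "(\<Sum>j<n. f (ord j)) = (\<Sum>v<n. f v :: 'b :: comm_monoid_add)"
  by (rule sum.reindex_bij_betw[OF ord_bij])

lemma sum_tail_step:
  fixes f :: "nat \<Rightarrow> nat"
  shows "k < n \<Longrightarrow> (\<Sum>j\<in>{k..<n}. f j) = f k + (\<Sum>j\<in>{Suc k..<n}. f j)"
  by (simp add: sum.atLeast_Suc_lessThan)

text \<open>The potential pays for the merges of the columns still to come; initially it contains
  the sum of all indegrees, which is \<open>m\<close>.\<close>

lemma wp_nm_closure:
  assumes g: "graph_ok s"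
  shows "wp W nm_closure (\<lambda>t s'. t \<le> 20 * (n * m) + 20 * m + 20 * (n * n) + 20 * n + 20 \<and> columns n s') s"
  unfolding nm_closure_def
proof (rule wp_For_potential[where n = n and K = "n * 3 + 6" and I = columns
      and \<Phi> = "\<lambda>k s. \<Sum>j\<in>{k..<n}. in_degree G (ord j) * (n * 4 + 5)"], goal_cases)
  case (5 k s')
  have g': "graph_ok s'" by (rule graph_ok_same[OF 5(2) g]) auto
  show ?case by (rule wp_mono[OF wp_nm_column[OF g' 5(4,1,3)]]) (simp add: sum_tail_step[OF 5(1)])
next
  case (6 t s')
  have "(\<Sum>j\<in>{0..<n}. in_degree G (ord j) * (n * 4 + 5)) = m * (n * 4 + 5)"
    using sum_ord[of "in_degree G"] sum_in_degree by (simp add: sum_distrib_right[symmetric] atLeast0LessThan)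
  then show ?case using 6 by (simp add: algebra_simps)
qed (use g n_le_W in \<open>auto simp: same_def graph_ok_def columns_def\<close>)

end

section \<open>Choosing between the two closure algorithms by the clock\<close>

definition closure_prog :: "com \<Rightarrow> com" where
  "closure_prog c =
     Seq (Var_assign ''budget'' (NAdd (NMul (V ''n'') (V ''m'')) (NMul (V ''n'') (V ''n''))))
    (Seq (Var_assign ''clock'' (NLit 0))
    (Seq (clocked (mat_closure c)) (Cond running Skip nm_closure)))"

lemma wvars_mat_closure:
  "{''N'', ''i'', ''j'', ''b'', ''p'', ''r'', ''RP''} \<subseteq> A \<Longrightarrow> range under \<subseteq> A \<Longrightarrow> wvars (mat_closure c) \<subseteq> A"
  unfolding insert_subset by (auto simp: mat_closure_def pow2_def mat_init_def level_def)

lemma rvars_mat_closure: "''X'' \<in> A \<Longrightarrow> range under \<subseteq> A \<Longrightarrow> rvars (mat_closure c) \<subseteq> A"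
  by (auto simp: mat_closure_def pow2_def mat_init_def level_def)

lemma wvars_closure_prog:
  assumes "{''N'', ''i'', ''j'', ''b'', ''p'', ''r'', ''RP'', ''clock'', ''budget'', ''v'', ''k'', ''a''} \<subseteq> A" "range under \<subseteq> A"
  shows "wvars (closure_prog c) \<subseteq> A"
proof -
  have "wvars (clocked (mat_closure c)) \<subseteq> A"
    by (rule order_trans[OF wvars_clocked]) (use assms wvars_mat_closure[of A c] in simp)
  then show ?thesis using assms by (simp add: closure_prog_def nm_closure_def)
qed

lemma rvars_closure_prog: "''X'' \<in> A \<Longrightarrow> range under \<subseteq> A \<Longrightarrow> rvars (closure_prog c) \<subseteq> A"
  using rvars_mat_closure[of A c] by (simp add: closure_prog_def rvars_clocked nm_closure_def)

text \<open>The unknown program contributes only names that begin with an underscore, so it can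
  neither read nor write the clock and the budget.\<close>

lemma cnames_mat_closure: "a \<in> {''clock'', ''budget''} \<Longrightarrow> a \<notin> cnames (mat_closure c)"
  using cnames_cren[of under c]
  by (auto simp: mat_closure_def pow2_def mat_init_def mat_cell_def level_def block_step_def copy_in_def
      copy_back_def copy_out_def block_loop_def mult_def extract_cell_def For_def Let_def)

context closure_instance
begin

definition mat_time :: nat where
  "mat_time = 50 * (n * n) + 50 * n + 50 + levels_time"

lemma graph_ok_clocked:
  assumes r: "run W (clocked (mat_closure c0)) (setw ''clock'' 0 0 s) t s'" and g: "graph_ok s"
  shows "graph_ok s'"
proof -
  let ?A = "- {''n'', ''m'', ''adj'', ''indeg'', ''inl'', ''ord'', ''num''}"
  have "wvars (clocked (mat_closure c0)) \<subseteq> ?A"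
  proof (rule order_trans[OF wvars_clocked])
    have "wvars (mat_closure c0) \<subseteq> ?A" by (rule wvars_mat_closure) (simp, blast)
    then show "insert ''clock'' (wvars (mat_closure c0)) \<subseteq> ?A" by simp
  qed
  moreover have "rvars (clocked (mat_closure c0)) \<subseteq> - {''wt''}"
    unfolding rvars_clocked by (rule rvars_mat_closure) auto
  ultimately have "same ?A (- {''wt''}) (setw ''clock'' 0 0 s) s'" using same_mono[OF run_same[OF r]] by blast
  moreover have "same ?A (- {''wt''}) s (setw ''clock'' 0 0 s)" by (simp add: same_def)
  ultimately have "same ?A (- {''wt''}) s s'" using same_trans by blast
  then show ?thesis by (rule graph_ok_same[OF _ g]) auto
qed

text \<open>If the clock ends below the budget, the simulation is faithful and the result of the
  matrix program stands. A run that uses the budget up, even exactly, is discarded; then the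
  elementary algorithm costs no more than a constant multiple of what has been spent, up to terms of
  order n^2 + 1.\<close>

lemma wp_closure_prog:
  assumes g: "graph_ok s0"
  shows "wp W (closure_prog c0) (\<lambda>t s. columns n s \<and>
     t \<le> (overhead (mat_closure c0) + 100) * (min mat_time (n * m + n * n) + n * n + n + 1)) s0"
proof -
  define B where "B = n * m + n * n"
  define z where "z = overhead (mat_closure c0)"
  have "n * m + n * n \<le> n * (n * n) + n * n" using m_le by simp
  also have "\<dots> \<le> (n + 2) ^ 3" by (simp add: power3_eq_cube algebra_simps)
  finally have BW: "B \<le> W" unfolding B_def by (rule le_W)
  define s1 where "s1 = setw ''budget'' 0 B s0"
  have g1: "graph_ok s1" by (rule graph_ok_same[OF _ g, of "{''budget''}" "{}"]) (auto simp: same_def s1_def)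
  have "wp W (mat_closure c0) (\<lambda>t s. t \<le> mat_time \<and> columns n s) s1"
    by (rule wp_mono[OF wp_mat_closure]) (use g1 in \<open>auto simp: graph_ok_def loaded_def mat_time_def columns_def\<close>)
  then obtain t s' where r: "run W (mat_closure c0) s1 t s'" "t \<le> mat_time" "columns n s'" unfolding wp_def by blast
  have "wp W (clocked (mat_closure c0)) (\<lambda>t1. wp W (Cond running Skip nm_closure)
     (\<lambda>t2 s. columns n s \<and> 2 + t1 + t2 \<le> (z + 100) * (min mat_time B + n * n + n + 1))) (setw ''clock'' 0 0 s1)"
  \<comment> \<open>The simulation has to start with a clock below the budget; an empty budget means
    \<open>n = 0\<close>.\<close>
  proof (cases "B = 0")
    case True
    then have "words (setw ''clock'' 0 0 s1) ''budget'' 0 \<le> words (setw ''clock'' 0 0 s1) ''clock'' 0" by (simp add: s1_def)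
    from clocked_expired[OF this, of W "mat_closure c0"] obtain t1 s2 where
      2: "run W (clocked (mat_closure c0)) (setw ''clock'' 0 0 s1) t1 s2" "t1 \<le> z"
      "words s2 ''clock'' 0 = 0" "words s2 ''budget'' 0 = 0" using True by (auto simp: s1_def z_def)
    have n0: "n = 0" using True by (simp add: B_def)
    have g2: "graph_ok s2"
      by (rule graph_ok_clocked[OF 2(1) g1])
    have "m = 0" using m_le n0 by simp
    have "wp W (Cond running Skip nm_closure)
     (\<lambda>t2 s. columns n s \<and> 2 + t1 + t2 \<le> (z + 100) * (min mat_time B + n * n + n + 1)) s2"
      using wp_nm_closure[OF g2] 2 n0 \<open>m = 0\<close> True by (auto elim!: wp_mono)
    then show ?thesis using 2(1) unfolding wp_def by blast
  next
    case False
    have "words s1 ''budget'' 0 = B" by (simp add: s1_def)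
    from run_clocked[OF r(1) _ _ this _ BW, of 0] cnames_mat_closure False obtain t1 s2 k where
      2: "run W (clocked (mat_closure c0)) (setw ''clock'' 0 0 s1) t1 s2" "k \<le> t" "k \<le> B"
      "t1 \<le> z * k + z" "words s2 ''clock'' 0 = k" "words s2 ''budget'' 0 = B"
      "k < B \<longrightarrow> s2 = setw ''clock'' 0 k s'" by (auto simp: z_def clock_spec_def)
    have zk: "z * k \<le> z * min mat_time B" using 2 r by (intro mult_le_mono2) auto
    have "wp W (Cond running Skip nm_closure)
      (\<lambda>t2 s. columns n s \<and> 2 + t1 + t2 \<le> (z + 100) * (min mat_time B + n * n + n + 1)) s2"
    proof (cases "k < B")
      case True
      have "2 + t1 + 2 \<le> (z + 100) * (min mat_time B + n * n + n + 1)"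
      proof -
        have "t1 \<le> z * min mat_time B + z" using 2(4) zk by linarith
        then show ?thesis by (simp add: algebra_simps)
      qed
      then show ?thesis using True 2 r by simp
    next
      case False
      then have k: "k = B" using 2 by simp
      \<comment> \<open>Ticks never exceed the steps of the original run, so
        \<open>B = k \<le> t \<le> mat_time\<close>.\<close>
      then have min: "min mat_time B = B" using 2 r by simp
      have mB: "m \<le> B" "n * m \<le> B" unfolding B_def using m_le by auto
      have g2: "graph_ok s2"
        by (rule graph_ok_clocked[OF 2(1) g1])
      have "wp W nm_closure (\<lambda>t2 s. columns n s \<and> 2 + t1 + (1 + t2) \<le> (z + 100) * (min mat_time B + n * n + n + 1)) s2"
      proof (rule wp_mono[OF wp_nm_closure[OF g2]], elim conjE, intro conjI)
        fix t2 s assume t2: "t2 \<le> 20 * (n * m) + 20 * m + 20 * (n * n) + 20 * n + 20"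
        have "t2 \<le> 40 * B + 20 * (n * n) + 20 * n + 20" using t2 mB by linarith
        moreover have "t1 \<le> z * B + z" using 2 k by simp
        ultimately have "2 + t1 + (1 + t2) \<le> z * B + z + 40 * B + 20 * (n * n) + 20 * n + 23" by linarith
        also have "\<dots> \<le> (z + 100) * (B + n * n + n + 1)" by (simp add: algebra_simps)
        finally show "2 + t1 + (1 + t2) \<le> (z + 100) * (min mat_time B + n * n + n + 1)" unfolding min .
      qed
      then show ?thesis using False 2 by simp
    qed
    then show ?thesis using 2(1) unfolding wp_def by blast
  qed
  moreover have "words s0 ''n'' 0 = n" "words s0 ''m'' 0 = m" using g by (auto simp: graph_ok_def)
  ultimately show ?thesis unfolding closure_prog_def using BW
    by (simp add: s1_def B_def z_def)
qed

end

section \<open>Computing the trees\<close>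

abbreviation NEq :: "nexp \<Rightarrow> nexp \<Rightarrow> bexp" where
  "NEq x y \<equiv> BAnd (BNot (NLess x y)) (BNot (NLess y x))"

text \<open>By De Morgan: nothing found yet, or a strictly smaller cost, or a cost that is not
  larger together with a smaller number.\<close>

definition better :: bexp where
  "better = BNot (BAnd (NLess (NLit 0) (V ''found''))
     (BAnd (BNot (RLess (RCell ''c'' (NLit 0)) (RCell ''bc'' (NLit 0))))
       (BNot (BAnd (BNot (RLess (RCell ''bc'' (NLit 0)) (RCell ''c'' (NLit 0))))
         (NLess (NCell ''num'' (V ''x'')) (NCell ''num'' (V ''t'')))))))"

definition scan_step :: com where
  "scan_step =
     Seq (Var_assign ''x'' (NCell ''inl'' (idx (V ''v'') (V ''k''))))
       (Cond (NLess (NLit 0) (NCell ''reach'' (idx (V ''u'') (V ''x''))))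
         (Seq (RAssign ''c'' (NLit 0) (RAdd (RCell ''dist'' (idx (V ''u'') (V ''x''))) (RCell ''wt'' (idx (V ''x'') (V ''v'')))))
           (Cond better (Seq (Var_assign ''t'' (V ''x''))
             (Seq (RAssign ''bc'' (NLit 0) (RCell ''c'' (NLit 0))) (Var_assign ''found'' (NLit 1)))) Skip)) Skip)"

definition scan :: com where
  "scan = Seq (Var_assign ''found'' (NLit 0)) (For ''k'' (NCell ''indeg'' (V ''v'')) scan_step)"

definition walk_step :: com where
  "walk_step =
     Seq (NAssign ''reach'' (idx (V ''x'') (V ''v'')) (NLit 1))
    (Seq (RAssign ''dist'' (idx (V ''x'') (V ''v''))
       (RAdd (RCell ''dist'' (idx (V ''x'') (V ''t''))) (RCell ''wt'' (idx (V ''t'') (V ''v'')))))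
    (Seq (Cond (NEq (V ''x'') (V ''t'')) (NAssign ''succ'' (idx (V ''x'') (V ''v'')) (V ''v''))
       (NAssign ''succ'' (idx (V ''x'') (V ''v'')) (NCell ''succ'' (idx (V ''x'') (V ''t'')))))
    (Var_assign ''x'' (NCell ''succ'' (idx (V ''x'') (V ''v''))))))"

definition walk :: com where
  "walk = Seq (Var_assign ''x'' (V ''u''))
     (While (NLess (NCell ''reach'' (idx (V ''x'') (V ''v''))) (NLit 1)) walk_step)"

definition visit :: com where
  "visit = Cond (NLess (NLit 0) (NCell ''RP'' (idx (V ''i'') (V ''j''))))
     (Seq (Var_assign ''u'' (NCell ''ord'' (V ''i'')))
       (Cond (NLess (NCell ''reach'' (idx (V ''u'') (V ''v''))) (NLit 1)) (Seq scan walk) Skip)) Skip"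

definition target :: com where
  "target =
     Seq (Var_assign ''v'' (NCell ''ord'' (V ''j'')))
    (Seq (NAssign ''reach'' (idx (V ''v'') (V ''v'')) (NLit 1))
    (Seq (RAssign ''dist'' (idx (V ''v'') (V ''v'')) (RLit 0))
         (For ''i'' (V ''n'') visit)))"

definition trees :: com where
  "trees = Seq (For ''i'' (V ''n'') (For ''j'' (V ''n'') (NAssign ''reach'' (idx (V ''i'') (V ''j'')) (NLit 0))))
     (For ''j'' (V ''n'') target)"

lemma vars_trees [simp]:
  "wvars scan_step = {''x'', ''t'', ''found''}" "rvars scan_step = {''c'', ''bc''}"
  "wvars scan = {''x'', ''t'', ''found'', ''k''}" "rvars scan = {''c'', ''bc''}"
  "wvars walk = {''x'', ''reach'', ''succ''}" "rvars walk = {''dist''}"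
  "wvars visit = {''u'', ''x'', ''t'', ''found'', ''k'', ''reach'', ''succ''}" "rvars visit = {''c'', ''bc'', ''dist''}"
  "wvars target = {''v'', ''i'', ''u'', ''x'', ''t'', ''found'', ''k'', ''reach'', ''succ''}" "rvars target = {''c'', ''bc'', ''dist''}"
  by (auto simp: scan_step_def scan_def walk_def walk_step_def visit_def target_def)

context numbered_instance
begin

abbreviation "prd \<equiv> nd.prd"
abbreviation "sc \<equiv> nd.sc"
abbreviation "dst \<equiv> nd.dst"

definition wgt :: "nat \<Rightarrow> nat \<Rightarrow> real" where
  "wgt x v = w (THE e. e < m \<and> tail G e = x \<and> head G e = v)"

lemma wgt_eq: "e < m \<Longrightarrow> w e = wgt (tail G e) (head G e)"
  unfolding wgt_def by (rule arg_cong[of _ _ w], rule the_equality[symmetric]) (auto intro: arc_eqI)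

lemma wt_eq: "graph_ok s \<Longrightarrow> x \<rightarrow> v \<Longrightarrow> reals s ''wt'' (x * n + v) = wgt x v"
  unfolding graph_ok_def loaded_def using wgt_eq by (auto simp: dominates_iff)

lemma prdD:
  assumes "u \<rightarrow>\<^sup>+ v"
  shows "prd u v \<rightarrow> v" "u \<rightarrow>\<^sup>* prd u v" "dst u v = dst u (prd u v) + wgt (prd u v) v"
proof -
  obtain e where e: "e \<in> arcs G" "tail G e = prd u v" "head G e = v" "u \<rightarrow>\<^sup>* prd u v"
    "dst u v = dst u (prd u v) + w e" using nd.prd[OF assms] by metis
  then show "prd u v \<rightarrow> v" "u \<rightarrow>\<^sup>* prd u v" "dst u v = dst u (prd u v) + wgt (prd u v) v"
    using wgt_eq[of e] arcs_G in_arcs_imp_in_arcs_ends[of e] by auto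
qed

lemma prd_le:
  assumes "x \<rightarrow> v" "u \<rightarrow>\<^sup>* x"
  shows "dst u v \<le> dst u x + wgt x v" "dst u v = dst u x + wgt x v \<Longrightarrow> num (prd u v) \<le> num x"
proof -
  obtain e where e: "e < m" "tail G e = x" "head G e = v" using assms dominates_iff by blast
  then show "dst u v \<le> dst u x + wgt x v" "dst u v = dst u x + wgt x v \<Longrightarrow> num (prd u v) \<le> num x"
    using nd.prd_minimal[of e v u] assms wgt_eq[of e] arcs_G by auto
qed

lemma reachable_bounds: "u \<rightarrow>\<^sup>* v \<Longrightarrow> u < n" "u \<rightarrow>\<^sup>* v \<Longrightarrow> v < n"
  using reachable_in_verts verts_G by auto

text \<open>The output array \<open>reach\<close> doubles as the record of the vertices that the
  tree of \<open>v\<close> covers so far.\<close>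

definition marked :: "nat \<Rightarrow> state \<Rightarrow> nat set" where
  "marked v s = {u. u < n \<and> words s ''reach'' (u * n + v) \<noteq> 0}"

definition good :: "nat \<Rightarrow> state \<Rightarrow> bool" where
  "good v s \<longleftrightarrow> (\<forall>u\<in>marked v s. u \<rightarrow>\<^sup>* v \<and> reals s ''dist'' (u * n + v) = dst u v \<and>
     (u \<noteq> v \<longrightarrow> words s ''succ'' (u * n + v) = sc u v))"

definition finished :: "nat \<Rightarrow> state \<Rightarrow> bool" where
  "finished v s \<longleftrightarrow> good v s \<and> marked v s = {u. u \<rightarrow>\<^sup>* v}"

text \<open>The marked vertices are closed under successors, except that a successor in
  \<open>A\<close> may still be unmarked. During a walk \<open>A\<close> contains the next vertex of
  the path; between walks it is empty.\<close>

definition closed_marks :: "nat \<Rightarrow> nat set \<Rightarrow> state \<Rightarrow> bool" where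
  "closed_marks v A s \<longleftrightarrow> (\<forall>y\<in>marked v s. y \<noteq> v \<longrightarrow> sc y v \<in> A \<union> marked v s)"

definition same_column :: "nat \<Rightarrow> state \<Rightarrow> state \<Rightarrow> bool" where
  "same_column a s s' \<longleftrightarrow> (\<forall>y<n. words s' ''reach'' (y * n + a) = words s ''reach'' (y * n + a) \<and>
     words s' ''succ'' (y * n + a) = words s ''succ'' (y * n + a) \<and>
     reals s' ''dist'' (y * n + a) = reals s ''dist'' (y * n + a))"

definition unmarked :: "nat \<Rightarrow> state \<Rightarrow> nat set" where
  "unmarked v s = {u. u \<rightarrow>\<^sup>* v} - marked v s"

lemma finite_unmarked: "finite (unmarked v s)"
  by (rule finite_subset[of _ "{..<n}"]) (auto simp: unmarked_def dest: reachable_bounds)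

lemma marked_same_column: "same_column v s s' \<Longrightarrow> marked v s' = marked v s"
  by (auto simp: same_column_def marked_def)

lemma good_same_column: "same_column v s s' \<Longrightarrow> good v s \<Longrightarrow> good v s'"
  using marked_same_column[of v s s'] by (auto simp: good_def same_column_def marked_def)

lemma finished_same_column: "same_column v s s' \<Longrightarrow> finished v s \<Longrightarrow> finished v s'"
  using marked_same_column[of v s s'] good_same_column[of v s s'] by (simp add: finished_def)

lemma same_column_same: "same A B s s' \<Longrightarrow> ''reach'' \<notin> A \<Longrightarrow> ''succ'' \<notin> A \<Longrightarrow> ''dist'' \<notin> B \<Longrightarrow> same_column v s s'"
  by (simp add: same_def same_column_def)

lemma same_column_trans: "same_column v s s' \<Longrightarrow> same_column v s' s'' \<Longrightarrow> same_column v s s''"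
  by (simp add: same_column_def)

lemma closed_marks_same_column: "same_column v s s' \<Longrightarrow> closed_marks v A s \<Longrightarrow> closed_marks v A s'"
  using marked_same_column[of v s s'] by (simp add: closed_marks_def)

lemma unmarked_same_column: "same_column v s s' \<Longrightarrow> unmarked v s' = unmarked v s"
  using marked_same_column[of v s s'] by (simp add: unmarked_def)

lemma finishedD:
  assumes "finished v s"
  shows "u \<rightarrow>\<^sup>* v \<Longrightarrow> u \<in> marked v s"
    and "u \<rightarrow>\<^sup>* v \<Longrightarrow> words s ''reach'' (u * n + v) \<noteq> 0"
    and "u \<rightarrow>\<^sup>* v \<Longrightarrow> reals s ''dist'' (u * n + v) = dst u v"
    and "u \<rightarrow>\<^sup>* v \<Longrightarrow> u \<noteq> v \<Longrightarrow> words s ''succ'' (u * n + v) = sc u v"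
    and "u < n \<Longrightarrow> \<not> u \<rightarrow>\<^sup>* v \<Longrightarrow> words s ''reach'' (u * n + v) = 0"
proof -
  have iff: "u \<in> marked v s \<longleftrightarrow> u \<rightarrow>\<^sup>* v" and g: "good v s" using assms by (auto simp: finished_def)
  show "u \<rightarrow>\<^sup>* v \<Longrightarrow> u \<in> marked v s" using iff by simp
  then show "u \<rightarrow>\<^sup>* v \<Longrightarrow> words s ''reach'' (u * n + v) \<noteq> 0"
    "u \<rightarrow>\<^sup>* v \<Longrightarrow> reals s ''dist'' (u * n + v) = dst u v"
    "u \<rightarrow>\<^sup>* v \<Longrightarrow> u \<noteq> v \<Longrightarrow> words s ''succ'' (u * n + v) = sc u v"
    using g by (auto simp: good_def marked_def)
  show "u < n \<Longrightarrow> \<not> u \<rightarrow>\<^sup>* v \<Longrightarrow> words s ''reach'' (u * n + v) = 0"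
    using iff by (simp add: marked_def)
qed

text \<open>\<open>X\<close> consists of the in-neighbours examined so far that \<open>u\<close>
  reaches. With no candidate yet, \<open>t\<close> and \<open>bc\<close> are arbitrary, which is why
  \<open>found\<close> is kept.\<close>

definition scan_inv :: "nat \<Rightarrow> nat \<Rightarrow> nat set \<Rightarrow> state \<Rightarrow> bool" where
  "scan_inv u v X s \<longleftrightarrow> (if X = {} then words s ''found'' 0 = 0 else
     words s ''found'' 0 = 1 \<and> words s ''t'' 0 \<in> X \<and>
     reals s ''bc'' 0 = dst u (words s ''t'' 0) + wgt (words s ''t'' 0) v \<and>
     (\<forall>x\<in>X. reals s ''bc'' 0 < dst u x + wgt x v \<or>
        reals s ''bc'' 0 = dst u x + wgt x v \<and> num (words s ''t'' 0) \<le> num x))"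

lemma scan_inv_cong:
  "words s' ''found'' = words s ''found'' \<Longrightarrow> words s' ''t'' = words s ''t'' \<Longrightarrow> reals s' ''bc'' = reals s ''bc'' \<Longrightarrow>
   scan_inv u v X s' = scan_inv u v X s"
  by (simp only: scan_inv_def)

lemma wp_scan_step:
  assumes g: "graph_ok s" and u: "u < n" "words s ''u'' 0 = u" and v: "v < n" "words s ''v'' 0 = v"
    and f: "\<forall>x. x \<rightarrow> v \<longrightarrow> finished x s" and k: "words s ''k'' 0 = k"
    and x: "x = words s ''inl'' (v * n + k)" "x \<rightarrow> v"
    and I: "scan_inv u v X s"
  shows "wp W scan_step (\<lambda>t s'. t \<le> 7 \<and> scan_inv u v (if u \<rightarrow>\<^sup>* x then insert x X else X) s') s"
proof -
  have gs: "words s ''n'' 0 = n" "words s ''num'' = num" using g by (auto simp: graph_ok_def)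
  have xn: "x < n" using x dominates_bounds by blast
  have fx: "finished x s" using f x by blast
  show ?thesis
  proof (cases "u \<rightarrow>\<^sup>* x")
    case False
    then have "words s ''reach'' (u * n + x) = 0" using finishedD(5)[OF fx u(1)] by simp
    moreover have "scan_inv u v X (setw ''x'' 0 x s)" using I by (subst scan_inv_cong[of _ s]) simp_all
    ultimately show ?thesis using False gs u v k x xn n_le_W by (simp add: scan_step_def)
  next
    case True
    then have r: "words s ''reach'' (u * n + x) \<noteq> 0" "reals s ''dist'' (u * n + x) = dst u x"
      using finishedD(2,3)[OF fx] by auto
    define cx where "cx = dst u x + wgt x v"
    define s1 where "s1 = setr ''c'' 0 cx (setw ''x'' 0 x s)"
    have s1: "words s1 ''x'' 0 = x" "reals s1 ''c'' 0 = cx" "words s1 ''num'' = num"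
      "words s1 ''found'' = words s ''found''" "words s1 ''t'' = words s ''t''" "reals s1 ''bc'' = reals s ''bc''"
      using gs by (auto simp: s1_def)
    have I1: "scan_inv u v X s1" using I by (subst scan_inv_cong[of _ s]) (simp_all add: s1_def)
    let ?s2 = "setw ''found'' 0 1 (setr ''bc'' 0 cx (setw ''t'' 0 x s1))"
    have "wp W (Cond better (Seq (Var_assign ''t'' (V ''x''))
             (Seq (RAssign ''bc'' (NLit 0) (RCell ''c'' (NLit 0))) (Var_assign ''found'' (NLit 1)))) Skip)
       (\<lambda>t s'. 3 + t \<le> 7 \<and> scan_inv u v (insert x X) s') s1"
    proof (cases "bval better s1")
      case True
      have "scan_inv u v (insert x X) ?s2"
      proof -
        have "X = {} \<or> (\<forall>y\<in>X. cx < dst u y + wgt y v \<or> cx = dst u y + wgt y v \<and> num x \<le> num y)"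
          using True I1 s1 unfolding better_def scan_inv_def by (fastforce split: if_splits)
        then show ?thesis using s1 by (auto simp: scan_inv_def cx_def)
      qed
      then show ?thesis using True s1 xn n_le_W by simp
    next
      case False
      have "scan_inv u v (insert x X) s1"
        using False I1 s1 unfolding better_def scan_inv_def cx_def by (auto split: if_splits)
      then show ?thesis using False by simp
    qed
    then show ?thesis unfolding scan_step_def using True gs u v k x xn n_le_W r wt_eq[OF g x(2)]
      by (simp add: s1_def cx_def)
  qed
qed

lemma wp_scan:
  assumes g: "graph_ok s" and u: "words s ''u'' 0 = u" and v: "words s ''v'' 0 = v"
    and f: "\<forall>x. x \<rightarrow> v \<longrightarrow> finished x s" and uv: "u \<rightarrow>\<^sup>+ v"
  shows "wp W scan (\<lambda>t s'. t \<le> in_degree G v * 9 + 3 \<and> words s' ''t'' 0 = prd u v) s"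
proof -
  have b: "u < n" "v < n" using reachable_bounds[of u v] uv by auto
  define x where "x k = words s ''inl'' (v * n + k)" for k
  define X where "X k = {y. \<exists>k'<k. y = x k' \<and> u \<rightarrow>\<^sup>* y}" for k
  have xs: "x ` {..<in_degree G v} = {y. y \<rightarrow> v}" using g b by (auto simp: graph_ok_def loaded_def x_def)
  have "wp W (For ''k'' (NCell ''indeg'' (V ''v'')) scan_step)
     (\<lambda>t s'. 1 + t \<le> in_degree G v * 9 + 3 \<and> words s' ''t'' 0 = prd u v) (setw ''found'' 0 0 s)"
  proof (rule wp_For[where n = "in_degree G v" and K = 7 and I = "\<lambda>k s. scan_inv u v (X k) s"], goal_cases)
    case (5 k s')
    have S: "same {''found'', ''k'', ''x'', ''t''} {''c'', ''bc''} s s'" using 5(2) by (auto simp: same_def)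
    have g': "graph_ok s'" by (rule graph_ok_same[OF S g]) auto
    have s': "words s' ''u'' 0 = u" "words s' ''v'' 0 = v" "words s' ''inl'' (v * n + k) = x k"
      using S u v by (auto simp: same_def x_def)
    have f': "\<forall>x. x \<rightarrow> v \<longrightarrow> finished x s'"
      using f finished_same_column[OF same_column_same[OF S]] by auto
    have xk: "x k \<rightarrow> v" using xs 5(1) by blast
    have "X (Suc k) = (if u \<rightarrow>\<^sup>* x k then insert (x k) (X k) else X k)"
      unfolding X_def less_Suc_eq by auto
    then have "wp W scan_step (\<lambda>t s'. t \<le> 7 \<and> scan_inv u v (X (Suc k)) s') s'"
      using wp_scan_step[OF g' b(1) s'(1) b(2) s'(2) f' 5(3) s'(3)[symmetric] xk 5(4)] by simp
    moreover have "scan_inv u v X (setw ''k'' 0 a s) = scan_inv u v X s" for X a s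
      by (rule scan_inv_cong) simp_all
    ultimately show ?case by (auto elim: wp_mono)
  next
    case (6 t s')
    let ?t = "words s' ''t'' 0"
    have X: "X (in_degree G v) = {y. y \<rightarrow> v \<and> u \<rightarrow>\<^sup>* y}" using xs unfolding X_def by blast
    have p: "prd u v \<in> X (in_degree G v)" using prdD[OF uv] X by blast
    then have ne: "X (in_degree G v) \<noteq> {}" by blast
    have t: "?t \<rightarrow> v" "u \<rightarrow>\<^sup>* ?t" "reals s' ''bc'' 0 = dst u ?t + wgt ?t v"
      and least: "reals s' ''bc'' 0 < dst u v \<or> reals s' ''bc'' 0 = dst u v \<and> num ?t \<le> num (prd u v)"
    proof -
      have *: "?t \<in> X (in_degree G v)" "reals s' ''bc'' 0 = dst u ?t + wgt ?t v"
        "\<forall>x\<in>X (in_degree G v). reals s' ''bc'' 0 < dst u x + wgt x v \<or>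
           reals s' ''bc'' 0 = dst u x + wgt x v \<and> num ?t \<le> num x"
        using 6(3) ne unfolding scan_inv_def by argo+
      show "?t \<rightarrow> v" "u \<rightarrow>\<^sup>* ?t" "reals s' ''bc'' 0 = dst u ?t + wgt ?t v" using * X by blast+
      show "reals s' ''bc'' 0 < dst u v \<or> reals s' ''bc'' 0 = dst u v \<and> num ?t \<le> num (prd u v)"
        using *(3) p unfolding prdD(3)[OF uv] by blast
    qed
    \<comment> \<open>Both \<open>?t\<close> and \<open>prd u v\<close> minimise the distance first
      and the number second.\<close>
    with prd_le[OF t(1,2)] have "num ?t = num (prd u v)" by auto
    then have "?t = prd u v" using num_inj t(1) prdD(1)[OF uv] dominates_bounds by (auto dest: inj_onD)
    then show ?case using 6(4) by simp
  qed (use g b v in_degree_le[of v] n_le_W in \<open>auto simp: same_def graph_ok_def loaded_def scan_inv_def X_def\<close>)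
  then show ?thesis by (simp add: scan_def)
qed

section \<open>Following a path until it meets the tree\<close>

definition walk_inv :: "nat \<Rightarrow> nat \<Rightarrow> nat \<Rightarrow> state \<Rightarrow> state \<Rightarrow> bool" where
  "walk_inv u v t s0 s \<longleftrightarrow> (let x = words s ''x'' 0 in
     graph_ok s \<and> words s ''v'' 0 = v \<and> words s ''t'' 0 = t \<and>
     (x = v \<or> x \<rightarrow>\<^sup>+ v \<and> prd x v = t) \<and>
     good v s \<and> v \<in> marked v s \<and> marked v s0 \<subseteq> marked v s \<and> closed_marks v {x} s \<and> u \<in> insert x (marked v s) \<and>
     finished t s \<and> (\<forall>a<n. a \<noteq> v \<longrightarrow> same_column a s0 s))"

text \<open>Each step marks one new vertex, so a potential of 8 per unmarked ancestor pays for all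
  walks towards \<open>v\<close> together. The tail \<open>t\<close> stays correct because all
  vertices of the path share the last arc.\<close>

lemma wp_walk_step:
  assumes I: "walk_inv u v t s0 s" and lt: "words s ''reach'' (words s ''x'' 0 * n + v) = 0"
  shows "wp W walk_step (\<lambda>\<tau> s'. walk_inv u v t s0 s' \<and> 1 + \<tau> + 8 * card (unmarked v s') \<le> 8 * card (unmarked v s)) s"
proof -
  define x where "x = words s ''x'' 0"
  have I': "graph_ok s" "words s ''v'' 0 = v" "words s ''t'' 0 = t" "x = v \<or> x \<rightarrow>\<^sup>+ v \<and> prd x v = t"
    "good v s" "v \<in> marked v s" "marked v s0 \<subseteq> marked v s" "closed_marks v {x} s" "u \<in> insert x (marked v s)"
    "finished t s" "\<forall>a<n. a \<noteq> v \<longrightarrow> same_column a s0 s"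
    using I by (auto simp: walk_inv_def Let_def x_def)
  have xnm: "x \<notin> marked v s" using lt by (simp add: marked_def x_def)
  then have xv: "x \<rightarrow>\<^sup>+ v" "prd x v = t" "x \<noteq> v" using I' by auto
  have t: "t \<rightarrow> v" "x \<rightarrow>\<^sup>* t" "dst x v = dst x t + wgt t v" using prdD[OF xv(1)] xv by auto
  then have tv: "t \<noteq> v" using num_mono by auto
  have b: "x < n" "v < n" "t < n" using reachable_bounds[OF t(2)] dominates_bounds[OF t(1)] by auto
  have n: "words s ''n'' 0 = n" using I' by (simp add: graph_ok_def)
  define y where "y = sc x v"
  have yn: "y < n" using nd.sc_reachable[OF xv(1)] reachable_bounds y_def by blast
  have dt: "reals s ''dist'' (x * n + t) = dst x t" and st: "x \<noteq> t \<Longrightarrow> words s ''succ'' (x * n + t) = sc x t"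
    using finishedD(3,4)[OF I'(10) t(2)] by auto
  \<comment> \<open>The recursion for successors, evaluated in the finished column of
    \<open>t\<close>.\<close>
  have y: "y = (if x = t then v else words s ''succ'' (x * n + t))"
    using nd.sc_eq[OF xv(1)] st xv(2) by (auto simp: y_def)
  define s' where "s' = setw ''x'' 0 y (setw ''succ'' (x * n + v) y (setr ''dist'' (x * n + v) (dst x v) (setw ''reach'' (x * n + v) 1 s)))"
  have S: "same {''x'', ''succ'', ''reach''} {''dist''} s s'" by (simp add: same_def s'_def)
  have g': "graph_ok s'" by (rule graph_ok_same[OF S I'(1)]) auto
  have col: "same_column a s s'" if "a < n" "a \<noteq> v" for a
    using that b by (auto simp: same_column_def s'_def row_major_eq_iff)
  have m': "marked v s' = insert x (marked v s)" using b by (auto simp: marked_def s'_def row_major_eq_iff)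
  have good': "good v s'" unfolding good_def m'
  proof
    fix z assume z: "z \<in> insert x (marked v s)"
    show "z \<rightarrow>\<^sup>* v \<and> reals s' ''dist'' (z * n + v) = dst z v \<and> (z \<noteq> v \<longrightarrow> words s' ''succ'' (z * n + v) = sc z v)"
    proof (cases "z = x")
      case True
      then show ?thesis using xv y_def by (auto simp: s'_def)
    next
      case False
      then have "z \<in> marked v s" using z by simp
      then show ?thesis using False I'(5) b by (auto simp: good_def s'_def row_major_eq_iff)
    qed
  qed
  have yv: "y = v \<or> y \<rightarrow>\<^sup>+ v \<and> prd y v = t"
    using nd.prd_sc[OF xv(1)] xv(2) by (auto simp: y_def)
  have cl: "closed_marks v {y} s'" using I'(8) unfolding closed_marks_def m' by (auto simp: y_def)
  have "walk_inv u v t s0 s'"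
  proof -
    have "\<forall>a<n. a \<noteq> v \<longrightarrow> same_column a s0 s'" using I'(11) col same_column_trans by blast
    moreover have "finished t s'" using finished_same_column[OF col[OF b(3) tv] I'(10)] .
    moreover have "words s' ''v'' 0 = v" "words s' ''t'' 0 = t" "words s' ''x'' 0 = y" using I' by (auto simp: s'_def)
    ultimately show ?thesis using g' yv good' cl I'(6,7,9) unfolding walk_inv_def Let_def m' by auto
  qed
  moreover have "card (unmarked v s) = Suc (card (unmarked v s'))"
  proof -
    have "unmarked v s = insert x (unmarked v s')" "x \<notin> unmarked v s'" using xnm xv by (auto simp: unmarked_def m')
    then show ?thesis using finite_unmarked by simp
  qed
  ultimately have fin: "walk_inv u v t s0 s' \<and> 1 + (1 + (1 + (2 + 1))) + 8 * card (unmarked v s') \<le> 8 * card (unmarked v s)" by simp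
  \<comment> \<open>The entry read from column \<open>t\<close> is not the one being written in
    column \<open>v\<close>.\<close>
  have neq: "x * n + t \<noteq> x * n + v" using tv by simp
  show ?thesis using n I'(2,3) x_def[symmetric] b dt t(3) wt_eq[OF I'(1) t(1)] n_le_W yn fin neq
    unfolding walk_step_def
    by (cases "x = t") (auto simp: y s'_def)
qed

text \<open>The root is marked beforehand and stops a walk that meets no earlier path. The loop can
  thus only end at a marked vertex, which makes the marks closed under successors again.\<close>

lemma wp_walk:
  assumes g: "graph_ok s" and u: "words s ''u'' 0 = u" and v: "words s ''v'' 0 = v"
    and t: "words s ''t'' 0 = prd u v" and uv: "u \<rightarrow>\<^sup>+ v" and f: "finished (prd u v) s"
    and m: "good v s" "v \<in> marked v s" "closed_marks v {} s"
  shows "wp W walk (\<lambda>\<tau> s'. \<tau> + 8 * card (unmarked v s') \<le> 8 * card (unmarked v s) + 2 \<and> good v s' \<and> marked v s \<subseteq> marked v s' \<and>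
     u \<in> marked v s' \<and> closed_marks v {} s' \<and> (\<forall>a<n. a \<noteq> v \<longrightarrow> same_column a s s')) s"
proof -
  define s1 where "s1 = setw ''x'' 0 u s"
  have b: "u < n" "v < n" using reachable_bounds[of u v] uv by auto
  have S: "same {''x''} {} s s1" by (simp add: same_def s1_def)
  have g1: "graph_ok s1" by (rule graph_ok_same[OF S g]) auto
  have col: "same_column a s s1" for a by (rule same_column_same[OF S]) auto
  have un: "unmarked v s1 = unmarked v s" and mk: "marked v s1 = marked v s"
    using unmarked_same_column[OF col] marked_same_column[OF col] by auto
  have cl: "closed_marks v {} s1" by (rule closed_marks_same_column[OF col m(3)])
  have "good v s1" "finished (prd u v) s1"
    by (rule good_same_column[OF col m(1)], rule finished_same_column[OF col f])
  then have I: "walk_inv u v (prd u v) s s1" using g1 v t uv m cl col unfolding walk_inv_def Let_def mk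
    by (auto simp: s1_def closed_marks_def)
  have "wp W (While (NLess (NCell ''reach'' (idx (V ''x'') (V ''v''))) (NLit 1)) walk_step)
    (\<lambda>\<tau> s'. 1 + \<tau> + 8 * card (unmarked v s') \<le> 8 * card (unmarked v s) + 2 \<and> good v s' \<and> marked v s \<subseteq> marked v s' \<and>
     u \<in> marked v s' \<and> closed_marks v {} s' \<and> (\<forall>a<n. a \<noteq> v \<longrightarrow> same_column a s s')) s1"
  proof (rule wp_While[where I = "walk_inv u v (prd u v) s" and \<Phi> = "\<lambda>s. 8 * card (unmarked v s)", OF I], goal_cases)
    case (1 s')
    then have "words s' ''reach'' (words s' ''x'' 0 * n + v) = 0" by (auto simp: walk_inv_def Let_def graph_ok_def)
    from wp_walk_step[OF 1(1) this] show ?case .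
  next
    case (2 \<tau> s')
    define x where "x = words s' ''x'' 0"
    have "x = v \<or> x \<rightarrow>\<^sup>+ v" using 2(1) by (auto simp: walk_inv_def Let_def x_def)
    then have "x < n" using b reachable_bounds[of x v] by auto
    then have "x \<in> marked v s'" using 2(1,2) by (auto simp: walk_inv_def Let_def graph_ok_def x_def marked_def)
    then show ?case using 2(1,3) unfolding walk_inv_def Let_def x_def[symmetric] closed_marks_def un by auto
  qed
  then show ?thesis using u b n_le_W by (simp add: walk_def s1_def)
qed

abbreviation leaf_set :: "nat \<Rightarrow> nat set" where
  "leaf_set v \<equiv> leaves (lex_tree w num v)"

lemma leaf_set: "finite (leaf_set v)" "card (leaf_set v) \<le> n"
proof -
  show "finite (leaf_set v)" by (rule nd.finite_leaves)
  have "leaf_set v \<subseteq> verts G" by (rule nd.leaves_subset)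
  then have "card (leaf_set v) \<le> card (verts G)" by (rule card_mono[OF finite_verts])
  then show "card (leaf_set v) \<le> n" by (simp add: verts_G)
qed

definition visit_inv :: "nat \<Rightarrow> state \<Rightarrow> nat \<Rightarrow> state \<Rightarrow> bool" where
  "visit_inv v s0 i s \<longleftrightarrow> good v s \<and> v \<in> marked v s \<and> closed_marks v {} s \<and>
     (\<forall>i'<i. ord i' \<rightarrow>\<^sup>* v \<longrightarrow> ord i' \<in> marked v s) \<and> (\<forall>a<n. a \<noteq> v \<longrightarrow> same_column a s0 s)"

text \<open>Position \<open>i\<close> carries number \<open>i + 1\<close>, so
  \<open>i < num y\<close> selects the leaves still to be visited. Each of them reserves one scan,
  at 9 steps per in-neighbour and a constant; each uncovered ancestor reserves one step of a
  walk.\<close>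

definition visit_pot :: "nat \<Rightarrow> nat \<Rightarrow> state \<Rightarrow> nat" where
  "visit_pot v i s = (in_degree G v * 9 + 10) * card {y \<in> leaf_set v. i < num y} + 8 * card (unmarked v s)"

text \<open>Ancestors are visited in topological order, so an ancestor that is still unmarked when it is
  visited has no predecessor in the tree: the expensive visits are those of leaves.\<close>

lemma unmarked_is_leaf:
  assumes I: "visit_inv v s0 i s" and i: "i < n" and u: "u = ord i" "u \<rightarrow>\<^sup>+ v" "u \<notin> marked v s"
  shows "u \<in> leaf_set v"
proof (rule nd.leaf_lex_tree[OF u(2)])
  fix x assume x: "x \<rightarrow>\<^sup>+ v"
  show "sc x v \<noteq> u"
  proof
    assume eq: "sc x v = u"
    have xn: "x < n" using x reachable_bounds[of x v] by auto
    have "num x < Suc i" using nd.num_sc[OF x] eq u(1) ord(2)[OF i] by simp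
    then have "num x - 1 < i" using num_bounds[OF xn] by linarith
    then have "x \<in> marked v s" using I x ord_num[OF xn] unfolding visit_inv_def by (metis reachable1_reachable)
    moreover have "x \<noteq> v" using nd.reachable1_neq[OF x] .
    ultimately have "u \<in> marked v s" using I eq unfolding visit_inv_def closed_marks_def by auto
    then show False using u(3) by simp
  qed
qed

lemma visit_pot_mono: "visit_pot v (Suc i) s \<le> visit_pot v i s"
proof -
  have "card {y \<in> leaf_set v. Suc i < num y} \<le> card {y \<in> leaf_set v. i < num y}"
    by (rule card_mono) (use leaf_set in auto)
  then show ?thesis by (auto simp: visit_pot_def intro: mult_le_mono2)
qed

lemma wp_visit:
  assumes g: "graph_ok s" and c: "columns n s" and i: "i < n" "words s ''i'' 0 = i" and j: "j < n" "words s ''j'' 0 = j"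
    and v: "v = ord j" "words s ''v'' 0 = v"
    and f: "\<forall>x. x \<rightarrow> v \<longrightarrow> finished x s" and I: "visit_inv v s0 i s"
  shows "wp W visit (\<lambda>t s'. visit_inv v s0 (Suc i) s' \<and> t + visit_pot v (Suc i) s' \<le> visit_pot v i s + 4) s"
proof -
  define u where "u = ord i"
  have b: "u < n" "v < n" using i j v ord by (auto simp: u_def)
  have gs: "words s ''n'' 0 = n" "words s ''ord'' i = u" using g i by (auto simp: graph_ok_def u_def)
  have RP: "words s ''RP'' (i * n + j) = (if u \<rightarrow>\<^sup>* v then 1 else 0)"
    using c i j reach_ord_iff[of i j] by (simp add: columns_def u_def v)
  consider (unreachable) "\<not> u \<rightarrow>\<^sup>* v" | (marked) "u \<rightarrow>\<^sup>* v" "u \<in> marked v s" | (new) "u \<rightarrow>\<^sup>* v" "u \<notin> marked v s"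
    by blast
  then show ?thesis
  proof cases
    case unreachable
    then have "visit_inv v s0 (Suc i) s" using I by (auto simp: visit_inv_def less_Suc_eq u_def)
    then show ?thesis using unreachable RP gs i j visit_pot_mono[of v i s] by (simp add: visit_def)
  next
    case marked
    define s1 where "s1 = setw ''u'' 0 u s"
    have col: "same_column a s s1" for a by (simp add: same_column_def s1_def)
    have "visit_inv v s0 (Suc i) s1"
      unfolding visit_inv_def
    proof (intro conjI)
      show "good v s1" "closed_marks v {} s1" using good_same_column[OF col] closed_marks_same_column[OF col] I
        by (auto simp: visit_inv_def)
      show "v \<in> marked v s1" "\<forall>i'<Suc i. ord i' \<rightarrow>\<^sup>* v \<longrightarrow> ord i' \<in> marked v s1"
        using I marked unfolding marked_same_column[OF col] by (auto simp: visit_inv_def less_Suc_eq u_def)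
      show "\<forall>a<n. a \<noteq> v \<longrightarrow> same_column a s0 s1" using I same_column_trans[OF _ col] by (auto simp: visit_inv_def)
    qed
    moreover have "visit_pot v (Suc i) s1 \<le> visit_pot v i s"
      using visit_pot_mono[of v i s] by (simp add: visit_pot_def unmarked_same_column[OF col])
    ultimately show ?thesis using marked RP gs i j v b n_le_W
      by (simp add: visit_def s1_def marked_def)
  next
    case new
    have "u \<noteq> v" using new I by (auto simp: visit_inv_def)
    then have uv: "u \<rightarrow>\<^sup>+ v" using new reachable_neq_reachable1 by blast
    have leaf: "u \<in> leaf_set v" by (rule unmarked_is_leaf[OF I i(1) u_def uv new(2)])
    \<comment> \<open>Advancing \<open>i\<close> by one releases exactly the reserve of the leaf
      \<open>u\<close>, which pays for this scan.\<close>
    have "{y \<in> leaf_set v. i < num y} = insert u {y \<in> leaf_set v. Suc i < num y}"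
    proof -
      have "y = u" if "y \<in> leaf_set v" "num y = Suc i" for y
      proof -
        have "y < n" using that nd.leaves_subset[of v] verts_G by auto
        then show ?thesis using that ord_num[of y] by (simp add: u_def)
      qed
      moreover have "i < num y \<longleftrightarrow> num y = Suc i \<or> Suc i < num y" for y by linarith
      moreover have "num u = Suc i" using ord(2)[OF i(1)] by (simp add: u_def)
      ultimately show ?thesis using leaf by blast
    qed
    moreover have "u \<notin> {y \<in> leaf_set v. Suc i < num y}" using ord(2)[OF i(1)] by (simp add: u_def)
    ultimately have card: "card {y \<in> leaf_set v. i < num y} = Suc (card {y \<in> leaf_set v. Suc i < num y})"
      using leaf_set by simp
    define s1 where "s1 = setw ''u'' 0 u s"
    have S1: "same {''u''} {} s s1" by (simp add: same_def s1_def)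
    have g1: "graph_ok s1" by (rule graph_ok_same[OF S1 g]) auto
    have col1: "same_column a s s1" for a by (simp add: same_column_def s1_def)
    have f1: "\<forall>x. x \<rightarrow> v \<longrightarrow> finished x s1" using f finished_same_column[OF col1] by blast
    have s1: "words s1 ''u'' 0 = u" "words s1 ''v'' 0 = v" using v by (auto simp: s1_def)
    have "wp W scan (\<lambda>t1. wp W walk (\<lambda>t2 s'. visit_inv v s0 (Suc i) s' \<and> 3 + (t1 + t2) + visit_pot v (Suc i) s' \<le> visit_pot v i s + 4)) s1"
    proof (rule wp_same[OF wp_scan[OF g1 s1 f1 uv]], elim conjE, goal_cases)
      case (1 t1 s2)
      have g2: "graph_ok s2" by (rule graph_ok_same[OF 1(1) g1]) auto
      have s2: "words s2 ''u'' 0 = u" "words s2 ''v'' 0 = v" using 1(1) s1 by (auto simp: same_def)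
      have col2: "same_column a s s2" for a
        by (rule same_column_trans[OF col1]) (rule same_column_same[OF 1(1)]; simp)
      have f2: "finished (prd u v) s2" using f prdD(1)[OF uv] finished_same_column[OF col2] by blast
      have m2: "good v s2" "v \<in> marked v s2" "closed_marks v {} s2"
        using I good_same_column[OF col2] closed_marks_same_column[OF col2] marked_same_column[OF col2]
        by (auto simp: visit_inv_def)
      show ?case
      proof (rule wp_mono[OF wp_walk[OF g2 s2 1(3) uv f2 m2]], elim conjE, intro conjI)
        fix t2 s' assume t2: "t2 + 8 * card (unmarked v s') \<le> 8 * card (unmarked v s2) + 2"
          and "good v s'" "u \<in> marked v s'" "closed_marks v {} s'"
          and sub: "marked v s2 \<subseteq> marked v s'" and o: "\<forall>a<n. a \<noteq> v \<longrightarrow> same_column a s2 s'"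
        moreover have "marked v s \<subseteq> marked v s'" using sub marked_same_column[OF col2] by simp
        moreover have "\<forall>a<n. a \<noteq> v \<longrightarrow> same_column a s0 s'"
          using o I same_column_trans[OF same_column_trans[OF _ col2]] by (auto simp: visit_inv_def)
        ultimately show "visit_inv v s0 (Suc i) s'"
          using I unfolding visit_inv_def less_Suc_eq u_def by blast
        show "3 + (t1 + t2) + visit_pot v (Suc i) s' \<le> visit_pot v i s + 4"
          using t2 1(2) unfolding visit_pot_def card unmarked_same_column[OF col2] by simp
      qed
    qed
    moreover have "words s ''reach'' (u * n + v) = 0" using new b by (simp add: marked_def)
    ultimately show ?thesis unfolding visit_def using new RP gs i j v b n_le_W
      by (simp add: s1_def add.assoc)
  qed
qed

lemma visit_pot_0: "visit_pot v 0 s \<le> 9 * (in_degree G v * card (leaf_set v)) + 18 * n"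
proof -
  have "card {y \<in> leaf_set v. 0 < num y} \<le> card (leaf_set v)" by (rule card_mono) (use leaf_set in auto)
  then have "(in_degree G v * 9 + 10) * card {y \<in> leaf_set v. 0 < num y} \<le> (in_degree G v * 9 + 10) * card (leaf_set v)"
    by (rule mult_le_mono2)
  also have "\<dots> \<le> 9 * (in_degree G v * card (leaf_set v)) + 10 * n"
    using leaf_set(2)[of v] by (simp add: algebra_simps)
  finally have "(in_degree G v * 9 + 10) * card {y \<in> leaf_set v. 0 < num y} \<le> 9 * (in_degree G v * card (leaf_set v)) + 10 * n" .
  moreover have "card (unmarked v s) \<le> card {..<n}"
    by (rule card_mono) (auto simp: unmarked_def dest: reachable_bounds)
  ultimately show ?thesis unfolding visit_pot_def by simp
qed

definition trees_inv :: "nat \<Rightarrow> state \<Rightarrow> bool" where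
  "trees_inv k s \<longleftrightarrow> (\<forall>j<k. finished (ord j) s) \<and> (\<forall>j. k \<le> j \<and> j < n \<longrightarrow> marked (ord j) s = {})"

text \<open>The in-neighbours of \<open>v\<close> precede it in the topological order, so their
  columns are finished when \<open>v\<close> is treated, and work on column \<open>v\<close> leaves
  them untouched.\<close>

lemma wp_target:
  assumes g: "graph_ok s" and c: "columns n s" and j: "j < n" "words s ''j'' 0 = j" and I: "trees_inv j s"
  shows "wp W target (\<lambda>t s'. trees_inv (Suc j) s' \<and>
     t \<le> 9 * (in_degree G (ord j) * card (leaf_set (ord j))) + 30 * n + 10) s"
proof -
  define v where "v = ord j"
  have vn: "v < n" using ord j by (simp add: v_def)
  have gs: "words s ''n'' 0 = n" "words s ''ord'' j = v" using g j by (auto simp: graph_ok_def v_def)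
  define s1 where "s1 = setr ''dist'' (v * n + v) 0 (setw ''reach'' (v * n + v) 1 (setw ''v'' 0 v s))"
  have S1: "same {''v'', ''reach''} {''dist''} s s1" by (simp add: same_def s1_def)
  have g1: "graph_ok s1" by (rule graph_ok_same[OF S1 g]) auto
  have c1: "columns n s1" using c S1 by (simp add: columns_def same_def)
  have s1: "words s1 ''v'' 0 = v" "words s1 ''j'' 0 = j" using j by (auto simp: s1_def)
  have col1: "same_column a s s1" if "a < n" "a \<noteq> v" for a
    using that vn by (auto simp: same_column_def s1_def row_major_eq_iff)
  have "marked v s = {}" using I j by (simp add: trees_inv_def v_def)
  then have m1: "marked v s1 = {v}" using vn by (auto simp: marked_def s1_def row_major_eq_iff)
  have good1: "good v s1" using vn verts_G nd.dst_self[of v] unfolding good_def m1 by (simp add: s1_def)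
  have f1: "finished x s1" if "x \<rightarrow> v" for x
  proof -
    have xn: "x < n" using dominates_bounds that by blast
    have "num x < Suc j" using num_mono[OF that] ord(2)[OF j(1)] by (simp add: v_def)
    then have "num x - 1 < j" using num_bounds[OF xn] by linarith
    then have "finished x s" using I ord_num[OF xn] unfolding trees_inv_def by metis
    moreover have "x \<noteq> v" using num_mono[OF that] by auto
    ultimately show ?thesis using finished_same_column[OF col1[OF xn]] by blast
  qed
  have "wp W (For ''i'' (V ''n'') visit) (\<lambda>t s'. trees_inv (Suc j) s' \<and>
     3 + t \<le> 9 * (in_degree G v * card (leaf_set v)) + 30 * n + 10) s1"
  proof (rule wp_For_potential[where n = n and K = 4 and I = "visit_inv v s1" and \<Phi> = "visit_pot v"], goal_cases)
    case 4
    have "same_column a s1 (setw ''i'' 0 0 s1)" for a by (simp add: same_column_def)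
    then show ?case using m1 good1
      by (auto simp: visit_inv_def good_def marked_def closed_marks_def same_column_def)
  next
    case (5 k s')
    have g': "graph_ok s'" by (rule graph_ok_same[OF 5(2) g1]) auto
    have s': "words s' ''v'' 0 = v" "words s' ''j'' 0 = j" using s1 5(2) by (auto simp: same_def)
    have c': "columns n s'" using c1 5(2) by (simp add: columns_def same_def)
    have f': "\<forall>x. x \<rightarrow> v \<longrightarrow> finished x s'"
    proof (intro allI impI)
      fix x assume x: "x \<rightarrow> v"
      then have "same_column x s1 s'" using 5(4) num_mono[OF x] dominates_bounds[OF x]
        unfolding visit_inv_def by (metis less_irrefl)
      then show "finished x s'" using f1[OF x] finished_same_column by blast
    qed
    have col: "same_column a s (setw ''i'' 0 (Suc k) s)" for a s by (simp add: same_column_def)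
    have eq: "visit_inv v s1 (Suc k) (setw ''i'' 0 (Suc k) s) = visit_inv v s1 (Suc k) s"
      "visit_pot v (Suc k) (setw ''i'' 0 (Suc k) s) = visit_pot v (Suc k) s" for s
      by (simp_all add: visit_inv_def good_def closed_marks_def marked_def same_column_def visit_pot_def unmarked_def)
    show ?case using wp_visit[OF g' c' 5(1,3) j(1) s'(2) v_def s'(1) f' 5(4)] unfolding eq .
  next
    case (6 t s')
    have m: "marked v s' = {u. u \<rightarrow>\<^sup>* v}"
    proof -
      have "u \<in> marked v s'" if "u \<rightarrow>\<^sup>* v" for u
      proof -
        have "u < n" using that reachable_bounds by blast
        then show ?thesis using 6(3) that ord_num[of u] num_bounds[of u] unfolding visit_inv_def
          by (metis One_nat_def Suc_le_eq Suc_pred)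
      qed
      then show ?thesis using 6(3) by (auto simp: visit_inv_def good_def)
    qed
    have "trees_inv (Suc j) s'"
    proof -
      have o: "same_column (ord a) s s'" if "a < n" "a \<noteq> j" for a
      proof -
        have "ord a \<noteq> v" "ord a < n" using that ord_inj[OF that(1) j(1)] ord by (auto simp: v_def)
        then show ?thesis using 6(3) same_column_trans[OF col1] unfolding visit_inv_def by blast
      qed
      have "finished (ord a) s'" if "a < Suc j" for a
      proof (cases "a = j")
        case True
        then show ?thesis using m 6(3) by (simp add: finished_def visit_inv_def v_def)
      next
        case False
        then show ?thesis using that o[of a] I j finished_same_column by (auto simp: trees_inv_def)
      qed
      moreover have "marked (ord a) s' = {}" if "Suc j \<le> a" "a < n" for a
        using that o[of a] I marked_same_column by (auto simp: trees_inv_def)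
      ultimately show ?thesis by (auto simp: trees_inv_def)
    qed
    moreover have "visit_pot v 0 (setw ''i'' 0 0 s1) \<le> 9 * (in_degree G v * card (leaf_set v)) + 18 * n"
      by (rule visit_pot_0)
    ultimately show ?case using 6(4) by simp
  qed (use g1 n_le_W in \<open>auto simp: same_def graph_ok_def\<close>)
  then show ?thesis unfolding target_def using gs j vn n_le_W
    by (simp add: s1_def v_def[symmetric])
qed

definition leaf_cost :: nat where
  "leaf_cost = (\<Sum>v<n. in_degree G v * card (leaf_set v))"

lemma wp_trees:
  assumes g: "graph_ok s" and c: "columns n s"
  shows "wp W trees (\<lambda>t s'. (\<forall>v<n. finished v s') \<and> t \<le> 9 * leaf_cost + 50 * (n * n) + 50 * n + 50) s"
  unfolding trees_def wp_Seq
proof (rule wp_fill[where get = "\<lambda>s. words s ''reach''" and g = "\<lambda>(i, j). i * n + j" and f = "\<lambda>_. 0"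
      and ?n1.0 = n and ?n2.0 = n and K = 1], goal_cases)
  case (12 t1 s1)
  have g1: "graph_ok s1" by (rule graph_ok_same[OF 12(1) g]) auto
  have c1: "columns n s1" using c 12(1) by (simp add: columns_def same_def)
  have "marked (ord j) s1 = {}" if "j < n" for j
    using filled_row_major[OF 12(2)] ord that by (auto simp: marked_def)
  then have I0: "trees_inv 0 (setw ''j'' 0 0 s1)" by (auto simp: trees_inv_def marked_def)
  show ?case
  proof (rule wp_For_potential[where n = n and K = "30 * n + 10" and I = trees_inv
        and \<Phi> = "\<lambda>k s. \<Sum>j\<in>{k..<n}. 9 * (in_degree G (ord j) * card (leaf_set (ord j)))", OF _ _ _ I0], goal_cases)
    case (4 k s')
    have g': "graph_ok s'" by (rule graph_ok_same[OF 4(2) g1]) auto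
    have c': "columns n s'" using c1 4(2) by (simp add: columns_def same_def)
    have eq: "trees_inv (Suc k) (setw ''j'' 0 (Suc k) s) = trees_inv (Suc k) s" for s
      by (simp add: trees_inv_def finished_def good_def marked_def)
    show ?case unfolding eq
      by (rule wp_mono[OF wp_target[OF g' c' 4(1,3,4)]]) (simp add: sum_tail_step[OF 4(1)])
  next
    case (5 t2 s')
    have "finished v s'" if "v < n" for v
      using 5(3) ord_num[OF that] num_bounds[OF that] unfolding trees_inv_def
      by (metis One_nat_def Suc_le_eq Suc_pred)
    moreover have "(\<Sum>j\<in>{0..<n}. 9 * (in_degree G (ord j) * card (leaf_set (ord j)))) = 9 * leaf_cost"
      using sum_ord[of "\<lambda>v. in_degree G v * card (leaf_set v)"]
      by (simp add: leaf_cost_def sum_distrib_left[symmetric] atLeast0LessThan)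
    ultimately show ?case using 5(4) 12(3) by (simp add: algebra_simps)
  qed (use g1 n_le_W in \<open>auto simp: same_def graph_ok_def\<close>)
qed (use g n_le_W row_major_inj0 in \<open>auto simp: same_def graph_ok_def\<close>)

end

section \<open>The running time\<close>

definition apsp :: "com \<Rightarrow> com" where
  "apsp c = Seq load (Seq topo (Seq (closure_prog c) trees))"

lemma vars_load: "wvars load = {''i'', ''j'', ''adj'', ''indeg'', ''e'', ''t'', ''h'', ''inl''}" "rvars load = {''wt''}"
  by (auto simp: load_def)

lemma vars_topo_prog: "wvars topo = {''q'', ''i'', ''k'', ''u'', ''j'', ''deg'', ''ord'', ''num''}" "rvars topo = {}"
  by (auto simp: topo_def)

context numbered_instance
begin

lemma encodes_solution:
  assumes f: "\<forall>v<n. finished v s" and nm: "words s ''num'' = num"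
  shows "encodes_apsp_solution s G w"
proof -
  have card: "card (verts G) = n" by (simp add: verts_G)
  have "\<mu> w u v = (if words s ''reach'' (u * n + v) = 0 then \<infinity> else ereal (reals s ''dist'' (u * n + v)))"
    if "u < n" "v < n" for u v
  proof (cases "u \<rightarrow>\<^sup>* v")
    case True
    then show ?thesis using finishedD(2,3)[of v s u] f that nd.mu_eq[OF True] by simp
  next
    case False
    then show ?thesis using finishedD(5)[of v s u] f that shortest_path_inf[OF False] by simp
  qed
  moreover have "arcs_ends (lex_tree w num v) = {(u, words s ''succ'' (u * n + v)) | u. u \<rightarrow>\<^sup>+ v}" if v: "v < n" for v
  proof -
    have fv: "finished v s" using f v by blast
    have "words s ''succ'' (u * n + v) = sc u v" if "u \<rightarrow>\<^sup>+ v" for u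
      using finishedD(4)[OF fv] that nd.reachable1_neq[OF that] by blast
    then show ?thesis unfolding nd.arcs_ends_lex_tree by auto
  qed
  ultimately show ?thesis unfolding encodes_apsp_solution_def Let_def card nm using num verts_G by simp
qed

end

context mm_program
begin

text \<open>\<open>mat_time\<close> as a function of \<open>n\<close> alone, so that it can be
  estimated independently of the graph and its numbering.\<close>

definition closure_time :: "nat \<Rightarrow> nat" where
  "closure_time n = 50 * (n * n) + 50 * n + 50 + (\<Sum>i<(LEAST l. n \<le> 2 ^ l).
    2 ^ (LEAST l. n \<le> 2 ^ l) div (2 * 2 ^ i) * (60 * (2 ^ i * 2 ^ i) + 2 * Mt (2 ^ i) + 2) + 3 + 1)"

text \<open>The exponent of the word bound is the larger of two demands: 4 for the program itself
  and \<open>d0\<close> for the embedded multiplication.\<close>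

lemma run_apsp:
  fixes G :: "(nat, nat) pre_digraph" and w :: "nat weight_fun"
  assumes G: "digraph G" "acyclic (arcs_ends G)" "encodes_graph s0 G w"
    and n: "n = card (verts G)" and m: "m = card (arcs G)"
  shows "\<exists>t s'. run ((n + 2) ^ max 4 d0) (apsp c0) s0 t s' \<and> encodes_apsp_solution s' G w \<and>
    t \<le> (overhead (mat_closure c0) + 100) * (min (closure_time n) (n * m + n * n) + n * n + n + 1) +
      9 * (\<Sum>v\<in>verts G. in_degree G v * card (leaves (wf_digraph.lex_tree G w (words s' ''num'') v))) +
      90 * (n * n) + 90 * n + 90"
proof -
  interpret digraph G by fact
  define W where "W = (n + 2) ^ max 4 d0"
  have Wb: "(n + 2) ^ 4 \<le> W" "(n + 2) ^ d0 \<le> W" unfolding W_def by (rule power_increasing; simp)+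
  have vG: "verts G = {..<n}" and aG: "arcs G = {..<m}" using G(3) n m by (auto simp: encodes_graph_def)
  interpret dag_instance G w n m W by unfold_locales (use vG aG G Wb in auto)
  have n0: "words s0 ''n'' 0 = n" "words s0 ''m'' 0 = m" using G(3) n m by (auto simp: encodes_graph_def)
  then have inp: "input_ok s0" using G(3) aG unfolding input_ok_def encodes_graph_def by blast
  define Q where "Q t s' \<longleftrightarrow> encodes_apsp_solution s' G w \<and>
    t \<le> (overhead (mat_closure c0) + 100) * (min (closure_time n) (n * m + n * n) + n * n + n + 1) +
      9 * (\<Sum>v\<in>verts G. in_degree G v * card (leaves (lex_tree w (words s' ''num'') v))) +
      90 * (n * n) + 90 * n + 90" for t s'
  have "wp W (apsp c0) Q s0"
    unfolding apsp_def wp_Seq_eta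
  proof (rule wp_same[OF wp_load[OF inp]], elim conjE, goal_cases)
    case (1 t1 s1)
    have n1: "words s1 ''n'' 0 = n" "words s1 ''m'' 0 = m" using 1(1) n0 by (auto simp: same_def vars_load)
    show ?case
    proof (rule wp_same[OF wp_topo[OF n1(1) 1(2)]], elim conjE, goal_cases)
      case (1 t2 s2)
      define num ord where "num = words s2 ''num''" and "ord = words s2 ''ord''"
      have n2: "words s2 ''n'' 0 = n" "words s2 ''m'' 0 = m" using 1(1) n1 by (auto simp: same_def vars_topo_prog)
      have l2: "loaded s2" using 1(1) \<open>loaded s1\<close> by (simp add: same_def vars_topo_prog loaded_def)
      have tk: "source_first_numbering num" "\<And>i. i < n \<Longrightarrow> ord i < n" "\<And>i. i < n \<Longrightarrow> num (ord i) = Suc i"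
        using 1(2) by (simp_all only: topo_ok_def num_def ord_def)
      \<comment> \<open>The numbering is known only now, as the contents of two arrays after this
        phase.\<close>
      interpret closure_instance G w n m W num ord c0 Mt d0
        by unfold_locales (rule tk Wb(2); assumption?)+
      have g2: "graph_ok s2" using n2 l2 unfolding graph_ok_def by (simp add: num_def ord_def)
      have mt: "mat_time = closure_time n"
        by (simp add: mat_time_def closure_time_def levels_time_def level_time_def dim_def lg_def)
      show ?case
      proof (rule wp_same[OF wp_closure_prog[OF g2]], elim conjE, goal_cases)
        case (1 t3 s3)
        have S3: "same (- {''n'', ''m'', ''adj'', ''indeg'', ''inl'', ''ord'', ''num''}) (- {''wt''}) s2 s3"
          by (rule same_mono[OF 1(1) wvars_closure_prog rvars_closure_prog]) auto
        have g3: "graph_ok s3" by (rule graph_ok_same[OF S3 g2]) auto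
        show ?case
        proof (rule wp_same[OF wp_trees[OF g3 1(2)]], elim conjE, goal_cases)
          case (1 t4 s4)
          have "words s4 ''num'' = words s3 ''num''" using 1(1) by (simp add: same_def trees_def)
          then have num4: "words s4 ''num'' = num" using g3 by (simp add: graph_ok_def)
          have lc: "leaf_cost = (\<Sum>v\<in>verts G. in_degree G v * card (leaves (lex_tree w (words s4 ''num'') v)))"
            by (simp add: leaf_cost_def verts_G num4)
          show ?case unfolding Q_def lc[symmetric]
            using encodes_solution[OF 1(2) num4] 1(3)
              \<open>t1 \<le> 20 * (n * n) + 20 * n + 20\<close> \<open>t2 \<le> 20 * (n * n) + 20 * n + 20\<close>
              \<open>t3 \<le> (overhead (mat_closure c0) + 100) * (min mat_time (n * m + n * n) + n * n + n + 1)\<close>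
            unfolding mt by simp
        qed
      qed
    qed
  qed
  then show ?thesis unfolding wp_def Q_def W_def by blast
qed

end

section \<open>Estimating the running time by the exponent\<close>

lemma sum_powers_le:
  fixes r :: real
  assumes "2 \<le> r"
  shows "(\<Sum>i<l. r ^ i) \<le> r ^ l"
proof (induction l)
  case (Suc l)
  have "(\<Sum>i<Suc l. r ^ i) \<le> 2 * r ^ l" using Suc by simp
  also have "\<dots> \<le> r * r ^ l" using assms by (intro mult_right_mono) auto
  finally show ?case by simp
qed simp

lemma square_le_powr: "1 \<le> x \<Longrightarrow> 2 \<le> \<tau> \<Longrightarrow> x * x \<le> x powr \<tau>" for x :: real
  using powr_mono[of 2 \<tau> x] by (simp add: powr_numeral power2_eq_square)

text \<open>At level \<open>i\<close> there are \<open>2 ^ (l - i - 1)\<close> products of size \<open>2 ^ i\<close>, so the costs of the levels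
  grow geometrically with ratio \<open>2 powr (\<tau> - 1) \<ge> 2\<close> and the last level dominates.\<close>

lemma (in mm_program) closure_time_bound:
  assumes Mt: "\<And>k. 1 \<le> k \<Longrightarrow> real (Mt k) \<le> D * real k powr \<tau>" and \<tau>: "2 \<le> \<tau>" and D: "1 \<le> D"
    and n: "1 \<le> n"
  shows "real (closure_time n) \<le> (154 + (64 + 2 * D) * 3 powr \<tau> + 4 * 3 powr \<tau>) * real n powr \<tau>"
proof -
  define l where "l = (LEAST l. n \<le> 2 ^ l)"
  define r where "r = (2 :: real) powr (\<tau> - 1)"
  define K where "K = 64 + 2 * D"
  have r: "2 \<le> r" unfolding r_def using \<tau> powr_mono[of 1 "\<tau> - 1" 2] by simp
  \<comment> \<open>Separates the factor \<open>2 ^ i\<close>, which cancels against the number of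
    blocks of a level.\<close>
  have pw: "(2 ^ i) powr \<tau> = 2 ^ i * r ^ i" for i :: nat
  proof -
    have "((2::real) ^ i) powr \<tau> = (2 powr real i) powr (1 + (\<tau> - 1))" by (simp add: powr_realpow)
    also have "\<dots> = 2 powr real i * (2 powr (\<tau> - 1)) powr real i"
      by (simp add: powr_powr powr_add[symmetric] algebra_simps)
    finally show ?thesis by (simp add: powr_realpow r_def)
  qed
  \<comment> \<open>Either \<open>l = 0\<close>, or minimality of \<open>l\<close> gives
    \<open>2 ^ (l - 1) < n\<close>; the factor 3 is ample in both cases.\<close>
  have le_l: "2 ^ l \<le> 3 * n"
  proof (cases l)
    case (Suc k)
    then have "\<not> n \<le> 2 ^ k" unfolding l_def by (intro not_less_Least) simp
    then show ?thesis using Suc by simp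
  qed (use n in simp)
  have lev: "real (2 ^ l div (2 * 2 ^ i) * (60 * (2 ^ i * 2 ^ i) + 2 * Mt (2 ^ i) + 2) + 3 + 1) \<le> K * 2 ^ l * r ^ i + 4" for i
  proof -
    have a: "real (2 ^ l div (2 * 2 ^ i)) \<le> 2 ^ l / 2 ^ i"
    proof -
      have "real (2 ^ l div (2 * 2 ^ i)) \<le> real (2 ^ l) / real (2 * 2 ^ i)" by (rule of_nat_div_le_of_nat)
      also have "\<dots> \<le> 2 ^ l / 2 ^ i" by (simp add: field_simps)
      finally show ?thesis .
    qed
    have one: "1 \<le> (2 ^ i) powr \<tau>" by (rule ge_one_powr_ge_zero) (use \<tau> in auto)
    have "real (2 ^ i) * real (2 ^ i) \<le> real (2 ^ i) powr \<tau>" by (rule square_le_powr) (use \<tau> in auto)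
    moreover have "real (Mt (2 ^ i)) \<le> D * real (2 ^ i) powr \<tau>" by (rule Mt) simp
    ultimately have "real (60 * (2 ^ i * 2 ^ i) + 2 * Mt (2 ^ i) + 2) \<le> 60 * (2 ^ i) powr \<tau> + 2 * (D * (2 ^ i) powr \<tau>) + 2"
      by simp
    \<comment> \<open>60 for the copying, \<open>2 * D\<close> for the two products, and 2 for the
      constant, as the power is at least 1; this is below the 64 + 2 D of \<open>K\<close>.\<close>
    also have "\<dots> \<le> K * (2 ^ i) powr \<tau>" using one by (simp add: K_def algebra_simps)
    finally have b: "real (60 * (2 ^ i * 2 ^ i) + 2 * Mt (2 ^ i) + 2) \<le> K * (2 ^ i) powr \<tau>" .
    have "real (2 ^ l div (2 * 2 ^ i)) * real (60 * (2 ^ i * 2 ^ i) + 2 * Mt (2 ^ i) + 2) \<le> (2 ^ l / 2 ^ i) * (K * (2 ^ i) powr \<tau>)"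
      by (rule mult_mono[OF a b]) auto
    also have "\<dots> = K * 2 ^ l * r ^ i" unfolding pw by simp
    finally show ?thesis by (simp only: of_nat_add of_nat_mult)
  qed
  have "real (\<Sum>i<l. 2 ^ l div (2 * 2 ^ i) * (60 * (2 ^ i * 2 ^ i) + 2 * Mt (2 ^ i) + 2) + 3 + 1) \<le> (\<Sum>i<l. K * 2 ^ l * r ^ i + 4)"
    unfolding of_nat_sum by (rule sum_mono) (rule lev)
  also have "\<dots> = K * 2 ^ l * (\<Sum>i<l. r ^ i) + 4 * real l" by (simp add: sum.distrib sum_distrib_left)
  also have "\<dots> \<le> K * 2 ^ l * r ^ l + 4 * (2 ^ l * r ^ l)"
  proof -
    \<comment> \<open>Absorbs the constant cost 4 of each of the \<open>l\<close> levels.\<close>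
    have "real l \<le> 2 ^ l" using of_nat_less_two_power[of l, where 'a = real] by simp
    also have "\<dots> \<le> 2 ^ l * r ^ l" using one_le_power[of r l] r by simp
    finally show ?thesis using sum_powers_le[OF r, of l] D by (intro add_mono mult_left_mono) (auto simp: K_def)
  qed
  also have "\<dots> = (K + 4) * (2 ^ l) powr \<tau>" unfolding pw by (simp add: algebra_simps)
  also have "\<dots> \<le> (K + 4) * (3 * real n) powr \<tau>"
  proof -
    have "(2::real) ^ l \<le> 3 * real n" using of_nat_mono[OF le_l, where 'a = real] by simp
    then show ?thesis using D \<tau> by (intro mult_left_mono powr_mono2) (auto simp: K_def)
  qed
  also have "\<dots> = (K + 4) * 3 powr \<tau> * real n powr \<tau>" by (simp add: powr_mult)
  finally have levels: "real (\<Sum>i<l. 2 ^ l div (2 * 2 ^ i) * (60 * (2 ^ i * 2 ^ i) + 2 * Mt (2 ^ i) + 2) + 3 + 1)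
    \<le> (K + 4) * 3 powr \<tau> * real n powr \<tau>" .
  have "real n * real n \<le> real n powr \<tau>" by (rule square_le_powr) (use n \<tau> in auto)
  moreover have "real n \<le> real n * real n" "1 \<le> real n * real n" using n by (auto simp: mult_ge1_I)
  ultimately have "real (50 * (n * n) + 50 * n + 50) \<le> 150 * real n powr \<tau>" by simp
  then have "real (closure_time n) \<le> 150 * real n powr \<tau> + (K + 4) * 3 powr \<tau> * real n powr \<tau>"
    using levels unfolding closure_time_def l_def[symmetric] of_nat_add[of "50 * (n * n) + 50 * n + 50"] by linarith
  also have "\<dots> \<le> (154 + (64 + 2 * D) * 3 powr \<tau> + 4 * 3 powr \<tau>) * real n powr \<tau>"
    by (simp add: K_def algebra_simps)
  finally show ?thesis .
qed

theorem theorem2: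
  fixes \<tau> :: real
  assumes "mm_omega < \<tau> \<or> (mm_omega \<in> mm_exponents \<and> \<tau> = mm_omega)"
  shows "\<exists>(c :: com) (C :: real) (d :: nat).
    \<forall>(G :: (nat, nat) pre_digraph) (w :: nat \<Rightarrow> real) (s :: state).
      digraph G \<and> acyclic (arcs_ends G) \<and> encodes_graph s G w \<longrightarrow>
      (\<exists>t s'. run ((card (verts G) + 2) ^ d) c s t s' \<and>
         encodes_apsp_solution s' G w \<and>
         (2 \<le> card (verts G) \<longrightarrow> real t \<le> C * apsp_bound \<tau> G w (words s' ''num'')))"
proof -
  \<comment> \<open>Only a member of \<open>mm_exponents\<close> comes with a program; its bound is
    weakened from \<open>\<tau>'\<close> to \<open>\<tau>\<close> at the end.\<close>
  obtain \<tau>' where \<tau>': "\<tau>' \<in> mm_exponents" "\<tau>' \<le> \<tau>" using ex_mm_exponent_le[OF assms] by blast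
  have two: "2 \<le> \<tau>'" by (rule mm_exponent_ge_2[OF \<tau>'(1)])
  obtain c0 C0 d0 where P: "\<And>n s. words s ''n'' 0 = n \<Longrightarrow>
     (\<exists>t s'. run ((n + 2) ^ d0) c0 s t s' \<and>
        (\<forall>i<n. \<forall>j<n. reals s' ''C'' (i * n + j) =
           (\<Sum>k<n. reals s ''A'' (i * n + k) * reals s ''B'' (k * n + j))) \<and>
        (1 \<le> n \<longrightarrow> real t \<le> C0 * real n powr \<tau>'))"
    using \<tau>'(1) unfolding mm_exponents_def by blast
  \<comment> \<open>Steps are natural numbers, so rounding down loses nothing.\<close>
  define Mt where "Mt k = nat \<lfloor>C0 * real k powr \<tau>'\<rfloor>" for k
  interpret mm_program c0 Mt d0
  proof
    fix s :: state and k assume "words s ''n'' 0 = k"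
    from P[OF this] obtain t s' where *: "run ((k + 2) ^ d0) c0 s t s'"
      "\<forall>i<k. \<forall>j<k. reals s' ''C'' (i * k + j) = (\<Sum>l<k. reals s ''A'' (i * k + l) * reals s ''B'' (l * k + j))"
      "1 \<le> k \<longrightarrow> real t \<le> C0 * real k powr \<tau>'" by blast
    have "1 \<le> k \<longrightarrow> t \<le> Mt k" using *(3) unfolding Mt_def by (auto simp: le_nat_floor)
    with * show "\<exists>t s'. run ((k + 2) ^ d0) c0 s t s' \<and>
     (\<forall>i<k. \<forall>j<k. reals s' ''C'' (i * k + j) = (\<Sum>l<k. reals s ''A'' (i * k + l) * reals s ''B'' (l * k + j))) \<and>
     (1 \<le> k \<longrightarrow> t \<le> Mt k)" by blast
  qed
  define D where "D = max 1 C0"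
  have Mt: "real (Mt k) \<le> D * real k powr \<tau>'" for k
  proof -
    have "real (Mt k) \<le> max 0 (C0 * real k powr \<tau>')" unfolding Mt_def by linarith
    also have "\<dots> \<le> D * real k powr \<tau>'" by (auto simp: D_def intro: mult_right_mono)
    finally show ?thesis .
  qed
  define K where "K = 154 + (64 + 2 * D) * 3 powr \<tau>' + 4 * 3 powr \<tau>'"
  define z where "z = real (overhead (mat_closure c0)) + 100"
  have "0 \<le> (64 + 2 * D) * 3 powr \<tau>'" unfolding D_def by (intro mult_nonneg_nonneg) auto
  then have K: "1 \<le> K" unfolding K_def by (smt (verit) powr_ge_zero)
  \<comment> \<open>\<open>K + 3\<close> stands for the closure bound \<open>K * B\<close> and the
    terms n^2, n and 1, each at most \<open>B\<close>. The 300 covers three times 90 from the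
    quadratic remainder and the factor 9 of the scans.\<close>
  define C where "C = z * (K + 3) + 300"
  have z: "100 \<le> z" by (simp add: z_def)
  show ?thesis
  proof (intro exI[where x = "apsp c0"], intro exI[where x = C], intro exI[where x = "max 4 d0"], intro allI impI)
    fix G :: "(nat, nat) pre_digraph" and w :: "nat \<Rightarrow> real" and s :: state
    assume "digraph G \<and> acyclic (arcs_ends G) \<and> encodes_graph s G w"
    then have G: "digraph G" "acyclic (arcs_ends G)" "encodes_graph s G w" by auto
    define n m where "n = card (verts G)" and "m = card (arcs G)"
    from run_apsp[OF G n_def m_def] obtain t s' where r: "run ((n + 2) ^ max 4 d0) (apsp c0) s t s'"
      "encodes_apsp_solution s' G w" and
      t: "t \<le> (overhead (mat_closure c0) + 100) * (min (closure_time n) (n * m + n * n) + n * n + n + 1) +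
      9 * (\<Sum>v\<in>verts G. in_degree G v * card (leaves (wf_digraph.lex_tree G w (words s' ''num'') v))) +
      90 * (n * n) + 90 * n + 90" by blast
    define L where "L = (\<Sum>v\<in>verts G. in_degree G v * card (leaves (wf_digraph.lex_tree G w (words s' ''num'') v)))"
    define B where "B = min (real n powr \<tau>) (real n * real m + real n ^ 2 * log 2 (real n))"
    have bound: "apsp_bound \<tau> G w (words s' ''num'') = B + real L"
      by (simp add: apsp_bound_def Let_def B_def L_def n_def m_def)
    have "real t \<le> C * apsp_bound \<tau> G w (words s' ''num'')" if n: "2 \<le> n"
    proof -
      have pw: "real n powr \<tau>' \<le> real n powr \<tau>" using \<tau>'(2) n by (intro powr_mono) auto
      have sq: "real n * real n \<le> real n powr \<tau>'" by (rule square_le_powr) (use n two in auto)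
      \<comment> \<open>From here n^2 is at most n^2 log n, so both the quadratic costs and the
        budget fit under the second argument of the minimum.\<close>
      have "1 \<le> log 2 (real n)" using n by simp
      then have lg: "real n * real n \<le> real n ^ 2 * log 2 (real n)"
        using mult_left_mono[of 1 "log 2 (real n)" "real n ^ 2"] by (simp add: power2_eq_square)
      have "0 \<le> real n * real m" by simp
      then have "real n * real n \<le> real n * real m + real n ^ 2 * log 2 (real n)" using lg by linarith
      then have B1: "real n * real n \<le> B" using sq pw by (simp add: B_def)
      have "real (closure_time n) \<le> K * real n powr \<tau>'" unfolding K_def
        by (rule closure_time_bound) (use Mt two n in \<open>auto simp: D_def\<close>)
      also have "\<dots> \<le> K * real n powr \<tau>" using pw K by (intro mult_left_mono) auto
      finally have c1: "real (closure_time n) \<le> K * real n powr \<tau>" .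
      have "real n * real m + real n * real n \<le> 1 * (real n * real m + real n ^ 2 * log 2 (real n))" using lg by simp
      also have "\<dots> \<le> K * (real n * real m + real n ^ 2 * log 2 (real n))" 
        using K \<open>1 \<le> log 2 (real n)\<close> by (intro mult_right_mono) auto
      finally have c2: "real n * real m + real n * real n \<le> K * (real n * real m + real n ^ 2 * log 2 (real n))" .
      \<comment> \<open>Thanks to the clock the closure obeys both bounds at once, so each argument
        of the minimum is treated separately.\<close>
      have min: "real (min (closure_time n) (n * m + n * n)) \<le> K * B"
      proof -
        have "real (min (closure_time n) (n * m + n * n)) \<le> K * real n powr \<tau>" using c1 by simp
        moreover have "real (min (closure_time n) (n * m + n * n)) \<le> K * (real n * real m + real n ^ 2 * log 2 (real n))"
        proof -
          have "real (min (closure_time n) (n * m + n * n)) \<le> real (n * m + n * n)" by (rule of_nat_mono) simp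
          then show ?thesis using c2 by simp
        qed
        ultimately show ?thesis unfolding B_def by (metis min_def)
      qed
      have n1: "real n \<le> real n * real n" "1 \<le> real n * real n" using n by (auto simp: mult_ge1_I)
      have "real t \<le> z * (real (min (closure_time n) (n * m + n * n)) + real n * real n + real n + 1) + 9 * real L
        + 90 * (real n * real n) + 90 * real n + 90"
        using of_nat_mono[OF t, where 'a = real] unfolding L_def[symmetric] z_def by (simp add: algebra_simps)
      also have "\<dots> \<le> z * (K * B + 3 * B) + 9 * real L + 270 * B"
      proof -
        have "real (min (closure_time n) (n * m + n * n)) + real n * real n + real n + 1 \<le> K * B + 3 * B"
          using min B1 n1 by linarith
        then have "z * (real (min (closure_time n) (n * m + n * n)) + real n * real n + real n + 1) \<le> z * (K * B + 3 * B)"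
          using z by (intro mult_left_mono) auto
        then show ?thesis using B1 n1 by linarith
      qed
      also have "\<dots> \<le> C * (B + real L)"
      proof -
        have "0 \<le> B" using B1 n1 by linarith
        have "0 \<le> z * (K + 3)" using z K by simp
        then have "9 * real L \<le> C * real L" unfolding C_def by (intro mult_right_mono) auto
        moreover have "z * (K * B + 3 * B) + 270 * B \<le> C * B" using \<open>0 \<le> B\<close> by (simp add: C_def algebra_simps)
        ultimately show ?thesis by (simp add: algebra_simps)
      qed
      finally show ?thesis unfolding bound .
    qed
    then show "\<exists>t s'. run ((card (verts G) + 2) ^ max 4 d0) (apsp c0) s t s' \<and>
         encodes_apsp_solution s' G w \<and>
         (2 \<le> card (verts G) \<longrightarrow> real t \<le> C * apsp_bound \<tau> G w (words s' ''num''))"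
      using r unfolding n_def by blast
  qed
qed

end
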